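(* There exists $\hat L>0$ such that for every $L\ge \hat L$, every $\mu\in(0,1)$ and every $n\in\mathbb{N}$ (with $n\ge 1$), setting $$C=3\mu+L\,n^{2/3}(1-\mu)^{2/3},$$ there exist four $n$-ejection-collision orbits ($n$-EC orbits) of the primary $P_1$ with Jacobi constant $C$ in the planar circular restricted three-body problem with mass parameter $\mu$, which can be characterized by: (i) two of them are $n$-EC orbits each of which is symmetric with respect to the $x$ axis; (ii) the other two are $n$-EC orbits that are symmetric one of the other with respect to the $x$ axis. The respective families are labelled $\alpha_n,\gamma_n$ (those in (i)) and $\beta_n,\delta_n$ (those in (ii)).
   Context: Planar circular restricted three-body problem (RTBP) with mass parameter $\mu\in(0,1)$, in rotating (synodical) coordinates: the primaries $P_1=(\mu,0)$ (mass $1-\mu$) and $P_2=(\mu-1,0)$ (mass $\mu$) are fixed and the massless particle $(x(t),y(t))$ satisfies $$\ddot x-2\dot y=\Omega_x(x,y),\qquad \ddot y+2\dot x=\Omega_y(x,y),$$ $$\Omega(x,y)=\tfrac12(x^2+y^2)+\frac{1-\mu}{r_1}+\frac{\mu}{r_2}+\tfrac12\mu(1-\mu),\quad r_1=\sqrt{(x-\mu)^2+y^2},\quad r_2=\sqrt{(x-\mu+1)^2+y^2}.$$ The Jacobi constant $C=2\Omega(x,y)-\dot x^2-\dot y^2$ is a first integral. Collisions with $P_1$ are regularized by the Levi-Civita change $x=\mu+u^2-v^2$, $y=2uv$, $dt/ds=4(u^2+v^2)$. For a fixed value of $C$ the regularized equations are smooth at $u=v=0$ ($'=d/ds$): $$u''-8(u^2+v^2)v'=\partial_u\big(4(u^2+v^2)\,\mathcal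 U\big),\qquad v''+8(u^2+v^2)u'=\partial_v\big(4(u^2+v^2)\,\mathcal U\big),\qquad \mathcal U=\Omega-\tfrac{C}{2},$$ with $\Omega$ expressed in $(u,v)$, and $u'^2+v'^2=8(u^2+v^2)\,\mathcal U$, so that $u'^2+v'^2=8(1-\mu)$ at $u=v=0$. The ejection orbits from $P_1$ are the solutions with $(u,v,u',v')(0)=(0,0,2\sqrt{2(1-\mu)}\cos\theta_0,2\sqrt{2(1-\mu)}\sin\theta_0)$; since $(u,v)$ and $(-u,-v)$ represent the same point of the $(x,y)$ plane, it suffices to take $\theta_0\in[0,\pi)$. An $n$-ejection-collision orbit ($n$-EC orbit) of $P_1$ is the orbit described by a particle that ejects from $P_1$ (starts at collision with $P_1$) and whose distance to $P_1$ reaches $n$ times a relative maximum before the particle collides with $P_1$. Symmetry of orbits with respect to the $x$ axis refers to their projections to the $(x,y)$ plane. *)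

theory Defs
  imports "HOL-Analysis.Analysis"
begin

definition r1 :: "real \<Rightarrow> real \<times> real \<Rightarrow> real" where
  "r1 \<mu> z = sqrt ((fst z - \<mu>)\<^sup>2 + (snd z)\<^sup>2)"

definition r2 :: "real \<Rightarrow> real \<times> real \<Rightarrow> real" where
  "r2 \<mu> z = sqrt ((fst z - \<mu> + 1)\<^sup>2 + (snd z)\<^sup>2)"

definition Omega :: "real \<Rightarrow> real \<times> real \<Rightarrow> real" where
  "Omega \<mu> z = ((fst z)\<^sup>2 + (snd z)\<^sup>2) / 2 + (1 - \<mu>) / r1 \<mu> z + \<mu> / r2 \<mu> z + \<mu> * (1 - \<mu>) / 2"

definition jacobi :: "real \<Rightarrow> real \<times> real \<Rightarrow> real \<times> real \<Rightarrow> real" where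
  "jacobi \<mu> z w = 2 * Omega \<mu> z - (fst w)\<^sup>2 - (snd w)\<^sup>2"

definition levi_civita :: "real \<Rightarrow> real \<Rightarrow> real \<Rightarrow> real \<times> real" where
  "levi_civita \<mu> u v = (\<mu> + u\<^sup>2 - v\<^sup>2, 2 * u * v)"

text \<open>
  The smooth extension to \<open>u = v = 0\<close> of \<open>4 (u\<^sup>2 + v\<^sup>2) (\<Omega> - C / 2)\<close>. Since \<open>r\<^sub>1 = u\<^sup>2 + v\<^sup>2\<close>,
  the singular term \<open>(1 - \<mu>) / r\<^sub>1\<close> contributes the constant \<open>4 (1 - \<mu>)\<close>; it has to be cancelled
  by hand because \<open>x / 0 = 0\<close>. See \<open>reg_potential_eq\<close> below.
\<close>
definition reg_potential :: "real \<Rightarrow> real \<Rightarrow> real \<Rightarrow> real \<Rightarrow> real" where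
  "reg_potential \<mu> C u v =
     (let z = levi_civita \<mu> u v in
      4 * (1 - \<mu>) + 4 * (u\<^sup>2 + v\<^sup>2) *
        (((fst z)\<^sup>2 + (snd z)\<^sup>2) / 2 + \<mu> / r2 \<mu> z + \<mu> * (1 - \<mu>) / 2 - C / 2))"

lemma r1_levi_civita: "r1 \<mu> (levi_civita \<mu> u v) = u\<^sup>2 + v\<^sup>2"
proof -
  have "(u\<^sup>2 - v\<^sup>2)\<^sup>2 + (2 * u * v)\<^sup>2 = (u\<^sup>2 + v\<^sup>2)\<^sup>2"
    by (simp add: power2_eq_square algebra_simps)
  then show ?thesis
    by (simp add: r1_def levi_civita_def)
qed

lemma reg_potential_eq:
  assumes "(u, v) \<noteq> (0, 0)"
  shows "reg_potential \<mu> C u v = 4 * (u\<^sup>2 + v\<^sup>2) * (Omega \<mu> (levi_civita \<mu> u v) - C / 2)"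
proof -
  have "4 * R * (a / R) = 4 * a" if "R \<noteq> 0" for R a :: real
    using that by simp
  moreover have "u\<^sup>2 + v\<^sup>2 \<noteq> 0"
    using assms by (simp add: sum_power2_eq_zero_iff)
  ultimately have "4 * (u\<^sup>2 + v\<^sup>2) * ((1 - \<mu>) / (u\<^sup>2 + v\<^sup>2)) = 4 * (1 - \<mu>)"
    by blast
  then show ?thesis
    unfolding reg_potential_def Omega_def Let_def r1_levi_civita
    by (simp only: algebra_simps)
qed

text \<open>
  \<open>p = u'\<close> and \<open>q = v'\<close> are derivatives with respect to the regularized time \<open>s\<close>. The condition on
  \<open>r2\<close> keeps the solution away from the other primary, where the equations are singular. The last
  conjunct says that the Jacobi constant of the solution is \<open>C\<close>, see \<open>jacobi_levi_civita\<close> below.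
\<close>
definition reg_solution ::
  "real \<Rightarrow> real \<Rightarrow> real \<Rightarrow> (real \<Rightarrow> real) \<Rightarrow> (real \<Rightarrow> real) \<Rightarrow> (real \<Rightarrow> real) \<Rightarrow> (real \<Rightarrow> real) \<Rightarrow> bool" where
  "reg_solution \<mu> C T u v p q \<longleftrightarrow>
     (\<forall>s\<in>{0..T}.
        r2 \<mu> (levi_civita \<mu> (u s) (v s)) \<noteq> 0 \<and>
        (u has_real_derivative p s) (at s within {0..T}) \<and>
        (v has_real_derivative q s) (at s within {0..T}) \<and>
        (p has_real_derivative
           8 * ((u s)\<^sup>2 + (v s)\<^sup>2) * q s + deriv (\<lambda>a. reg_potential \<mu> C a (v s)) (u s))
           (at s within {0..T}) \<and>
        (q has_real_derivative
           - 8 * ((u s)\<^sup>2 + (v s)\<^sup>2) * p s + deriv (\<lambda>b. reg_potential \<mu> C (u s) b) (v s))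
           (at s within {0..T}) \<and>
        (p s)\<^sup>2 + (q s)\<^sup>2 = 2 * reg_potential \<mu> C (u s) (v s))"

text \<open>
  The velocity below is the derivative of \<open>levi_civita \<mu> u v\<close> with respect to the physical time \<open>t\<close>,
  where \<open>dt / ds = 4 (u\<^sup>2 + v\<^sup>2)\<close>.
\<close>
lemma jacobi_levi_civita:
  assumes "(u, v) \<noteq> (0, 0)"
  shows "jacobi \<mu> (levi_civita \<mu> u v)
           ((2 * u * p - 2 * v * q) / (4 * (u\<^sup>2 + v\<^sup>2)), (2 * v * p + 2 * u * q) / (4 * (u\<^sup>2 + v\<^sup>2))) = C
         \<longleftrightarrow> p\<^sup>2 + q\<^sup>2 = 2 * reg_potential \<mu> C u v"
proof -
  define R where "R = u\<^sup>2 + v\<^sup>2"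
  have R: "R \<noteq> 0"
    using assms by (simp add: R_def sum_power2_eq_zero_iff)
  have "(2 * u * p - 2 * v * q)\<^sup>2 + (2 * v * p + 2 * u * q)\<^sup>2 = 4 * R * (p\<^sup>2 + q\<^sup>2)"
    by (simp add: R_def power2_eq_square algebra_simps)
  then have "((2 * u * p - 2 * v * q) / (4 * R))\<^sup>2 + ((2 * v * p + 2 * u * q) / (4 * R))\<^sup>2
      = 4 * R * (p\<^sup>2 + q\<^sup>2) / (4 * R)\<^sup>2"
    by (simp only: power_divide add_divide_distrib [symmetric])
  also have "\<dots> = (p\<^sup>2 + q\<^sup>2) / (4 * R)"
    using R by (simp add: power2_eq_square divide_simps)
  finally have *: "((2 * u * p - 2 * v * q) / (4 * R))\<^sup>2 + ((2 * v * p + 2 * u * q) / (4 * R))\<^sup>2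
      = (p\<^sup>2 + q\<^sup>2) / (4 * R)" .
  have "jacobi \<mu> (levi_civita \<mu> u v) ((2 * u * p - 2 * v * q) / (4 * R), (2 * v * p + 2 * u * q) / (4 * R))
      = 2 * Omega \<mu> (levi_civita \<mu> u v) - (p\<^sup>2 + q\<^sup>2) / (4 * R)"
    using * by (simp add: jacobi_def)
  moreover have "2 * Omega \<mu> (levi_civita \<mu> u v) - (p\<^sup>2 + q\<^sup>2) / (4 * R) = C
      \<longleftrightarrow> p\<^sup>2 + q\<^sup>2 = 2 * (4 * R * (Omega \<mu> (levi_civita \<mu> u v) - C / 2))"
    using R by (auto simp: field_simps)
  ultimately show ?thesis
    using reg_potential_eq [OF assms] by (simp add: R_def)
qed

definition ejection_collision ::
  "real \<Rightarrow> real \<Rightarrow> nat \<Rightarrow> real \<Rightarrow> real \<Rightarrow>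
   (real \<Rightarrow> real) \<Rightarrow> (real \<Rightarrow> real) \<Rightarrow> (real \<Rightarrow> real) \<Rightarrow> (real \<Rightarrow> real) \<Rightarrow> bool" where
  "ejection_collision \<mu> C n \<theta> T u v p q \<longleftrightarrow>
     0 < T \<and> reg_solution \<mu> C T u v p q \<and>
     u 0 = 0 \<and> v 0 = 0 \<and>
     p 0 = 2 * sqrt (2 * (1 - \<mu>)) * cos \<theta> \<and> q 0 = 2 * sqrt (2 * (1 - \<mu>)) * sin \<theta> \<and>
     (\<forall>s\<in>{0<..<T}. (u s, v s) \<noteq> (0, 0)) \<and>
     u T = 0 \<and> v T = 0 \<and>
     finite {s \<in> {0<..<T}. \<forall>\<^sub>F s' in at s.
       r1 \<mu> (levi_civita \<mu> (u s') (v s')) \<le> r1 \<mu> (levi_civita \<mu> (u s) (v s))} \<and>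
     card {s \<in> {0<..<T}. \<forall>\<^sub>F s' in at s.
       r1 \<mu> (levi_civita \<mu> (u s') (v s')) \<le> r1 \<mu> (levi_civita \<mu> (u s) (v s))} = n"

text \<open>
  An ejection-collision orbit is represented by its projection to the \<open>(x, y)\<close> plane, so that
  \<open>(u, v)\<close> and \<open>(-u, -v)\<close> give the same orbit.
\<close>
definition n_EC_orbit :: "real \<Rightarrow> real \<Rightarrow> nat \<Rightarrow> (real \<times> real) set \<Rightarrow> bool" where
  "n_EC_orbit \<mu> C n \<Gamma> \<longleftrightarrow>
     (\<exists>\<theta>\<in>{0..<pi}. \<exists>T u v p q. ejection_collision \<mu> C n \<theta> T u v p q \<and>
        \<Gamma> = (\<lambda>s. levi_civita \<mu> (u s) (v s)) ` {0..T})"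

definition reflect_x_axis :: "real \<times> real \<Rightarrow> real \<times> real" where
  "reflect_x_axis z = (fst z, - snd z)"

end

(*
  Near P1 put z = (u + i v) / A with A\<^sup>2 = 2 (1 - \<mu>) / c, c = C - 3 \<mu>, and rescale time by 2 sqrt c. The equations
  become a harmonic oscillator seen in a slowly rotating frame, with rotation of size \<epsilon> ~ 4 / (L^(3/2) n)
  and a tidal force of the second primary of size \<mu> \<epsilon>\<^sup>2 / 4. Over the n half periods of an n-EC orbit
  the total perturbation is O(L^(-3/2)), uniformly in \<mu> and n, which makes everything below uniform.

  A passage near the origin is a collision iff the angular momentum vanishes there. To leading order the
  tidal torque accumulated along the orbit ejected in direction \<theta> is a multiple of - sin (4 \<theta>). Its sign
  change at \<theta> = \<pi>/4 gives a collision after n half periods by the Poincare-Miranda theorem; this is the orbit \<beta>,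
  and \<delta> is its mirror image. Near \<theta> = 0 one shoots for a perpendicular crossing of the x axis at half time, and
  reversibility yields the symmetric orbit \<alpha>; multiplication by i, which changes the sign of the parameter
  a = A\<^sup>2 of the tide, gives \<gamma>.

  Collisions must not happen before the n-th passage. The frame rotation makes the torque per half period strictly
  monotone near \<theta> = 0 and \<theta> = \<pi>/4, so the angular momentum at multiples of \<pi> is a strictly convex or concave
  sequence; as it (almost) vanishes at both ends, it is bounded away from 0 in between.
*)
theory Submission
  imports Defs
begin

text \<open>With R = u^2 + v^2 and c = C - 3 \<mu> the regularized potential is 4 (1 - \<mu>) + 2
  R^3 - 2 c R + 4 \<mu> R W. The linear part of the attraction of the second primary cancels against
  the offset \<mu> of the barycentre in the centrifugal term; so the constants collect into 3 \<mu>
  and the tide W starts at second order. The obstacle is uniformity: \<mu> may be arbitrarily close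
  to 0 and n arbitrarily large. The torque carries the factor \<kappa> = \<mu> / 4, so every error
  in the angular momentum must carry it too, and the convexity of the sequence is only of size
  \<kappa> \<epsilon>^3. A collision time must therefore be located up to an error small against
  \<epsilon>. Comparison with the oscillator in the rotating frame is too coarse for this (error of
  order \<eta>); in the nonrotating frame the error is of second order. All smallness is measured by
  one number \<eta> that dominates \<epsilon> T and a. It depends only on the constant B of the
  tide, and the bound on L is 20 / \<eta>. The shooting equations are solved by signs on the
  boundary of a rectangle, without any derivative in \<theta>.\<close>

section \<open>The tidal force\<close>

text \<open>
  The potential of the second primary minus its expansion up to first order is \<open>W x = 1 / \<bar>1 + x\<bar> - 1 + Re x\<close>.
  With \<open>x = a z\<^sup>2\<close>, \<open>q = tide_arg a z\<close> and \<open>S = \<bar>1 + x\<bar> = sqrt (1 + a q)\<close> one has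
  \<open>W x / a\<^sup>2 = q\<^sup>2 tide_e S - \<bar>z\<bar>^4 / 2\<close>, which is regular at \<open>a = 0\<close>. The tidal force is the gradient of
  \<open>\<bar>z\<bar>\<^sup>2 W (a z\<^sup>2) / a\<^sup>2\<close>.
\<close>

definition tide_arg :: "real \<Rightarrow> complex \<Rightarrow> real" where
  "tide_arg a z = 2 * Re (z\<^sup>2) + a * (cmod z) ^ 4"

definition tide_root :: "real \<Rightarrow> complex \<Rightarrow> real" where
  "tide_root a z = sqrt (1 + a * tide_arg a z)"

definition tide_e :: "real \<Rightarrow> real" where
  "tide_e S = (S + 2) * inverse (2 * S * (S + 1)\<^sup>2)"

text \<open>For S^2 = 1 + a q the derivative of q^2 \<open>tide_e\<close> S in q is q
  \<open>tide_k\<close> S. The zero of S^2 - 1 is already cancelled, and \<open>inverse\<close>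
  replaces division so that the closure rules for products apply.\<close>

definition tide_k :: "real \<Rightarrow> real" where
  "tide_k S = (S\<^sup>2 + S + 1) * inverse (2 * S ^ 3 * (S + 1))"

text \<open>The difference quotient of \<open>tide_k\<close> between S^2 and 1, where
  \<open>tide_k\<close> is 3/4. It makes the factor a in the torque explicit.\<close>

definition tide_k1 :: "real \<Rightarrow> real" where
  "tide_k1 S = - (3 * S ^ 3 + 6 * S\<^sup>2 + 4 * S + 2) * inverse (4 * S ^ 3 * (S + 1)\<^sup>2)"

definition tide_force :: "real \<Rightarrow> complex \<Rightarrow> complex" where
  "tide_force a z =
     of_real (2 * (tide_arg a z)\<^sup>2 * tide_e (tide_root a z) - 3 * (cmod z) ^ 4) * z
     + of_real (4 * (cmod z)\<^sup>2 * tide_arg a z * tide_k (tide_root a z)) * (cnj z + of_real (a * (cmod z)\<^sup>2) * z)"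

definition tide_torque :: "real \<Rightarrow> complex \<Rightarrow> real" where
  "tide_torque a z = Im (cnj z * tide_force a z)"

text \<open>The coefficient of a in the exact splitting of the torque into its value at a = 0 and a
  remainder. In the bracket, 3/4 |z|^4 comes from the term a |z|^4 of \<open>tide_arg\<close>, the
  rest from \<open>tide_k1\<close>.\<close>

definition tide_torque1 :: "real \<Rightarrow> complex \<Rightarrow> real" where
  "tide_torque1 a z = - 4 * (cmod z)\<^sup>2 * Im (z\<^sup>2) *
     (3 / 4 * (cmod z) ^ 4 + (tide_arg a z)\<^sup>2 * tide_k1 (tide_root a z))"

lemma tide_e_eq: "S > 0 \<Longrightarrow> (S\<^sup>2 - 1)\<^sup>2 * tide_e S = 1 / S - 1 + (S\<^sup>2 - 1) / 2"
  using add_pos_pos[of S 1] unfolding tide_e_def inverse_eq_divide by (simp add: divide_simps) algebra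

lemma tide_k_eq: "S > 0 \<Longrightarrow> (S\<^sup>2 - 1) * tide_k S = (1 - 1 / S ^ 3) / 2"
  using add_pos_pos[of S 1] unfolding tide_k_def inverse_eq_divide by (simp add: divide_simps) algebra

lemma tide_k1_eq: "S > 0 \<Longrightarrow> tide_k S = 3 / 4 + (S\<^sup>2 - 1) * tide_k1 S"
  using add_pos_pos[of S 1] unfolding tide_k_def tide_k1_def inverse_eq_divide by (simp add: divide_simps) algebra

text \<open>These bounds give |a z^2| \<le> 1/8: in units of the distance of the primaries the
  particle stays well away from the second one, and the root S stays away from 0.\<close>

lemma tide_arg_bound:
  assumes "\<bar>a\<bar> \<le> 1 / 32" "cmod z \<le> 2"
  shows "\<bar>a * tide_arg a z\<bar> \<le> 9 / 32"
proof -
  have "\<bar>Re (z\<^sup>2)\<bar> \<le> cmod z ^ 2"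
    using abs_Re_le_cmod[of "z\<^sup>2"] by (simp add: norm_power)
  also have "\<dots> \<le> 2 ^ 2" using assms by (intro power_mono) auto
  finally have 1: "\<bar>Re (z\<^sup>2)\<bar> \<le> 4" by simp
  have "cmod z ^ 4 \<le> 2 ^ 4" using assms by (intro power_mono) auto
  then have "\<bar>a\<bar> * cmod z ^ 4 \<le> 1/32 * 2 ^ 4"
    using assms by (intro mult_mono) auto
  then have 2: "\<bar>a * cmod z ^ 4\<bar> \<le> 1/2" by (simp add: abs_mult)
  have "\<bar>tide_arg a z\<bar> \<le> 9" unfolding tide_arg_def using 1 2 by linarith
  then have "\<bar>a\<bar> * \<bar>tide_arg a z\<bar> \<le> 1/32 * 9"
    using assms by (intro mult_mono) auto
  then show ?thesis by (simp add: abs_mult)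
qed

lemma tide_root_bounds:
  assumes "\<bar>a\<bar> \<le> 1 / 32" "cmod z \<le> 2"
  shows "1 / 2 \<le> tide_root a z" "(tide_root a z)\<^sup>2 = 1 + a * tide_arg a z"
proof -
  have *: "1 / 4 \<le> 1 + a * tide_arg a z"
    using tide_arg_bound[OF assms] by linarith
  have "sqrt (1 / 4) \<le> sqrt (1 + a * tide_arg a z)"
    using * by (rule real_sqrt_le_mono)
  then show "1 / 2 \<le> tide_root a z" by (simp add: tide_root_def real_sqrt_divide)
  show "(tide_root a z)\<^sup>2 = 1 + a * tide_arg a z"
    using * by (simp add: tide_root_def)
qed

text \<open>Real multiples of z exert no torque, so only the \<open>cnj z\<close> part of the force
  survives.\<close>

lemma tide_torque_eq:
  "tide_torque a z = - 4 * (cmod z)\<^sup>2 * tide_arg a z * tide_k (tide_root a z) * Im (z\<^sup>2)"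
proof -
  define p where "p = 2 * (tide_arg a z)\<^sup>2 * tide_e (tide_root a z) - 3 * (cmod z) ^ 4"
  define q where "q = 4 * (cmod z)\<^sup>2 * tide_arg a z * tide_k (tide_root a z)"
  have "tide_torque a z = Im (cnj z * (of_real p * z + of_real q * (cnj z + of_real (a * (cmod z)\<^sup>2) * z)))"
    by (simp only: tide_torque_def tide_force_def p_def q_def)
  also have "\<dots> = - q * Im (z\<^sup>2)"
    by (simp add: power2_eq_square algebra_simps)
  finally show ?thesis by (simp add: q_def)
qed

lemma tide_torque_expand:
  assumes "\<bar>a\<bar> \<le> 1 / 32" "cmod z \<le> 2"
  shows "tide_torque a z = - 3 * (cmod z)\<^sup>2 * Im (z ^ 4) + a * tide_torque1 a z"
proof -
  have S: "tide_root a z > 0" using tide_root_bounds[OF assms] by linarith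
  have k: "tide_k (tide_root a z) = 3 / 4 + a * tide_arg a z * tide_k1 (tide_root a z)"
    using tide_k1_eq[OF S] tide_root_bounds(2)[OF assms] by simp
  have 4: "Im (z ^ 4) = 2 * Re (z\<^sup>2) * Im (z\<^sup>2)"
    by (simp add: power2_eq_square power4_eq_xxxx algebra_simps)
  show ?thesis
    unfolding tide_torque_eq k 4 tide_torque1_def
    by (simp add: tide_arg_def algebra_simps power2_eq_square)
qed

lemma tide_force_minus: "tide_force a (- z) = - tide_force a z"
  by (simp add: tide_force_def tide_arg_def tide_root_def algebra_simps)

lemma tide_force_cnj: "tide_force a (cnj z) = cnj (tide_force a z)"
proof -
  have 1: "tide_arg a (cnj z) = tide_arg a z" by (simp add: tide_arg_def power2_eq_square)
  have 2: "tide_root a (cnj z) = tide_root a z" by (simp add: tide_root_def 1)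
  show ?thesis unfolding tide_force_def 1 2 by simp
qed

lemma tide_torque_minus: "tide_torque a (- z) = tide_torque a z"
  by (simp add: tide_torque_def tide_force_minus)

text \<open>Multiplication by i turns z^2 into - z^2, which amounts to moving the second primary to
  the opposite side of the first one.\<close>

lemma tide_force_ii: "tide_force a (\<i> * z) = \<i> * tide_force (- a) z"
proof -
  have 1: "tide_arg a (\<i> * z) = - tide_arg (- a) z"
    by (simp add: tide_arg_def norm_mult power_mult_distrib)
  have 2: "tide_root a (\<i> * z) = tide_root (- a) z"
    by (simp add: tide_root_def 1)
  show ?thesis
    unfolding tide_force_def 1 2 by (simp add: norm_mult algebra_simps)
qed

text \<open>The potential |z|^2 W(a z^2) / a^2 taken with a = 1 at A z is A^6 times the one taken
  with a = A^2 at z; the gradient loses one factor A.\<close>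

lemma tide_force_scale:
  assumes "A > 0"
  shows "of_real (A ^ 5) * tide_force (A\<^sup>2) z = tide_force 1 (of_real A * z)"
proof -
  have 1: "tide_arg 1 (of_real A * z) = A\<^sup>2 * tide_arg (A\<^sup>2) z"
    by (simp add: tide_arg_def norm_mult power_mult_distrib algebra_simps power4_eq_xxxx power2_eq_square)
  have 2: "tide_root 1 (of_real A * z) = tide_root (A\<^sup>2) z"
    by (simp add: tide_root_def 1)
  have n: "cmod (of_real A * z) = A * cmod z" using assms by (simp add: norm_mult)
  show ?thesis
    unfolding tide_force_def 1 2 n
    by (simp add: algebra_simps power2_eq_square power4_eq_xxxx eval_nat_numeral)
qed

section \<open>Bounds and Lipschitz constants uniform in the tide parameter\<close>

text \<open>The constants must not depend on the parameter \<open>a\<close>, which tends to \<open>0\<close> with \<open>1 / L\<close>.\<close>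

definition unif_lip :: "(real \<Rightarrow> complex \<Rightarrow> 'b::real_normed_vector) \<Rightarrow> bool" where
  "unif_lip f \<longleftrightarrow> (\<exists>K\<ge>0. \<forall>a z w. \<bar>a\<bar> \<le> 1 / 32 \<longrightarrow> cmod z \<le> 2 \<longrightarrow> cmod w \<le> 2 \<longrightarrow>
     norm (f a z) \<le> K \<and> norm (f a z - f a w) \<le> K * cmod (z - w))"

lemma unif_lipI:
  assumes "\<And>a z. \<bar>a\<bar> \<le> 1 / 32 \<Longrightarrow> cmod z \<le> 2 \<Longrightarrow> norm (f a z) \<le> K"
    and "\<And>a z w. \<bar>a\<bar> \<le> 1 / 32 \<Longrightarrow> cmod z \<le> 2 \<Longrightarrow> cmod w \<le> 2 \<Longrightarrow> norm (f a z - f a w) \<le> K' * cmod (z - w)"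
  shows "unif_lip f"
  unfolding unif_lip_def
proof (intro exI[of _ "max 0 (max K K')"] conjI allI impI)
  fix a :: real and z w :: complex assume *: "\<bar>a\<bar> \<le> 1 / 32" "cmod z \<le> 2" "cmod w \<le> 2"
  show "norm (f a z) \<le> max 0 (max K K')" using assms(1)[OF *(1,2)] by linarith
  have "norm (f a z - f a w) \<le> K' * cmod (z - w)" by (rule assms(2)[OF *])
  also have "\<dots> \<le> max 0 (max K K') * cmod (z - w)" by (intro mult_right_mono) auto
  finally show "norm (f a z - f a w) \<le> max 0 (max K K') * cmod (z - w)" .
qed simp

lemma unif_lipE:
  assumes "unif_lip f"
  obtains K where "K \<ge> 0"
    "\<And>a z. \<bar>a\<bar> \<le> 1 / 32 \<Longrightarrow> cmod z \<le> 2 \<Longrightarrow> norm (f a z) \<le> K"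
    "\<And>a z w. \<bar>a\<bar> \<le> 1 / 32 \<Longrightarrow> cmod z \<le> 2 \<Longrightarrow> cmod w \<le> 2 \<Longrightarrow> norm (f a z - f a w) \<le> K * cmod (z - w)"
  using assms unfolding unif_lip_def by blast

named_theorems ulip

lemma unif_lip_const [ulip]: "unif_lip (\<lambda>a z. c)"
  by (rule unif_lipI[of _ "norm c" 0]) auto

lemma unif_lip_a [ulip]: "unif_lip (\<lambda>a z. a)"
  by (rule unif_lipI[of _ "1/32" 0]) auto

lemma unif_lip_id [ulip]: "unif_lip (\<lambda>a z. z)"
  by (rule unif_lipI[of _ 2 1]) auto

lemma unif_lip_bounded_linear:
  assumes "bounded_linear L" "unif_lip f"
  shows "unif_lip (\<lambda>a z. L (f a z))"
proof -
  interpret bounded_linear L by fact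
  obtain B where B: "B > 0" "\<And>x. norm (L x) \<le> norm x * B" using pos_bounded by blast
  obtain K where K: "K \<ge> 0"
    "\<And>a z. \<bar>a\<bar> \<le> 1 / 32 \<Longrightarrow> cmod z \<le> 2 \<Longrightarrow> norm (f a z) \<le> K"
    "\<And>a z w. \<bar>a\<bar> \<le> 1 / 32 \<Longrightarrow> cmod z \<le> 2 \<Longrightarrow> cmod w \<le> 2 \<Longrightarrow> norm (f a z - f a w) \<le> K * cmod (z - w)"
    using unif_lipE[OF assms(2)] by blast
  show ?thesis
  proof (rule unif_lipI[of _ "K * B" "K * B"])
    fix a :: real and z w :: complex assume *: "\<bar>a\<bar> \<le> 1 / 32" "cmod z \<le> 2" 
    show "norm (L (f a z)) \<le> K * B"
      using B(2)[of "f a z"] K(2)[OF *] B(1) by (meson mult_right_mono less_imp_le order_trans)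
    assume **: "cmod w \<le> 2"
    have "norm (L (f a z) - L (f a w)) \<le> norm (f a z - f a w) * B"
      using B(2)[of "f a z - f a w"] by (simp add: diff)
    also have "\<dots> \<le> K * cmod (z - w) * B"
      using K(3)[OF * **] B(1) by (intro mult_right_mono) auto
    finally show "norm (L (f a z) - L (f a w)) \<le> K * B * cmod (z - w)" by (simp add: mult_ac)
  qed
qed

lemma unif_lip_add [ulip]:
  assumes "unif_lip f" "unif_lip g"
  shows "unif_lip (\<lambda>a z. f a z + g a z)"
proof -
  obtain K where K: "K \<ge> 0"
    "\<And>a z. \<bar>a\<bar> \<le> 1 / 32 \<Longrightarrow> cmod z \<le> 2 \<Longrightarrow> norm (f a z) \<le> K"
    "\<And>a z w. \<bar>a\<bar> \<le> 1 / 32 \<Longrightarrow> cmod z \<le> 2 \<Longrightarrow> cmod w \<le> 2 \<Longrightarrow> norm (f a z - f a w) \<le> K * cmod (z - w)"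
    using unif_lipE[OF assms(1)] by blast
  obtain J where J: "J \<ge> 0"
    "\<And>a z. \<bar>a\<bar> \<le> 1 / 32 \<Longrightarrow> cmod z \<le> 2 \<Longrightarrow> norm (g a z) \<le> J"
    "\<And>a z w. \<bar>a\<bar> \<le> 1 / 32 \<Longrightarrow> cmod z \<le> 2 \<Longrightarrow> cmod w \<le> 2 \<Longrightarrow> norm (g a z - g a w) \<le> J * cmod (z - w)"
    using unif_lipE[OF assms(2)] by blast
  show ?thesis
  proof (rule unif_lipI[of _ "K + J" "K + J"])
    fix a :: real and z w :: complex assume *: "\<bar>a\<bar> \<le> 1 / 32" "cmod z \<le> 2" 
    show "norm (f a z + g a z) \<le> K + J"
      using K(2)[OF *] J(2)[OF *] norm_triangle_ineq[of "f a z" "g a z"] by linarith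
    assume **: "cmod w \<le> 2"
    have "norm (f a z + g a z - (f a w + g a w)) \<le> norm (f a z - f a w) + norm (g a z - g a w)"
      by (rule norm_diff_triangle_ineq)
    then show "norm (f a z + g a z - (f a w + g a w)) \<le> (K + J) * cmod (z - w)"
      using K(3)[OF * **] J(3)[OF * **] by (simp add: distrib_right)
  qed
qed

lemma unif_lip_mult [ulip]:
  fixes f g :: "real \<Rightarrow> complex \<Rightarrow> 'b::real_normed_algebra"
  assumes "unif_lip f" "unif_lip g"
  shows "unif_lip (\<lambda>a z. f a z * g a z)"
proof -
  obtain K where K: "K \<ge> 0"
    "\<And>a z. \<bar>a\<bar> \<le> 1 / 32 \<Longrightarrow> cmod z \<le> 2 \<Longrightarrow> norm (f a z) \<le> K"
    "\<And>a z w. \<bar>a\<bar> \<le> 1 / 32 \<Longrightarrow> cmod z \<le> 2 \<Longrightarrow> cmod w \<le> 2 \<Longrightarrow> norm (f a z - f a w) \<le> K * cmod (z - w)"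
    using unif_lipE[OF assms(1)] by blast
  obtain J where J: "J \<ge> 0"
    "\<And>a z. \<bar>a\<bar> \<le> 1 / 32 \<Longrightarrow> cmod z \<le> 2 \<Longrightarrow> norm (g a z) \<le> J"
    "\<And>a z w. \<bar>a\<bar> \<le> 1 / 32 \<Longrightarrow> cmod z \<le> 2 \<Longrightarrow> cmod w \<le> 2 \<Longrightarrow> norm (g a z - g a w) \<le> J * cmod (z - w)"
    using unif_lipE[OF assms(2)] by blast
  show ?thesis
  proof (rule unif_lipI[of _ "K * J" "2 * K * J"])
    fix a :: real and z w :: complex assume *: "\<bar>a\<bar> \<le> 1 / 32" "cmod z \<le> 2" 
    have "norm (f a z * g a z) \<le> norm (f a z) * norm (g a z)" by (rule norm_mult_ineq)
    also have "\<dots> \<le> K * J"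
      using K(2)[OF *] J(2)[OF *] K(1) by (intro mult_mono) auto
    finally show "norm (f a z * g a z) \<le> K * J" .
    assume **: "cmod w \<le> 2"
    have "f a z * g a z - f a w * g a w = (f a z - f a w) * g a z + f a w * (g a z - g a w)"
      by (simp add: algebra_simps)
    then have "norm (f a z * g a z - f a w * g a w)
        \<le> norm (f a z - f a w) * norm (g a z) + norm (f a w) * norm (g a z - g a w)"
      by (simp only:) (rule order_trans[OF norm_triangle_ineq add_mono[OF norm_mult_ineq norm_mult_ineq]])
    also have "\<dots> \<le> (K * cmod (z - w)) * J + K * (J * cmod (z - w))"
      using K J *(1,2) ** by (intro add_mono mult_mono) (auto intro: mult_nonneg_nonneg)
    finally show "norm (f a z * g a z - f a w * g a w) \<le> 2 * K * J * cmod (z - w)"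
      by (simp add: algebra_simps)
  qed
qed

lemma unif_lip_uminus [ulip]: "unif_lip f \<Longrightarrow> unif_lip (\<lambda>a z. - f a z)"
  using unif_lip_bounded_linear[of "\<lambda>x. - x" f] bounded_linear_minus[OF bounded_linear_ident] by auto

lemma unif_lip_diff [ulip]: "unif_lip f \<Longrightarrow> unif_lip g \<Longrightarrow> unif_lip (\<lambda>a z. f a z - g a z)"
  using unif_lip_add[of f "\<lambda>a z. - g a z"] unif_lip_uminus[of g] by auto

lemma unif_lip_Re [ulip]: "unif_lip f \<Longrightarrow> unif_lip (\<lambda>a z. Re (f a z))"
  by (rule unif_lip_bounded_linear[OF bounded_linear_Re])

lemma unif_lip_Im [ulip]: "unif_lip f \<Longrightarrow> unif_lip (\<lambda>a z. Im (f a z))"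
  by (rule unif_lip_bounded_linear[OF bounded_linear_Im])

lemma unif_lip_cnj [ulip]: "unif_lip f \<Longrightarrow> unif_lip (\<lambda>a z. cnj (f a z))"
  by (rule unif_lip_bounded_linear[OF bounded_linear_cnj])

lemma unif_lip_of_real [ulip]: "unif_lip f \<Longrightarrow> unif_lip (\<lambda>a z. complex_of_real (f a z))"
  by (rule unif_lip_bounded_linear[OF bounded_linear_of_real])

lemma unif_lip_power [ulip]:
  fixes f :: "real \<Rightarrow> complex \<Rightarrow> 'b::real_normed_algebra_1"
  shows "unif_lip f \<Longrightarrow> unif_lip (\<lambda>a z. f a z ^ m)"
  by (induction m) (auto intro: ulip)

lemma unif_lip_cmod [ulip]: "unif_lip (\<lambda>a z. cmod z)"
  by (rule unif_lipI[of _ 2 1]) (auto simp: norm_triangle_ineq3)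

text \<open>The lower bound c cannot be found by structural rules; hence this lemma and the one for
  the square root stay outside \<open>ulip\<close> and are applied by hand.\<close>

lemma unif_lip_inverse:
  fixes f :: "real \<Rightarrow> complex \<Rightarrow> real"
  assumes "unif_lip f" "c > 0" "\<And>a z. \<bar>a\<bar> \<le> 1 / 32 \<Longrightarrow> cmod z \<le> 2 \<Longrightarrow> c \<le> f a z"
  shows "unif_lip (\<lambda>a z. inverse (f a z))"
proof -
  obtain K where K: "K \<ge> 0"
    "\<And>a z. \<bar>a\<bar> \<le> 1 / 32 \<Longrightarrow> cmod z \<le> 2 \<Longrightarrow> norm (f a z) \<le> K"
    "\<And>a z w. \<bar>a\<bar> \<le> 1 / 32 \<Longrightarrow> cmod z \<le> 2 \<Longrightarrow> cmod w \<le> 2 \<Longrightarrow> norm (f a z - f a w) \<le> K * cmod (z - w)"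
    using unif_lipE[OF assms(1)] by blast
  show ?thesis
  proof (rule unif_lipI[of _ "inverse c" "K * (inverse c * inverse c)"])
    fix a :: real and z w :: complex assume *: "\<bar>a\<bar> \<le> 1 / 32" "cmod z \<le> 2" 
    show 1: "norm (inverse (f a z)) \<le> inverse c"
      using assms(3)[OF *] \<open>c > 0\<close> by (auto intro!: le_imp_inverse_le)
    assume **: "cmod w \<le> 2"
    have 2: "norm (inverse (f a w)) \<le> inverse c"
      using assms(3)[OF *(1) **] \<open>c > 0\<close> by (auto intro!: le_imp_inverse_le)
    have "inverse (f a z) - inverse (f a w) = - (f a z - f a w) * (inverse (f a z) * inverse (f a w))"
      using assms(3)[OF *] assms(3)[OF *(1) **] \<open>c > 0\<close> by (simp add: field_simps)
    then have "norm (inverse (f a z) - inverse (f a w)) = norm (f a z - f a w) * (norm (inverse (f a z)) * norm (inverse (f a w)))"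
      by (simp add: abs_mult abs_minus_commute)
    also have "\<dots> \<le> (K * cmod (z - w)) * (inverse c * inverse c)"
      using K(3)[OF * **] K(1) 1 2 \<open>c > 0\<close> by (intro mult_mono) auto
    finally show "norm (inverse (f a z) - inverse (f a w)) \<le> K * (inverse c * inverse c) * cmod (z - w)"
      by (simp add: mult_ac)
  qed
qed

lemma unif_lip_sqrt:
  fixes f :: "real \<Rightarrow> complex \<Rightarrow> real"
  assumes "unif_lip f" "c > 0" "\<And>a z. \<bar>a\<bar> \<le> 1 / 32 \<Longrightarrow> cmod z \<le> 2 \<Longrightarrow> c \<le> f a z"
  shows "unif_lip (\<lambda>a z. sqrt (f a z))"
proof -
  obtain K where K: "K \<ge> 0"
    "\<And>a z. \<bar>a\<bar> \<le> 1 / 32 \<Longrightarrow> cmod z \<le> 2 \<Longrightarrow> norm (f a z) \<le> K"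
    "\<And>a z w. \<bar>a\<bar> \<le> 1 / 32 \<Longrightarrow> cmod z \<le> 2 \<Longrightarrow> cmod w \<le> 2 \<Longrightarrow> norm (f a z - f a w) \<le> K * cmod (z - w)"
    using unif_lipE[OF assms(1)] by blast
  show ?thesis
  proof (rule unif_lipI[of _ "sqrt K" "K * inverse (sqrt c)"])
    fix a :: real and z w :: complex assume *: "\<bar>a\<bar> \<le> 1 / 32" "cmod z \<le> 2" 
    show "norm (sqrt (f a z)) \<le> sqrt K"
      using assms(3)[OF *] \<open>c > 0\<close> K(2)[OF *] by auto
    assume **: "cmod w \<le> 2"
    have p: "f a z > 0" "f a w > 0" using assms(3)[OF *] assms(3)[OF *(1) **] \<open>c > 0\<close> by auto
    have d: "sqrt c \<le> sqrt (f a z) + sqrt (f a w)"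
      using real_sqrt_le_mono[OF assms(3)[OF *]] p by (simp add: add_increasing2)
    have "(sqrt (f a z) - sqrt (f a w)) * (sqrt (f a z) + sqrt (f a w)) = f a z - f a w"
      using p by (simp add: algebra_simps)
    moreover have "sqrt (f a z) + sqrt (f a w) > 0" using p by (simp add: add_pos_pos)
    ultimately have "norm (sqrt (f a z) - sqrt (f a w)) * (sqrt (f a z) + sqrt (f a w)) = norm (f a z - f a w)"
      by (metis abs_mult abs_of_pos real_norm_def)
    then have "norm (sqrt (f a z) - sqrt (f a w)) * sqrt c \<le> K * cmod (z - w)"
      using mult_left_mono[OF d, of "norm (sqrt (f a z) - sqrt (f a w))"] K(3)[OF * **] by simp
    then show "norm (sqrt (f a z) - sqrt (f a w)) \<le> K * inverse (sqrt c) * cmod (z - w)"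
      using \<open>c > 0\<close> by (simp add: field_simps)
  qed
qed

lemma unif_lip_tide_arg [ulip]: "unif_lip tide_arg"
  unfolding tide_arg_def[abs_def] by (intro ulip)

lemma unif_lip_tide_root [ulip]: "unif_lip tide_root"
  unfolding tide_root_def[abs_def]
proof (rule unif_lip_sqrt[of _ "1/4"])
  show "unif_lip (\<lambda>a z. 1 + a * tide_arg a z)" by (intro ulip)
  show "1 / 4 \<le> 1 + a * tide_arg a z" if "\<bar>a\<bar> \<le> 1 / 32" "cmod z \<le> 2" for a z
    using tide_arg_bound[OF that] by linarith
qed simp

lemma unif_lip_inverse_poly:
  assumes "m > 0"
  shows "unif_lip (\<lambda>a z. inverse (m * tide_root a z ^ i * (tide_root a z + 1) ^ j))"
proof (rule unif_lip_inverse[of _ "m * (1/2) ^ i * 1 ^ j"])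
  fix a :: real and z :: complex assume *: "\<bar>a\<bar> \<le> 1 / 32" "cmod z \<le> 2"
  show "m * (1 / 2) ^ i * 1 ^ j \<le> m * tide_root a z ^ i * (tide_root a z + 1) ^ j"
    using tide_root_bounds(1)[OF *] assms by (intro mult_mono power_mono) auto
qed (use assms in \<open>auto intro!: ulip\<close>)

lemma unif_lip_tide_e [ulip]: "unif_lip (\<lambda>a z. tide_e (tide_root a z))"
  unfolding tide_e_def
  by (intro ulip unif_lip_inverse_poly[of 2 1 2, simplified power_one_right]) simp

lemma unif_lip_tide_k [ulip]: "unif_lip (\<lambda>a z. tide_k (tide_root a z))"
  unfolding tide_k_def
  by (intro ulip unif_lip_inverse_poly[of 2 3 1, simplified power_one_right]) simp

lemma unif_lip_tide_k1 [ulip]: "unif_lip (\<lambda>a z. tide_k1 (tide_root a z))"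
  unfolding tide_k1_def
  by (intro ulip unif_lip_inverse_poly[of 4 3 2, simplified power_one_right]) simp

lemma unif_lip_tide_force [ulip]: "unif_lip tide_force"
  unfolding tide_force_def[abs_def] by (intro ulip)

lemma unif_lip_tide_torque [ulip]: "unif_lip tide_torque"
  unfolding tide_torque_def[abs_def] by (intro ulip)

lemma unif_lip_tide_torque1 [ulip]: "unif_lip tide_torque1"
  unfolding tide_torque1_def[abs_def] by (intro ulip)

section \<open>Ordinary differential equations\<close>

text \<open>Continuity in each variable separately gives joint continuity when the Lipschitz
  constant in the second variable is independent of the first. A Picard iterate has such a constant:
  the bound M of the field.\<close>

lemma continuous_on_Times_lipschitz:
  fixes F :: "'p::metric_space \<Rightarrow> real \<Rightarrow> 'a::real_normed_vector"
  assumes c: "\<And>\<tau>. \<tau> \<in> I \<Longrightarrow> continuous_on P (\<lambda>p. F p \<tau>)"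
    and l: "\<And>p \<tau> \<sigma>. p \<in> P \<Longrightarrow> \<tau> \<in> I \<Longrightarrow> \<sigma> \<in> I \<Longrightarrow> norm (F p \<tau> - F p \<sigma>) \<le> M * \<bar>\<tau> - \<sigma>\<bar>"
  shows "continuous_on (P \<times> I) (\<lambda>x. F (fst x) (snd x))"
  unfolding continuous_on_iff
proof (intro ballI allI impI)
  fix x and e :: real assume x: "x \<in> P \<times> I" and e: "e > 0"
  obtain p \<tau> where xp: "x = (p, \<tau>)" "p \<in> P" "\<tau> \<in> I" using x by auto
  obtain d where d: "d > 0" "\<And>q. q \<in> P \<Longrightarrow> dist q p < d \<Longrightarrow> dist (F q \<tau>) (F p \<tau>) < e / 2"
    using c[OF xp(3)] xp(2) e unfolding continuous_on_iff by (meson half_gt_zero)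
  define m where "m = e / (2 * (\<bar>M\<bar> + 1))"
  have m: "m > 0" using e by (simp add: m_def)
  show "\<exists>d>0. \<forall>x'\<in>P \<times> I. dist x' x < d \<longrightarrow> dist (F (fst x') (snd x')) (F (fst x) (snd x)) < e"
  proof (intro exI[of _ "min d m"] conjI ballI impI)
    show "0 < min d m" using d m by simp
    fix y assume y: "y \<in> P \<times> I" "dist y x < min d m"
    obtain q \<sigma> where yq: "y = (q, \<sigma>)" "q \<in> P" "\<sigma> \<in> I" using y by auto
    have 1: "dist q p < d" "\<bar>\<sigma> - \<tau>\<bar> < m"
      using y(2) dist_fst_le[of y x] dist_snd_le[of y x] by (auto simp: yq xp dist_real_def)
    have "norm (F q \<sigma> - F q \<tau>) \<le> M * \<bar>\<sigma> - \<tau>\<bar>" by (rule l) (use yq xp in auto)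
    also have "\<dots> \<le> (\<bar>M\<bar> + 1) * m" using 1 by (intro mult_mono) auto
    also have "\<dots> = e / 2" by (simp add: m_def field_simps)
    finally have "dist (F q \<sigma>) (F q \<tau>) \<le> e / 2" by (simp add: dist_norm)
    moreover have "dist (F q \<tau>) (F p \<tau>) < e / 2" using d yq 1 by auto
    ultimately have "dist (F q \<sigma>) (F p \<tau>) < e"
      using dist_triangle[of "F q \<sigma>" "F p \<tau>" "F q \<tau>"] by linarith
    then show "dist (F (fst y) (snd y)) (F (fst x) (snd x)) < e" by (simp add: xp yq)
  qed
qed

text \<open>The iteration treats all initial values at once, so the uniform limit is continuous in
  parameter and time jointly, as the shooting argument requires. L T \<le> 1/2 lets a single
  contraction reach the time T.\<close>

lemma picard_parametric:
  fixes f :: "real \<Rightarrow> 'a::banach \<Rightarrow> 'a" and x0 :: "'p::metric_space \<Rightarrow> 'a"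
  assumes x0: "continuous_on P x0" and S: "\<And>p. p \<in> P \<Longrightarrow> cball (x0 p) R \<subseteq> S"
    and f: "continuous_on ({0..T} \<times> S) (\<lambda>x. f (fst x) (snd x))"
    and M: "\<And>\<tau> x. \<tau> \<in> {0..T} \<Longrightarrow> x \<in> S \<Longrightarrow> norm (f \<tau> x) \<le> M"
    and L: "\<And>\<tau> x y. \<tau> \<in> {0..T} \<Longrightarrow> x \<in> S \<Longrightarrow> y \<in> S \<Longrightarrow> norm (f \<tau> x - f \<tau> y) \<le> L * norm (x - y)"
    and T: "0 \<le> T" "M * T \<le> R" "L * T \<le> 1 / 2" "0 \<le> M" "0 \<le> L"
  obtains X where "continuous_on (P \<times> {0..T}) (\<lambda>x. X (fst x) (snd x))"
    "\<And>p. p \<in> P \<Longrightarrow> X p 0 = x0 p"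
    "\<And>p \<tau>. p \<in> P \<Longrightarrow> \<tau> \<in> {0..T} \<Longrightarrow> X p \<tau> \<in> cball (x0 p) R"
    "\<And>p \<tau>. p \<in> P \<Longrightarrow> \<tau> \<in> {0..T} \<Longrightarrow> (X p has_vector_derivative f \<tau> (X p \<tau>)) (at \<tau> within {0..T})"
proof -
  define \<Phi> where "\<Phi> Y p \<tau> = x0 p + integral {0..\<tau>} (\<lambda>\<sigma>. f \<sigma> (Y p \<sigma>))" for Y :: "'p \<Rightarrow> real \<Rightarrow> 'a" and p \<tau>
  define ok where "ok Y \<longleftrightarrow> continuous_on (P \<times> {0..T}) (\<lambda>x. Y (fst x) (snd x)) \<and>
    (\<forall>p\<in>P. \<forall>\<tau>\<in>{0..T}. Y p \<tau> \<in> cball (x0 p) R)" for Y :: "'p \<Rightarrow> real \<Rightarrow> 'a"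
  have R: "R \<ge> 0" using T by (meson mult_nonneg_nonneg order_trans)
  have okS: "Y p \<tau> \<in> S" if "ok Y" "p \<in> P" "\<tau> \<in> {0..T}" for Y p \<tau>
    using that S unfolding ok_def by blast
  have contY: "continuous_on (P \<times> {0..T}) (\<lambda>x. f (snd x) (Y (fst x) (snd x)))" if "ok Y" for Y
  proof -
    have "continuous_on (P \<times> {0..T}) ((\<lambda>x. f (fst x) (snd x)) \<circ> (\<lambda>x. (snd x, Y (fst x) (snd x))))"
    proof (rule continuous_on_compose)
      show "continuous_on (P \<times> {0..T}) (\<lambda>x. (snd x, Y (fst x) (snd x)))"
        using that unfolding ok_def by (intro continuous_intros) auto
      show "continuous_on ((\<lambda>x. (snd x, Y (fst x) (snd x))) ` (P \<times> {0..T})) (\<lambda>x. f (fst x) (snd x))"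
        by (rule continuous_on_subset[OF f]) (use okS[OF that] in auto)
    qed
    then show ?thesis by (simp add: o_def)
  qed
  have contp: "continuous_on {0..T} (\<lambda>\<sigma>. f \<sigma> (Y p \<sigma>))" if "ok Y" "p \<in> P" for Y p
  proof -
    have "continuous_on {0..T} ((\<lambda>x. f (snd x) (Y (fst x) (snd x))) \<circ> (\<lambda>\<sigma>. (p, \<sigma>)))"
      by (rule continuous_on_compose)
        (use that in \<open>auto intro!: continuous_intros continuous_on_subset[OF contY[OF that(1)]]\<close>)
    then show ?thesis by (simp add: o_def)
  qed
  have int: "(\<lambda>\<sigma>. f \<sigma> (Y p \<sigma>)) integrable_on {\<tau>..\<upsilon>}" if "ok Y" "p \<in> P" "0 \<le> \<tau>" "\<upsilon> \<le> T" for Y p \<tau> \<upsilon>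
    by (rule integrable_continuous_real, rule continuous_on_subset[OF contp]) (use that in auto)
  have lip: "norm (\<Phi> Y p \<tau> - \<Phi> Y p \<sigma>) \<le> M * \<bar>\<tau> - \<sigma>\<bar>"
    if Y: "ok Y" "p \<in> P" and \<tau>: "\<tau> \<in> {0..T}" "\<sigma> \<in> {0..T}" for Y p \<tau> \<sigma>
  proof -
    have *: "norm (\<Phi> Y p \<tau> - \<Phi> Y p \<sigma>) \<le> M * (\<tau> - \<sigma>)" if "\<tau> \<in> {0..T}" "\<sigma> \<in> {0..T}" "\<sigma> \<le> \<tau>" for \<tau> \<sigma>
    proof -
      have "\<Phi> Y p \<tau> - \<Phi> Y p \<sigma> = integral {\<sigma>..\<tau>} (\<lambda>\<sigma>. f \<sigma> (Y p \<sigma>))"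
        using Henstock_Kurzweil_Integration.integral_combine[of 0 \<sigma> \<tau> "\<lambda>\<sigma>. f \<sigma> (Y p \<sigma>)"] int[OF Y, of 0 \<tau>] that
        by (simp add: \<Phi>_def algebra_simps)
      moreover have "norm (integral {\<sigma>..\<tau>} (\<lambda>\<sigma>. f \<sigma> (Y p \<sigma>))) \<le> M * (\<tau> - \<sigma>)"
        using Henstock_Kurzweil_Integration.integral_bound[where a=\<sigma> and b=\<tau> and f="\<lambda>\<sigma>. f \<sigma> (Y p \<sigma>)" and B=M]
          that continuous_on_subset[OF contp[OF Y], of "{\<sigma>..\<tau>}"] M okS[OF Y]
        by auto
      ultimately show ?thesis by simp
    qed
    show ?thesis
      using *[of \<tau> \<sigma>] *[of \<sigma> \<tau>] \<tau> by (cases "\<sigma> \<le> \<tau>") (auto simp: norm_minus_commute)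
  qed
  have ok\<Phi>: "ok (\<Phi> Y)" if "ok Y" for Y
    unfolding ok_def
  proof (intro conjI ballI)
    show "continuous_on (P \<times> {0..T}) (\<lambda>x. \<Phi> Y (fst x) (snd x))"
    proof (rule continuous_on_Times_lipschitz)
      fix \<tau> assume \<tau>: "\<tau> \<in> {0..T}"
      have "continuous_on P (\<lambda>p. integral (cbox 0 \<tau>) (\<lambda>\<sigma>. f \<sigma> (Y p \<sigma>)))"
        by (rule integral_continuous_on_param)
          (use \<tau> in \<open>auto simp: case_prod_unfold intro!: continuous_on_subset[OF contY[OF that]]\<close>)
      then show "continuous_on P (\<lambda>p. \<Phi> Y p \<tau>)"
        unfolding \<Phi>_def using x0 by (auto intro!: continuous_intros)
    qed (rule lip[OF that])
    fix p \<tau> assume p: "p \<in> P" and \<tau>: "\<tau> \<in> {0..T}"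
    have "norm (\<Phi> Y p \<tau> - \<Phi> Y p 0) \<le> M * \<bar>\<tau> - 0\<bar>" by (rule lip) (use that p \<tau> in auto)
    also have "\<dots> \<le> M * T" using \<tau> T by (intro mult_left_mono) auto
    also have "\<dots> \<le> R" by fact
    finally show "\<Phi> Y p \<tau> \<in> cball (x0 p) R" by (simp add: \<Phi>_def dist_norm norm_minus_commute)
  qed
  have contr: "norm (\<Phi> Y p \<tau> - \<Phi> Z p \<tau>) \<le> D / 2"
    if "ok Y" "ok Z" and D: "\<And>\<tau>. \<tau> \<in> {0..T} \<Longrightarrow> norm (Y p \<tau> - Z p \<tau>) \<le> D"
      and "p \<in> P" "\<tau> \<in> {0..T}" for Y Z p \<tau> D
  proof -
    have D0: "D \<ge> 0" using D[OF \<open>\<tau> \<in> {0..T}\<close>] norm_ge_zero order_trans by blast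
    have "\<Phi> Y p \<tau> - \<Phi> Z p \<tau> = integral {0..\<tau>} (\<lambda>\<sigma>. f \<sigma> (Y p \<sigma>) - f \<sigma> (Z p \<sigma>))"
      using that int by (simp add: \<Phi>_def integral_diff)
    also have "norm \<dots> \<le> (L * D) * (\<tau> - 0)"
    proof (rule Henstock_Kurzweil_Integration.integral_bound)
      show "continuous_on {0..\<tau>} (\<lambda>\<sigma>. f \<sigma> (Y p \<sigma>) - f \<sigma> (Z p \<sigma>))"
        using that by (intro continuous_on_diff; intro continuous_on_subset[OF contp]) auto
      fix \<sigma> assume \<sigma>: "\<sigma> \<in> {0..\<tau>}"
      then have \<sigma>': "\<sigma> \<in> {0..T}" using that by auto
      have "norm (f \<sigma> (Y p \<sigma>) - f \<sigma> (Z p \<sigma>)) \<le> L * norm (Y p \<sigma> - Z p \<sigma>)"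
        by (rule L) (use okS that \<sigma>' in auto)
      also have "\<dots> \<le> L * D" using D[OF \<sigma>'] T by (intro mult_left_mono) auto
      finally show "norm (f \<sigma> (Y p \<sigma>) - f \<sigma> (Z p \<sigma>)) \<le> L * D" .
    qed (use that in auto)
    also have "\<dots> \<le> (L * D) * T" using D0 T that by (intro mult_left_mono) auto
    also have "\<dots> = (L * T) * D" by simp
    also have "\<dots> \<le> 1 / 2 * D" using D0 T by (intro mult_right_mono) auto
    finally show ?thesis by simp
  qed
  define Y where "Y = rec_nat (\<lambda>p \<tau>. x0 p) (\<lambda>_. \<Phi>)"
  have Y_simps: "Y 0 = (\<lambda>p \<tau>. x0 p)" "\<And>k. Y (Suc k) = \<Phi> (Y k)" by (simp_all add: Y_def)
  have "continuous_on (P \<times> {0..T}) (\<lambda>x. x0 (fst x))"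
    by (rule continuous_on_compose2[OF x0]) (auto intro!: continuous_intros)
  then have okY: "ok (Y k)" for k
    by (induction k) (use R in \<open>auto simp: Y_simps ok\<Phi> ok_def[of "\<lambda>p \<tau>. x0 p"]\<close>)
  have step: "norm (Y (Suc k) p \<tau> - Y k p \<tau>) \<le> R / 2 ^ k" if "p \<in> P" "\<tau> \<in> {0..T}" for k p \<tau>
    using that
  proof (induction k arbitrary: \<tau>)
    case 0
    then show ?case using okY[of "Suc 0"] unfolding ok_def by (auto simp: Y_simps dist_norm norm_minus_commute)
  next
    case (Suc k)
    then show ?case using contr[OF okY[of "Suc k"] okY[of k], of p "R / 2 ^ k" \<tau>]
      by (simp add: Y_simps field_simps)
  qed
  \<comment> \<open>The right side is the exact sum of the increments R / 2^i for i from k to k + m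
    - 1, in a form that telescopes in m.\<close>
  have tail: "norm (Y (k + m) p \<tau> - Y k p \<tau>) \<le> 2 * R / 2 ^ k - 2 * R / 2 ^ (k + m)"
    if "p \<in> P" "\<tau> \<in> {0..T}" for k m p \<tau>
  proof (induction m)
    case (Suc m)
    have "norm (Y (k + Suc m) p \<tau> - Y k p \<tau>) \<le> norm (Y (Suc (k + m)) p \<tau> - Y (k + m) p \<tau>) + norm (Y (k + m) p \<tau> - Y k p \<tau>)"
      using norm_triangle_ineq[of "Y (Suc (k + m)) p \<tau> - Y (k + m) p \<tau>" "Y (k + m) p \<tau> - Y k p \<tau>"] by simp
    also have "\<dots> \<le> R / 2 ^ (k + m) + (2 * R / 2 ^ k - 2 * R / 2 ^ (k + m))"
      by (intro add_mono step that Suc)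
    also have "\<dots> = 2 * R / 2 ^ k - 2 * R / 2 ^ (k + Suc m)" by simp
    finally show ?case .
  qed simp
  have "(\<lambda>k. 2 * R * (1 / 2) ^ k) \<longlonglongrightarrow> 2 * R * 0"
    by (intro tendsto_intros LIMSEQ_power_zero) auto
  then have lim0: "(\<lambda>k. 2 * R / 2 ^ k) \<longlonglongrightarrow> 0" by (simp add: power_one_over)
  have "uniformly_convergent_on (P \<times> {0..T}) (\<lambda>k x. Y k (fst x) (snd x))"
  proof (rule Cauchy_uniformly_convergent, rule uniformly_Cauchy_onI')
    fix e :: real assume "e > 0"
    then obtain N where N: "2 * R / 2 ^ k < e" if "k \<ge> N" for k
      using order_tendstoD(2)[OF lim0] by (auto simp: eventually_sequentially)
    show "\<exists>M. \<forall>x\<in>P \<times> {0..T}. \<forall>m\<ge>M. \<forall>n>m. dist (Y m (fst x) (snd x)) (Y n (fst x) (snd x)) < e"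
    proof (intro exI[of _ N] ballI allI impI)
      fix x m n assume x: "x \<in> P \<times> {0..T}" and mn: "N \<le> m" "m < n"
      have "norm (Y (m + (n - m)) (fst x) (snd x) - Y m (fst x) (snd x)) \<le> 2 * R / 2 ^ m - 2 * R / 2 ^ (m + (n - m))"
        by (rule tail) (use x in auto)
      also have "\<dots> \<le> 2 * R / 2 ^ m" using R by simp
      also have "\<dots> < e" using N mn by simp
      finally show "dist (Y m (fst x) (snd x)) (Y n (fst x) (snd x)) < e"
        using mn by (simp add: dist_norm norm_minus_commute)
    qed
  qed
  then obtain l where l: "uniform_limit (P \<times> {0..T}) (\<lambda>k x. Y k (fst x) (snd x)) l sequentially"
    unfolding uniformly_convergent_on_def by blast
  define X where "X p \<tau> = l (p, \<tau>)" for p \<tau>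
  have lim: "(\<lambda>k. Y k p \<tau>) \<longlonglongrightarrow> X p \<tau>" if "p \<in> P" "\<tau> \<in> {0..T}" for p \<tau>
    using tendsto_uniform_limitI[OF l, of "(p, \<tau>)"] that by (simp add: X_def)
  have "continuous_on (P \<times> {0..T}) l"
    by (rule uniform_limit_theorem[OF _ l]) (use okY in \<open>auto simp: ok_def intro!: always_eventually\<close>)
  then have Xc: "continuous_on (P \<times> {0..T}) (\<lambda>x. X (fst x) (snd x))" by (simp add: X_def)
  have Xb: "X p \<tau> \<in> cball (x0 p) R" if "p \<in> P" "\<tau> \<in> {0..T}" for p \<tau>
    by (rule Lim_in_closed_set[OF closed_cball _ _ lim]) (use that okY in \<open>auto simp: ok_def\<close>)
  have okX: "ok X" using Xc Xb by (auto simp: ok_def)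
  have tailX: "norm (X p \<tau> - Y k p \<tau>) \<le> 2 * R / 2 ^ k" if "p \<in> P" "\<tau> \<in> {0..T}" for k p \<tau>
  proof (rule Lim_bounded)
    show "(\<lambda>m. norm (Y m p \<tau> - Y k p \<tau>)) \<longlonglongrightarrow> norm (X p \<tau> - Y k p \<tau>)"
      by (intro tendsto_intros lim that)
    show "\<forall>m\<ge>k. norm (Y m p \<tau> - Y k p \<tau>) \<le> 2 * R / 2 ^ k"
    proof (intro allI impI)
      fix m assume "k \<le> m"
      have "norm (Y (k + (m - k)) p \<tau> - Y k p \<tau>) \<le> 2 * R / 2 ^ k - 2 * R / 2 ^ (k + (m - k))"
        by (rule tail[OF that])
      also have "\<dots> \<le> 2 * R / 2 ^ k" using R by simp
      finally show "norm (Y m p \<tau> - Y k p \<tau>) \<le> 2 * R / 2 ^ k" using \<open>k \<le> m\<close> by simp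
    qed
  qed
  \<comment> \<open>The distance from the image of X to X is compared with iterate k + 1, which is
    the image of iterate k: contraction bounds one part, \<open>tailX\<close> the other, and both
    tend to 0.\<close>
  have fixpoint: "\<Phi> X p \<tau> = X p \<tau>" if "p \<in> P" "\<tau> \<in> {0..T}" for p \<tau>
  proof -
    have "norm (\<Phi> X p \<tau> - X p \<tau>) \<le> 0"
    proof (rule Lim_bounded2)
      show "(\<lambda>k. 2 * R / 2 ^ k) \<longlonglongrightarrow> 0" by (rule lim0)
      show "\<forall>k\<ge>0. norm (\<Phi> X p \<tau> - X p \<tau>) \<le> 2 * R / 2 ^ k"
      proof (intro allI impI)
        fix k :: nat
        have "norm (\<Phi> X p \<tau> - X p \<tau>) \<le> norm (\<Phi> X p \<tau> - \<Phi> (Y k) p \<tau>) + norm (X p \<tau> - Y (Suc k) p \<tau>)"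
          using norm_triangle_ineq4[of "\<Phi> X p \<tau> - \<Phi> (Y k) p \<tau>" "X p \<tau> - Y (Suc k) p \<tau>"]
          by (simp add: Y_simps)
        also have "\<dots> \<le> (2 * R / 2 ^ k) / 2 + 2 * R / 2 ^ Suc k"
          by (intro add_mono contr okX okY tailX that)
        also have "\<dots> = 2 * R / 2 ^ k" by simp
        finally show "norm (\<Phi> X p \<tau> - X p \<tau>) \<le> 2 * R / 2 ^ k" .
      qed
    qed
    then show ?thesis by simp
  qed
  show ?thesis
  proof (rule that[of X])
    show "X p 0 = x0 p" if "p \<in> P" for p
      using fixpoint[OF that, of 0] T by (simp add: \<Phi>_def)
    show "(X p has_vector_derivative f \<tau> (X p \<tau>)) (at \<tau> within {0..T})" if "p \<in> P" "\<tau> \<in> {0..T}" for p \<tau>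
    proof -
      have d: "((\<lambda>\<tau>. \<Phi> X p \<tau>) has_vector_derivative 0 + f \<tau> (X p \<tau>)) (at \<tau> within {0..T})"
        unfolding \<Phi>_def
        by (intro has_vector_derivative_add has_vector_derivative_const
            integral_has_vector_derivative contp okX that)
      show ?thesis
        by (rule has_vector_derivative_transform[OF that(2) _ d[unfolded add_0]]) (use fixpoint that in auto)
    qed
  qed (use Xc Xb in blast)+
qed

text \<open>Gronwall in differential form: exp (- 2 L \<tau>) |x - y|^2 does not increase. The
  Lipschitz bound is asked only along the two curves, which suits a field that is controlled only on
  a bounded region.\<close>

lemma ode_unique:
  fixes x y :: "real \<Rightarrow> 'a::real_inner"
  assumes "a \<le> b"
    and x: "\<And>\<tau>. \<tau> \<in> {a..b} \<Longrightarrow> (x has_vector_derivative f (x \<tau>)) (at \<tau> within {a..b})"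
    and y: "\<And>\<tau>. \<tau> \<in> {a..b} \<Longrightarrow> (y has_vector_derivative f (y \<tau>)) (at \<tau> within {a..b})"
    and L: "\<And>\<tau>. \<tau> \<in> {a..b} \<Longrightarrow> norm (f (x \<tau>) - f (y \<tau>)) \<le> L * norm (x \<tau> - y \<tau>)"
    and eq: "x a = y a" and "\<tau> \<in> {a..b}"
  shows "x \<tau> = y \<tau>"
proof -
  define d where "d \<tau> = x \<tau> - y \<tau>" for \<tau>
  define E where "E \<tau> = exp (- 2 * L * \<tau>) * (d \<tau> \<bullet> d \<tau>)" for \<tau>
  have "E \<tau> \<le> E a"
  proof (rule DERIV_nonpos_imp_decreasing_open[of a \<tau> E])
    show "a \<le> \<tau>" using assms by auto
    have d': "(d has_vector_derivative f (x s) - f (y s)) (at s within {a..b})" if "s \<in> {a..b}" for s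
      unfolding d_def by (intro has_vector_derivative_diff x y that)
    have E': "(E has_real_derivative exp (- 2 * L * s) * (- 2 * L * (d s \<bullet> d s) + 2 * (d s \<bullet> (f (x s) - f (y s)))))
       (at s within {a..b})" if "s \<in> {a..b}" for s
    proof -
      have "((\<lambda>\<tau>. d \<tau> \<bullet> d \<tau>) has_derivative (\<lambda>h. d s \<bullet> (h *\<^sub>R (f (x s) - f (y s))) + (h *\<^sub>R (f (x s) - f (y s))) \<bullet> d s)) (at s within {a..b})"
        using d'[OF that] unfolding has_vector_derivative_def by (intro derivative_intros)
      then have "((\<lambda>\<tau>. d \<tau> \<bullet> d \<tau>) has_real_derivative 2 * (d s \<bullet> (f (x s) - f (y s)))) (at s within {a..b})"
        unfolding has_field_derivative_def by (rule has_derivative_eq_rhs) (auto simp: fun_eq_iff inner_commute algebra_simps)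
      then show ?thesis unfolding E_def
        by (auto intro!: derivative_eq_intros simp: algebra_simps)
    qed
    show "continuous_on {a..\<tau>} E"
      by (rule continuous_on_subset[of "{a..b}"])
        (use assms in \<open>auto simp: continuous_on_eq_continuous_within intro!: DERIV_continuous E'\<close>)
    fix s assume s: "a < s" "s < \<tau>"
    then have s': "s \<in> {a..b}" using assms by auto
    have "(E has_real_derivative exp (- 2 * L * s) * (- 2 * L * (d s \<bullet> d s) + 2 * (d s \<bullet> (f (x s) - f (y s))))) (at s)"
      using E'[OF s'] s assms by (simp add: at_within_Icc_at)
    moreover have "d s \<bullet> (f (x s) - f (y s)) \<le> L * (d s \<bullet> d s)"
    proof -
      have "d s \<bullet> (f (x s) - f (y s)) \<le> norm (d s) * norm (f (x s) - f (y s))" by (rule norm_cauchy_schwarz)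
      also have "\<dots> \<le> norm (d s) * (L * norm (d s))" using L[OF s'] by (intro mult_left_mono) (auto simp: d_def)
      also have "\<dots> = L * (d s \<bullet> d s)" by (simp add: dot_square_norm power2_eq_square)
      finally show ?thesis .
    qed
    then have "exp (- 2 * L * s) * (- 2 * L * (d s \<bullet> d s) + 2 * (d s \<bullet> (f (x s) - f (y s)))) \<le> 0"
      by (intro mult_nonneg_nonpos) auto
    ultimately show "\<exists>y. (E has_real_derivative y) (at s) \<and> y \<le> 0" by blast
  qed
  moreover have "E a = 0" by (simp add: E_def d_def eq)
  ultimately have "d \<tau> \<bullet> d \<tau> \<le> 0" by (simp add: E_def mult_le_0_iff)
  then have "d \<tau> = 0" by (metis inner_ge_zero inner_eq_zero_iff order_antisym)
  then show ?thesis by (simp add: d_def)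
qed

text \<open>Brouwer's theorem for p - (f p, g p) clamped to the rectangle. At a fixed point f > 0
  would force x = a and f < 0 would force x = b, both against the boundary signs; likewise for
  g.\<close>

lemma poincare_miranda:
  fixes f g :: "real \<times> real \<Rightarrow> real"
  assumes ab: "a \<le> b" "c \<le> d"
    and f: "continuous_on ({a..b} \<times> {c..d}) f" and g: "continuous_on ({a..b} \<times> {c..d}) g"
    and f1: "\<And>y. y \<in> {c..d} \<Longrightarrow> f (a, y) \<le> 0" and f2: "\<And>y. y \<in> {c..d} \<Longrightarrow> 0 \<le> f (b, y)"
    and g1: "\<And>x. x \<in> {a..b} \<Longrightarrow> g (x, c) \<le> 0" and g2: "\<And>x. x \<in> {a..b} \<Longrightarrow> 0 \<le> g (x, d)"
  obtains x y where "x \<in> {a..b}" "y \<in> {c..d}" "f (x, y) = 0" "g (x, y) = 0"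
proof -
  define h where "h p = (max a (min b (fst p - f p)), max c (min d (snd p - g p)))" for p
  obtain p where "p \<in> {a..b} \<times> {c..d}" "h p = p"
  proof (rule brouwer)
    show "compact ({a..b} \<times> {c..d})" by (intro compact_Times compact_Icc)
    show "convex ({a..b} \<times> {c..d})" by (intro convex_Times) auto
    show "{a..b} \<times> {c..d} \<noteq> {}" using ab by auto
    show "continuous_on ({a..b} \<times> {c..d}) h" unfolding h_def by (intro continuous_intros f g)
    show "h \<in> {a..b} \<times> {c..d} \<rightarrow> {a..b} \<times> {c..d}" using ab by (auto simp: h_def)
  qed blast
  then obtain x y where xy: "x \<in> {a..b}" "y \<in> {c..d}" "h (x, y) = (x, y)" by (cases p) auto
  then have 1: "max a (min b (x - f (x, y))) = x" "max c (min d (y - g (x, y))) = y" by (auto simp: h_def)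
  have "f (x, y) = 0"
    using 1(1) xy(1) f1[OF xy(2)] f2[OF xy(2)] by (cases "x = a"; cases "x = b") (auto simp: max_def min_def split: if_splits)
  moreover have "g (x, y) = 0"
    using 1(2) xy(2) g1[OF xy(1)] g2[OF xy(1)] by (cases "y = c"; cases "y = d") (auto simp: max_def min_def split: if_splits)
  ultimately show ?thesis using that xy by blast
qed

text \<open>Derivatives are taken within a larger set S, because the solutions are differentiable
  only within \<open>{0..T}\<close> while the estimates concern subintervals.\<close>

lemma norm_diff_le_of_deriv:
  fixes f :: "real \<Rightarrow> 'a::real_normed_vector" and \<phi> :: "real \<Rightarrow> real"
  assumes "a \<le> b"
    and f: "\<And>s. s \<in> {a..b} \<Longrightarrow> (f has_vector_derivative f' s) (at s within S)"
    and \<phi>: "\<And>s. s \<in> {a..b} \<Longrightarrow> (\<phi> has_real_derivative \<phi>' s) (at s within S)"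
    and S: "{a..b} \<subseteq> S" and le: "\<And>s. s \<in> {a..b} \<Longrightarrow> norm (f' s) \<le> \<phi>' s"
  shows "norm (f b - f a) \<le> \<phi> b - \<phi> a"
proof (cases "a = b")
  case False
  have f1: "(f has_vector_derivative f' s) (at s within {a..b})" if "s \<in> {a..b}" for s
    using has_vector_derivative_within_subset[OF f[OF that] S] .
  have \<phi>1: "(\<phi> has_vector_derivative \<phi>' s) (at s within {a..b})" if "s \<in> {a..b}" for s
    using DERIV_subset[OF \<phi>[OF that] S] by (simp add: has_real_derivative_iff_has_vector_derivative)
  show ?thesis
  proof (rule differentiable_bound_general)
    show "a < b" using False \<open>a \<le> b\<close> by simp
    show "continuous_on {a..b} f" "continuous_on {a..b} \<phi>"
      unfolding continuous_on_eq_continuous_within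
      using f1 \<phi>1 has_vector_derivative_continuous by blast+
    fix x assume x: "a < x" "x < b"
    then show "(f has_vector_derivative f' x) (at x)" "(\<phi> has_vector_derivative \<phi>' x) (at x)"
      using f1[of x] \<phi>1[of x] by (auto simp: at_within_Icc_at)
    show "norm (f' x) \<le> \<phi>' x" using le x by auto
  qed
qed simp

text \<open>The one-sided form follows from the norm version for the constant 0, with majorant
  \<phi> - f.\<close>

lemma diff_le_of_deriv:
  fixes f \<phi> :: "real \<Rightarrow> real"
  assumes "a \<le> b"
    and f: "\<And>s. s \<in> {a..b} \<Longrightarrow> (f has_real_derivative f' s) (at s within S)"
    and \<phi>: "\<And>s. s \<in> {a..b} \<Longrightarrow> (\<phi> has_real_derivative \<phi>' s) (at s within S)"
    and S: "{a..b} \<subseteq> S" and le: "\<And>s. s \<in> {a..b} \<Longrightarrow> f' s \<le> \<phi>' s"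
  shows "f b - f a \<le> \<phi> b - \<phi> a"
proof -
  have "norm ((\<lambda>_. 0 :: real) b - (\<lambda>_. 0) a) \<le> (\<phi> b - f b) - (\<phi> a - f a)"
    by (rule norm_diff_le_of_deriv[where f' = "\<lambda>_. 0" and \<phi>' = "\<lambda>s. \<phi>' s - f' s", OF \<open>a \<le> b\<close> _ _ S])
      (use f \<phi> le in \<open>auto intro!: derivative_intros\<close>)
  then show ?thesis by simp
qed

section \<open>The rescaled equations of motion\<close>

lemma norm_mult_le: "norm (x::complex) \<le> b \<Longrightarrow> norm y \<le> c \<Longrightarrow> norm (x * y) \<le> b * c"
  unfolding norm_mult by (intro mult_mono) (auto intro: order_trans[OF norm_ge_zero])

lemma norm_mult_diff_le:
  fixes x :: complex
  assumes "norm x \<le> b" "norm y' \<le> c'" "norm (x - x') \<le> d" "norm (y - y') \<le> e"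
  shows "norm (x * y - x' * y') \<le> b * e + d * c'"
proof -
  have "x * y - x' * y' = x * (y - y') + (x - x') * y'" by (simp add: algebra_simps)
  then show ?thesis
    using norm_mult_le[OF assms(1,4)] norm_mult_le[OF assms(3,2)]
    by (metis add_mono norm_triangle_ineq order_trans)
qed

lemma norm_fst_snd_le: "norm (fst x) \<le> norm x" "norm (snd x) \<le> norm x"
  using norm_fst_le[of "fst x" "snd x"] norm_snd_le[of "snd x" "fst x"] by simp_all

text \<open>
  Here \<open>y\<close> is the velocity with respect to the non-rotating frame, expressed in the rotating one:
  \<open>z' = y - i (\<epsilon>/2) \<bar>z\<bar>\<^sup>2 z\<close>. In these variables \<open>Im (cnj z * y)\<close> is changed by the tide only.
\<close>

definition rtbp_field :: "real \<Rightarrow> real \<Rightarrow> real \<Rightarrow> complex \<times> complex \<Rightarrow> complex \<times> complex" where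
  "rtbp_field a \<kappa> \<epsilon> x = (case x of (z, y) \<Rightarrow>
     (y - \<i> * of_real (\<epsilon> / 2 * (cmod z)\<^sup>2) * z,
      - \<i> * of_real (\<epsilon> / 2 * (cmod z)\<^sup>2) * y - z
        + (of_real (\<epsilon> * Im (cnj z * y)) * z + of_real (\<kappa> * \<epsilon>\<^sup>2) * tide_force a z)))"

text \<open>The bounds by 2 belong to the notion: in that region the force is controlled uniformly,
  and for |a| \<le> 1/32 the second primary is out of reach.\<close>

definition rtbp_solution :: "real \<Rightarrow> real \<Rightarrow> real \<Rightarrow> real \<Rightarrow> (real \<Rightarrow> complex) \<Rightarrow> (real \<Rightarrow> complex) \<Rightarrow> bool" where
  "rtbp_solution a \<kappa> \<epsilon> T Z Y \<longleftrightarrow> (\<forall>\<tau>\<in>{0..T}. cmod (Z \<tau>) \<le> 2 \<and> cmod (Y \<tau>) \<le> 2 \<and>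
     ((\<lambda>\<tau>. (Z \<tau>, Y \<tau>)) has_vector_derivative rtbp_field a \<kappa> \<epsilon> (Z \<tau>, Y \<tau>)) (at \<tau> within {0..T}))"

text \<open>One constant B serves all estimates. The torque at parameter 0 has its own Lipschitz
  bound because leading terms are always evaluated there. Only |a| is restricted: the orbit \<gamma>
  comes from a negative a.\<close>

locale tide =
  fixes B a :: real
  assumes B1: "1 \<le> B" and a_le: "\<bar>a\<bar> \<le> 1 / 32"
    and force_bound: "cmod z \<le> 2 \<Longrightarrow> cmod (tide_force a z) \<le> B"
    and force_lip: "cmod z \<le> 2 \<Longrightarrow> cmod w \<le> 2 \<Longrightarrow> cmod (tide_force a z - tide_force a w) \<le> B * cmod (z - w)"
    and torque_bound: "cmod z \<le> 2 \<Longrightarrow> \<bar>tide_torque a z\<bar> \<le> B"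
    and torque_lip: "cmod z \<le> 2 \<Longrightarrow> cmod w \<le> 2 \<Longrightarrow> \<bar>tide_torque a z - tide_torque a w\<bar> \<le> B * cmod (z - w)"
    and torque0_lip: "cmod z \<le> 2 \<Longrightarrow> cmod w \<le> 2 \<Longrightarrow> \<bar>tide_torque 0 z - tide_torque 0 w\<bar> \<le> B * cmod (z - w)"
    and torque1_bound: "cmod z \<le> 2 \<Longrightarrow> \<bar>tide_torque1 a z\<bar> \<le> B"
    and torque1_lip: "cmod z \<le> 2 \<Longrightarrow> cmod w \<le> 2 \<Longrightarrow> \<bar>tide_torque1 a z - tide_torque1 a w\<bar> \<le> B * cmod (z - w)"
begin

lemma continuous_on_force: "continuous_on (cball 0 2) (tide_force a)"
proof -
  have "B-lipschitz_on (cball 0 2) (tide_force a)"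
    by (rule lipschitz_onI) (use B1 force_lip in \<open>auto simp: dist_norm\<close>)
  then show ?thesis by (rule lipschitz_on_continuous_on)
qed

end

text \<open>L is chosen from B and a depends on L, so B must be available for all a at once.\<close>

lemma tide_uniform:
  obtains B where "\<And>a. \<bar>a\<bar> \<le> 1 / 32 \<Longrightarrow> tide B a"
proof -
  obtain K1 where K1: "K1 \<ge> 0"
    "\<And>a z. \<bar>a\<bar> \<le> 1 / 32 \<Longrightarrow> cmod z \<le> 2 \<Longrightarrow> cmod (tide_force a z) \<le> K1"
    "\<And>a z w. \<bar>a\<bar> \<le> 1 / 32 \<Longrightarrow> cmod z \<le> 2 \<Longrightarrow> cmod w \<le> 2 \<Longrightarrow> cmod (tide_force a z - tide_force a w) \<le> K1 * cmod (z - w)"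
    using unif_lipE[OF unif_lip_tide_force] by blast
  obtain K2 where K2: "K2 \<ge> 0"
    "\<And>a z. \<bar>a\<bar> \<le> 1 / 32 \<Longrightarrow> cmod z \<le> 2 \<Longrightarrow> \<bar>tide_torque a z\<bar> \<le> K2"
    "\<And>a z w. \<bar>a\<bar> \<le> 1 / 32 \<Longrightarrow> cmod z \<le> 2 \<Longrightarrow> cmod w \<le> 2 \<Longrightarrow> \<bar>tide_torque a z - tide_torque a w\<bar> \<le> K2 * cmod (z - w)"
    using unif_lipE[OF unif_lip_tide_torque] unfolding real_norm_def by blast
  obtain K3 where K3: "K3 \<ge> 0"
    "\<And>a z. \<bar>a\<bar> \<le> 1 / 32 \<Longrightarrow> cmod z \<le> 2 \<Longrightarrow> \<bar>tide_torque1 a z\<bar> \<le> K3"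
    "\<And>a z w. \<bar>a\<bar> \<le> 1 / 32 \<Longrightarrow> cmod z \<le> 2 \<Longrightarrow> cmod w \<le> 2 \<Longrightarrow> \<bar>tide_torque1 a z - tide_torque1 a w\<bar> \<le> K3 * cmod (z - w)"
    using unif_lipE[OF unif_lip_tide_torque1] unfolding real_norm_def by blast
  define B where "B = 1 + K1 + K2 + K3"
  have B: "1 \<le> B" "K1 \<le> B" "K2 \<le> B" "K3 \<le> B" using K1(1) K2(1) K3(1) by (auto simp: B_def)
  show ?thesis
  proof (rule that[of B])
    fix a :: real assume a: "\<bar>a\<bar> \<le> 1 / 32"
    show "tide B a"
    proof
      fix z w :: complex assume z: "cmod z \<le> 2"
      show "cmod (tide_force a z) \<le> B" "\<bar>tide_torque a z\<bar> \<le> B" "\<bar>tide_torque1 a z\<bar> \<le> B"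
        using K1(2)[OF a z] K2(2)[OF a z] K3(2)[OF a z] B by linarith+
      assume w: "cmod w \<le> 2"
      have 0: "\<bar>0 :: real\<bar> \<le> 1 / 32" by simp
      show "cmod (tide_force a z - tide_force a w) \<le> B * cmod (z - w)"
        "\<bar>tide_torque a z - tide_torque a w\<bar> \<le> B * cmod (z - w)"
        "\<bar>tide_torque 0 z - tide_torque 0 w\<bar> \<le> B * cmod (z - w)"
        "\<bar>tide_torque1 a z - tide_torque1 a w\<bar> \<le> B * cmod (z - w)"
        using K1(3)[OF a z w] K2(3)[OF a z w] K2(3)[OF 0 z w] K3(3)[OF a z w] B
        by (meson mult_right_mono norm_ge_zero order_trans)+
    qed (use B a in auto)
  qed
qed

text \<open>\<epsilon> T measures the rotation accumulated over the whole orbit and a the correction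
  to the leading torque; \<eta> dominates both. The square of B is there because a second-order
  displacement, itself proportional to B, is multiplied by the Lipschitz constant or the bound B of
  the torque.\<close>

locale rtbp = tide +
  fixes \<kappa> \<epsilon> T \<eta> :: real
  assumes kappa: "0 < \<kappa>" "\<kappa> \<le> 1 / 4" and eps: "0 < \<epsilon>" and T1: "1 \<le> T" and eps_T: "\<epsilon> * T \<le> \<eta>"
    and a_eta: "\<bar>a\<bar> \<le> \<eta>" and eta: "\<eta> * B\<^sup>2 \<le> 1 / 100000"
begin

lemma eta_pos: "0 < \<eta>"
  using eps T1 eps_T by (meson less_le_trans mult_pos_pos zero_less_one)

lemma etaB: "\<eta> * B \<le> 1 / 100000" "\<eta> \<le> 1 / 100000"
proof -
  have "\<eta> * B * 1 \<le> \<eta> * B * B" using B1 eta_pos by (intro mult_left_mono) auto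
  then show 1: "\<eta> * B \<le> 1 / 100000" using eta by (simp add: power2_eq_square)
  have "\<eta> * 1 \<le> \<eta> * B" using B1 eta_pos by (intro mult_left_mono) auto
  then show "\<eta> \<le> 1 / 100000" using 1 by simp
qed

lemma eps_le: "\<epsilon> \<le> \<eta>"
  using mult_left_mono[OF T1, of \<epsilon>] eps eps_T by linarith

lemma eps_tau: "0 \<le> \<tau> \<Longrightarrow> \<tau> \<le> T \<Longrightarrow> \<epsilon> * \<tau> \<le> \<eta>"
  using mult_left_mono[of \<tau> T \<epsilon>] eps eps_T by linarith

text \<open>The tide has a second factor \<epsilon> \<le> \<eta>, which absorbs B; so it is
  dominated by the rotation, which is of first order.\<close>

lemma kappa_eps2: "\<kappa> * \<epsilon>\<^sup>2 * B \<le> \<epsilon> / 100000" "\<kappa> * \<epsilon>\<^sup>2 \<le> \<epsilon> / 100000"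
proof -
  have "\<kappa> * (\<epsilon> * (\<epsilon> * B)) \<le> 1 * (\<epsilon> * (\<eta> * B))"
    using kappa eps eps_le B1 eta_pos by (intro mult_mono mult_left_mono) auto
  also have "\<dots> \<le> 1 * (\<epsilon> * (1 / 100000))" using etaB eps by (intro mult_left_mono) auto
  finally show 1: "\<kappa> * \<epsilon>\<^sup>2 * B \<le> \<epsilon> / 100000" by (simp add: power2_eq_square mult_ac)
  have "\<kappa> * \<epsilon>\<^sup>2 * 1 \<le> \<kappa> * \<epsilon>\<^sup>2 * B" using B1 kappa by (intro mult_left_mono) auto
  then show "\<kappa> * \<epsilon>\<^sup>2 \<le> \<epsilon> / 100000" using 1 by simp
qed

text \<open>Variation of constants for the rotated harmonic oscillator: \<open>z = sin \<tau> A + cos \<tau> D\<close> and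
  \<open>y = cos \<tau> A - sin \<tau> D\<close>, after which the whole vector field is of order \<open>\<epsilon>\<close>.\<close>

definition slow_pos :: "real \<Rightarrow> complex \<times> complex \<Rightarrow> complex" where
  "slow_pos \<tau> x = of_real (sin \<tau>) * fst x + of_real (cos \<tau>) * snd x"

definition slow_force :: "real \<Rightarrow> complex \<times> complex \<Rightarrow> complex" where
  "slow_force \<tau> x = of_real (\<epsilon> * Im (cnj (snd x) * fst x)) * slow_pos \<tau> x + of_real (\<kappa> * \<epsilon>\<^sup>2) * tide_force a (slow_pos \<tau> x)"

definition slow_field :: "real \<Rightarrow> complex \<times> complex \<Rightarrow> complex \<times> complex" where
  "slow_field \<tau> x =
     (- \<i> * of_real (\<epsilon> / 2 * (cmod (slow_pos \<tau> x))\<^sup>2) * fst x + of_real (cos \<tau>) * slow_force \<tau> x,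
      - \<i> * of_real (\<epsilon> / 2 * (cmod (slow_pos \<tau> x))\<^sup>2) * snd x - of_real (sin \<tau>) * slow_force \<tau> x)"

text \<open>It contains the balls of radius 1/2 around all initial values (cis \<theta>, 0), and 3/2
  + 1/2 = 2 keeps the position where the force is controlled.\<close>

definition slow_dom :: "(complex \<times> complex) set" where
  "slow_dom = cball 0 (3 / 2) \<times> cball 0 (1 / 2)"

lemma slow_pos_bounds:
  assumes "x \<in> slow_dom"
  shows "cmod (fst x) \<le> 3 / 2" "cmod (snd x) \<le> 1 / 2" "cmod (slow_pos \<tau> x) \<le> 2"
proof -
  show 1: "cmod (fst x) \<le> 3 / 2" "cmod (snd x) \<le> 1 / 2"
    using assms by (auto simp: slow_dom_def)
  have s: "cmod (of_real (sin \<tau>)) \<le> 1" "cmod (of_real (cos \<tau>)) \<le> 1" by auto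
  show "cmod (slow_pos \<tau> x) \<le> 2"
    using norm_triangle_ineq[of "of_real (sin \<tau>) * fst x" "of_real (cos \<tau>) * snd x"]
      norm_mult_le[OF s(1) 1(1)] norm_mult_le[OF s(2) 1(2)]
    unfolding slow_pos_def by linarith
qed

lemma norm_eps_mult: "\<bar>h\<bar> \<le> 1 \<Longrightarrow> cmod (of_real (\<epsilon> * h)) \<le> \<epsilon>"
  unfolding norm_of_real abs_mult using eps mult_left_mono[of "\<bar>h\<bar>" 1 \<epsilon>] by simp

lemma norm_kappa: "cmod (of_real (\<kappa> * \<epsilon>\<^sup>2)) \<le> \<kappa> * \<epsilon>\<^sup>2"
  unfolding norm_of_real using kappa by simp

lemma slow_field_bound:
  assumes "x \<in> slow_dom"
  shows "norm (slow_field \<tau> x) \<le> 10 * B * \<epsilon>"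
proof -
  note b = slow_pos_bounds(1,2)[OF assms] slow_pos_bounds(3)[OF assms, of \<tau>]
  have s: "cmod (of_real (sin \<tau>)) \<le> 1" "cmod (of_real (cos \<tau>)) \<le> 1" by auto
  have "(cmod (slow_pos \<tau> x))\<^sup>2 \<le> 2\<^sup>2" using b by (intro power_mono) auto
  then have z2: "cmod (- \<i> * of_real (\<epsilon> / 2 * (cmod (slow_pos \<tau> x))\<^sup>2)) \<le> 2 * \<epsilon>"
    using eps by (simp add: norm_mult norm_power)
  have "\<bar>Im (cnj (snd x) * fst x)\<bar> \<le> cmod (cnj (snd x) * fst x)" by (rule abs_Im_le_cmod)
  also have "\<dots> \<le> 1 / 2 * (3 / 2)" by (rule norm_mult_le) (use b in auto)
  finally have "cmod (of_real (\<epsilon> * Im (cnj (snd x) * fst x))) \<le> \<epsilon>"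
    by (intro norm_eps_mult) simp
  from norm_mult_le[OF this b(3)]
  have h: "cmod (of_real (\<epsilon> * Im (cnj (snd x) * fst x)) * slow_pos \<tau> x) \<le> \<epsilon> * 2" .
  have "cmod (of_real (\<kappa> * \<epsilon>\<^sup>2) * tide_force a (slow_pos \<tau> x)) \<le> \<kappa> * \<epsilon>\<^sup>2 * B"
    by (rule norm_mult_le[OF norm_kappa force_bound[OF b(3)]])
  then have f: "cmod (slow_force \<tau> x) \<le> 3 * \<epsilon>"
    unfolding slow_force_def
    using norm_triangle_ineq[of "of_real (\<epsilon> * Im (cnj (snd x) * fst x)) * slow_pos \<tau> x"
        "of_real (\<kappa> * \<epsilon>\<^sup>2) * tide_force a (slow_pos \<tau> x)"] h kappa_eps2 eps
    by linarith
  have "norm (slow_field \<tau> x) \<le> norm (fst (slow_field \<tau> x)) + norm (snd (slow_field \<tau> x))"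
    using norm_Pair_le[of "fst (slow_field \<tau> x)" "snd (slow_field \<tau> x)"] by simp
  also have "\<dots> \<le> (2 * \<epsilon> * (3 / 2) + 1 * (3 * \<epsilon>)) + (2 * \<epsilon> * (1 / 2) + 1 * (3 * \<epsilon>))"
    unfolding slow_field_def fst_conv snd_conv
    by (intro add_mono order_trans[OF norm_triangle_ineq add_mono] order_trans[OF norm_triangle_ineq4 add_mono]
        norm_mult_le z2 b f s)
  also have "\<dots> = 10 * 1 * \<epsilon>" by simp
  also have "\<dots> \<le> 10 * B * \<epsilon>" using B1 eps by (intro mult_right_mono) auto
  finally show ?thesis .
qed

lemma slow_field_lip:
  assumes x: "x \<in> slow_dom" and x': "x' \<in> slow_dom"
  shows "norm (slow_field \<tau> x - slow_field \<tau> x') \<le> 40 * B * \<epsilon> * norm (x - x')"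
proof -
  define D where "D = norm (x - x')"
  have D0: "0 \<le> D" by (simp add: D_def)
  note b = slow_pos_bounds(1,2)[OF x] slow_pos_bounds(3)[OF x, of \<tau>]
    and b' = slow_pos_bounds(1,2)[OF x'] slow_pos_bounds(3)[OF x', of \<tau>]
  have s: "cmod (of_real (sin \<tau>)) \<le> 1" "cmod (of_real (cos \<tau>)) \<le> 1" by auto
  have d: "cmod (fst x - fst x') \<le> D" "cmod (snd x - snd x') \<le> D"
    using norm_fst_snd_le[of "x - x'"] by (auto simp: D_def)
  have "slow_pos \<tau> x - slow_pos \<tau> x' = of_real (sin \<tau>) * (fst x - fst x') + of_real (cos \<tau>) * (snd x - snd x')"
    by (simp add: slow_pos_def algebra_simps)
  then have dz: "cmod (slow_pos \<tau> x - slow_pos \<tau> x') \<le> 2 * D"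
    using norm_triangle_ineq[of "of_real (sin \<tau>) * (fst x - fst x')" "of_real (cos \<tau>) * (snd x - snd x')"]
      norm_mult_le[OF s(1) d(1)] norm_mult_le[OF s(2) d(2)] by auto
  have "\<bar>cmod (slow_pos \<tau> x) - cmod (slow_pos \<tau> x')\<bar> * (cmod (slow_pos \<tau> x) + cmod (slow_pos \<tau> x')) \<le> 2 * D * 4"
    using b b' D0 by (intro mult_mono order_trans[OF norm_triangle_ineq3 dz]) auto
  moreover have "(cmod (slow_pos \<tau> x))\<^sup>2 - (cmod (slow_pos \<tau> x'))\<^sup>2
      = (cmod (slow_pos \<tau> x) - cmod (slow_pos \<tau> x')) * (cmod (slow_pos \<tau> x) + cmod (slow_pos \<tau> x'))"
    by (simp add: power2_eq_square algebra_simps)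
  ultimately have "\<bar>(cmod (slow_pos \<tau> x))\<^sup>2 - (cmod (slow_pos \<tau> x'))\<^sup>2\<bar> \<le> 8 * D"
    by (simp add: abs_mult)
  then have dz2: "cmod (- \<i> * of_real (\<epsilon> / 2 * (cmod (slow_pos \<tau> x))\<^sup>2) - (- \<i> * of_real (\<epsilon> / 2 * (cmod (slow_pos \<tau> x'))\<^sup>2))) \<le> 4 * \<epsilon> * D"
  proof -
    assume *: "\<bar>(cmod (slow_pos \<tau> x))\<^sup>2 - (cmod (slow_pos \<tau> x'))\<^sup>2\<bar> \<le> 8 * D"
    have "- \<i> * of_real (\<epsilon> / 2 * (cmod (slow_pos \<tau> x))\<^sup>2) - (- \<i> * of_real (\<epsilon> / 2 * (cmod (slow_pos \<tau> x'))\<^sup>2))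
       = - \<i> * of_real (\<epsilon> / 2 * ((cmod (slow_pos \<tau> x))\<^sup>2 - (cmod (slow_pos \<tau> x'))\<^sup>2))"
      by (simp add: algebra_simps)
    then have "cmod (- \<i> * of_real (\<epsilon> / 2 * (cmod (slow_pos \<tau> x))\<^sup>2) - (- \<i> * of_real (\<epsilon> / 2 * (cmod (slow_pos \<tau> x'))\<^sup>2)))
       = \<epsilon> / 2 * \<bar>(cmod (slow_pos \<tau> x))\<^sup>2 - (cmod (slow_pos \<tau> x'))\<^sup>2\<bar>"
      using eps by (simp only: norm_mult norm_of_real abs_mult) simp
    also have "\<dots> \<le> \<epsilon> / 2 * (8 * D)" using * eps by (intro mult_left_mono) auto
    also have "\<dots> = 4 * \<epsilon> * D" by simp
    finally show ?thesis .
  qed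
  have "(cmod (slow_pos \<tau> x))\<^sup>2 \<le> 2\<^sup>2" using b by (intro power_mono) auto
  then have z2: "cmod (- \<i> * of_real (\<epsilon> / 2 * (cmod (slow_pos \<tau> x))\<^sup>2)) \<le> 2 * \<epsilon>"
    using eps by (simp add: norm_mult norm_power)
  have "\<bar>Im (cnj (snd x) * fst x)\<bar> \<le> cmod (cnj (snd x) * fst x)" by (rule abs_Im_le_cmod)
  also have "\<dots> \<le> 1 / 2 * (3 / 2)" by (rule norm_mult_le) (use b in auto)
  finally have h: "cmod (of_real (\<epsilon> * Im (cnj (snd x) * fst x))) \<le> \<epsilon>"
    by (intro norm_eps_mult) simp
  have "\<bar>Im (cnj (snd x) * fst x) - Im (cnj (snd x') * fst x')\<bar> \<le> cmod (cnj (snd x) * fst x - cnj (snd x') * fst x')"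
    using abs_Im_le_cmod[of "cnj (snd x) * fst x - cnj (snd x') * fst x'"] by simp
  also have "\<dots> \<le> 1 / 2 * D + D * (3 / 2)"
    by (rule norm_mult_diff_le) (use b b' d in \<open>auto simp flip: complex_cnj_diff\<close>)
  finally have "\<epsilon> * \<bar>Im (cnj (snd x) * fst x) - Im (cnj (snd x') * fst x')\<bar> \<le> \<epsilon> * (2 * D)"
    using eps by (intro mult_left_mono) auto
  then have dh: "cmod (of_real (\<epsilon> * Im (cnj (snd x) * fst x)) - of_real (\<epsilon> * Im (cnj (snd x') * fst x'))) \<le> 2 * \<epsilon> * D"
    unfolding of_real_diff[symmetric] norm_of_real right_diff_distrib[symmetric] abs_mult using eps by simp
  have "cmod (of_real (\<kappa> * \<epsilon>\<^sup>2) * (tide_force a (slow_pos \<tau> x) - tide_force a (slow_pos \<tau> x'))) \<le> \<kappa> * \<epsilon>\<^sup>2 * (B * (2 * D))"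
    by (rule norm_mult_le[OF norm_kappa])
      (use B1 in \<open>auto intro!: order_trans[OF force_lip[OF b(3) b'(3)]] mult_left_mono dz\<close>)
  also have "\<dots> \<le> \<epsilon> / 100000 * (2 * D)"
    using mult_right_mono[OF kappa_eps2(1), of "2 * D"] D0 by (simp add: mult_ac)
  also have "\<dots> \<le> \<epsilon> * D" using eps D0 by simp
  finally have dN: "cmod (of_real (\<kappa> * \<epsilon>\<^sup>2) * tide_force a (slow_pos \<tau> x) - of_real (\<kappa> * \<epsilon>\<^sup>2) * tide_force a (slow_pos \<tau> x')) \<le> \<epsilon> * D"
    by (simp only: right_diff_distrib)
  have "cmod (of_real (\<epsilon> * Im (cnj (snd x) * fst x)) * slow_pos \<tau> x - of_real (\<epsilon> * Im (cnj (snd x') * fst x')) * slow_pos \<tau> x')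
      \<le> \<epsilon> * (2 * D) + 2 * \<epsilon> * D * 2"
    by (rule norm_mult_diff_le[OF h b'(3) dh dz])
  then have df: "cmod (slow_force \<tau> x - slow_force \<tau> x') \<le> 7 * \<epsilon> * D"
    unfolding slow_force_def using dN norm_diff_triangle_ineq[of
      "of_real (\<epsilon> * Im (cnj (snd x) * fst x)) * slow_pos \<tau> x" "of_real (\<kappa> * \<epsilon>\<^sup>2) * tide_force a (slow_pos \<tau> x)"
      "of_real (\<epsilon> * Im (cnj (snd x') * fst x')) * slow_pos \<tau> x'" "of_real (\<kappa> * \<epsilon>\<^sup>2) * tide_force a (slow_pos \<tau> x')"]
    by linarith
  have f1: "cmod (of_real (cos \<tau>) * slow_force \<tau> x - of_real (cos \<tau>) * slow_force \<tau> x') \<le> 1 * (7 * \<epsilon> * D)"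
    "cmod (of_real (sin \<tau>) * slow_force \<tau> x - of_real (sin \<tau>) * slow_force \<tau> x') \<le> 1 * (7 * \<epsilon> * D)"
    unfolding right_diff_distrib[symmetric] by (intro norm_mult_le df s)+
  have g1: "cmod (- \<i> * of_real (\<epsilon> / 2 * (cmod (slow_pos \<tau> x))\<^sup>2) * fst x - - \<i> * of_real (\<epsilon> / 2 * (cmod (slow_pos \<tau> x'))\<^sup>2) * fst x')
      \<le> 2 * \<epsilon> * D + 4 * \<epsilon> * D * (3 / 2)"
    by (rule norm_mult_diff_le[OF z2 b'(1) dz2 d(1)])
  have g2: "cmod (- \<i> * of_real (\<epsilon> / 2 * (cmod (slow_pos \<tau> x))\<^sup>2) * snd x - - \<i> * of_real (\<epsilon> / 2 * (cmod (slow_pos \<tau> x'))\<^sup>2) * snd x')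
      \<le> 2 * \<epsilon> * D + 4 * \<epsilon> * D * (1 / 2)"
    by (rule norm_mult_diff_le[OF z2 b'(2) dz2 d(2)])
  have 1: "cmod (fst (slow_field \<tau> x) - fst (slow_field \<tau> x')) \<le> 15 * \<epsilon> * D"
    unfolding slow_field_def fst_conv
    by (rule order_trans[OF norm_diff_triangle_ineq order_trans[OF add_mono[OF g1 f1(1)]]]) simp
  have 2: "cmod (snd (slow_field \<tau> x) - snd (slow_field \<tau> x')) \<le> 11 * \<epsilon> * D"
  proof -
    have *: "p - q - (p' - q') = (p - p') - (q - q')" for p q p' q' :: complex by simp
    show ?thesis
      unfolding slow_field_def snd_conv
      by (subst *, rule order_trans[OF norm_triangle_ineq4 order_trans[OF add_mono[OF g2 f1(2)]]]) simp
  qed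
  have "norm (slow_field \<tau> x - slow_field \<tau> x')
     \<le> cmod (fst (slow_field \<tau> x) - fst (slow_field \<tau> x')) + cmod (snd (slow_field \<tau> x) - snd (slow_field \<tau> x'))"
    using norm_Pair_le[of "fst (slow_field \<tau> x - slow_field \<tau> x')" "snd (slow_field \<tau> x - slow_field \<tau> x')"]
    unfolding prod.collapse by simp
  also have "\<dots> \<le> 40 * 1 * \<epsilon> * D" using 1 2 eps D0 mult_nonneg_nonneg[of \<epsilon> D] by linarith
  also have "\<dots> \<le> 40 * B * \<epsilon> * D" using B1 eps D0 by (intro mult_right_mono) auto
  finally show ?thesis by (simp add: D_def)
qed

lemma slow_field_continuous: "continuous_on ({0..T} \<times> slow_dom) (\<lambda>x. slow_field (fst x) (snd x))"
proof -
  have p: "continuous_on ({0..T} \<times> slow_dom) (\<lambda>x. slow_pos (fst x) (snd x))"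
    unfolding slow_pos_def by (intro continuous_intros)
  have "continuous_on ({0..T} \<times> slow_dom) (\<lambda>x. tide_force a (slow_pos (fst x) (snd x)))"
    by (rule continuous_on_compose2[OF continuous_on_force p]) (use slow_pos_bounds in auto)
  with p show ?thesis
    unfolding slow_field_def slow_force_def by (intro continuous_intros) auto
qed

text \<open>In the slow variables both the size and the Lipschitz constant of the field are O(B
  \<epsilon>), and \<epsilon> T \<le> \<eta>. Hence one application of
  \<open>picard_parametric\<close> covers all n half periods, and undoing the oscillation gives z
  and y.\<close>

lemma solutions_exist:
  obtains Z Y :: "real \<Rightarrow> real \<Rightarrow> complex"
  where "continuous_on (UNIV \<times> {0..T}) (\<lambda>x. Z (fst x) (snd x))"
    "continuous_on (UNIV \<times> {0..T}) (\<lambda>x. Y (fst x) (snd x))"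
    "\<And>\<theta>. Z \<theta> 0 = 0" "\<And>\<theta>. Y \<theta> 0 = cis \<theta>" "\<And>\<theta>. rtbp_solution a \<kappa> \<epsilon> T (Z \<theta>) (Y \<theta>)"
proof -
  obtain X where X: "continuous_on (UNIV \<times> {0..T}) (\<lambda>x. X (fst x) (snd x))"
    "\<And>p::real. X p 0 = (cis p, 0)"
    "\<And>p \<tau>. \<tau> \<in> {0..T} \<Longrightarrow> X p \<tau> \<in> cball (cis p, 0) (1/2)"
    "\<And>p \<tau>. \<tau> \<in> {0..T} \<Longrightarrow> (X p has_vector_derivative slow_field \<tau> (X p \<tau>)) (at \<tau> within {0..T})"
  proof (rule picard_parametric[where P = UNIV and ?x0.0 = "\<lambda>p. (cis p, 0)" and R = "1/2" and S = slow_dom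
        and f = slow_field and T = T and M = "10 * B * \<epsilon>" and L = "40 * B * \<epsilon>"])
    show "continuous_on UNIV (\<lambda>p::real. (cis p, 0 :: complex))" by (intro continuous_intros)
    show "cball (cis p, 0) (1 / 2) \<subseteq> slow_dom" for p
    proof
      fix x assume "x \<in> cball (cis p, 0 :: complex) (1/2)"
      then have *: "norm (x - (cis p, 0)) \<le> 1/2" by (simp add: dist_norm norm_minus_commute)
      have 1: "cmod (fst x - cis p) \<le> 1/2" "cmod (snd x) \<le> 1/2"
        using norm_fst_snd_le[of "x - (cis p, 0)"] * by auto
      have "cmod (fst x) \<le> cmod (fst x - cis p) + cmod (cis p)"
        using norm_triangle_ineq[of "fst x - cis p" "cis p"] by simp
      then show "x \<in> slow_dom" using 1 by (auto simp: slow_dom_def mem_Times_iff)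
    qed
    show "10 * B * \<epsilon> * T \<le> 1/2" "40 * B * \<epsilon> * T \<le> 1/2"
    proof -
      have "B * (\<epsilon> * T) \<le> B * \<eta>" using B1 eps_T by (intro mult_left_mono) auto
      then show "10 * B * \<epsilon> * T \<le> 1/2" "40 * B * \<epsilon> * T \<le> 1/2"
        using etaB by (auto simp: mult_ac)
    qed
  qed (use slow_field_continuous slow_field_bound slow_field_lip T1 B1 eps in auto)
  have dom: "X p \<tau> \<in> slow_dom" if "\<tau> \<in> {0..T}" for p \<tau>
  proof -
    have *: "norm (X p \<tau> - (cis p, 0)) \<le> 1/2" using X(3)[OF that, of p] by (simp add: dist_norm norm_minus_commute)
    have 1: "cmod (fst (X p \<tau>) - cis p) \<le> 1/2" "cmod (snd (X p \<tau>)) \<le> 1/2"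
      using norm_fst_snd_le[of "X p \<tau> - (cis p, 0)"] * by auto
    have "cmod (fst (X p \<tau>)) \<le> cmod (fst (X p \<tau>) - cis p) + cmod (cis p)"
      using norm_triangle_ineq[of "fst (X p \<tau>) - cis p" "cis p"] by simp
    then show ?thesis using 1 by (auto simp: slow_dom_def mem_Times_iff)
  qed
  define Z where "Z p \<tau> = slow_pos \<tau> (X p \<tau>)" for p \<tau>
  define Y where "Y p \<tau> = of_real (cos \<tau>) * fst (X p \<tau>) - of_real (sin \<tau>) * snd (X p \<tau>)" for p \<tau>
  have "rtbp_solution a \<kappa> \<epsilon> T (Z p) (Y p)" for p
    unfolding rtbp_solution_def
  proof (intro ballI conjI)
    fix \<tau> assume \<tau>: "\<tau> \<in> {0..T}"
    note b = slow_pos_bounds[OF dom[OF \<tau>, of p]]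
    show "cmod (Z p \<tau>) \<le> 2" using b by (simp add: Z_def)
    have s: "cmod (of_real (sin \<tau>)) \<le> 1" "cmod (of_real (cos \<tau>)) \<le> 1" by auto
    show "cmod (Y p \<tau>) \<le> 2"
      using norm_triangle_ineq4[of "of_real (cos \<tau>) * fst (X p \<tau>)" "of_real (sin \<tau>) * snd (X p \<tau>)"]
        norm_mult_le[OF s(2) b(1)] norm_mult_le[OF s(1) b(2)]
      unfolding Y_def by linarith
    define A D where "A = fst (X p \<tau>)" and "D = snd (X p \<tau>)"
    define A' D' where "A' = fst (slow_field \<tau> (X p \<tau>))" and "D' = snd (slow_field \<tau> (X p \<tau>))"
    have dA: "((\<lambda>\<tau>. fst (X p \<tau>)) has_vector_derivative A') (at \<tau> within {0..T})"
      and dD: "((\<lambda>\<tau>. snd (X p \<tau>)) has_vector_derivative D') (at \<tau> within {0..T})"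
      using X(4)[OF \<tau>, of p] unfolding has_vector_derivative_def A'_def D'_def
      by (auto dest: has_derivative_fst has_derivative_snd)
    have ds: "((\<lambda>\<tau>. complex_of_real (sin \<tau>)) has_vector_derivative of_real (cos \<tau>)) (at \<tau> within {0..T})"
      and dc: "((\<lambda>\<tau>. complex_of_real (cos \<tau>)) has_vector_derivative of_real (- sin \<tau>)) (at \<tau> within {0..T})"
      by (intro has_vector_derivative_of_real; auto intro!: derivative_eq_intros)+
    have dZ: "(Z p has_vector_derivative of_real (sin \<tau>) * A' + of_real (cos \<tau>) * A +
        (of_real (cos \<tau>) * D' + of_real (- sin \<tau>) * D)) (at \<tau> within {0..T})"
      unfolding Z_def slow_pos_def A_def D_def
      by (intro has_vector_derivative_add has_vector_derivative_mult dA dD ds dc)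
    have dY: "(Y p has_vector_derivative of_real (cos \<tau>) * A' + of_real (- sin \<tau>) * A -
        (of_real (sin \<tau>) * D' + of_real (cos \<tau>) * D)) (at \<tau> within {0..T})"
      unfolding Y_def A_def D_def
      by (intro has_vector_derivative_diff has_vector_derivative_mult dA dD ds dc)
    define w where "w = - \<i> * of_real (\<epsilon> / 2 * (cmod (Z p \<tau>))\<^sup>2)"
    define g where "g = slow_force \<tau> (X p \<tau>)"
    define s c where "s = complex_of_real (sin \<tau>)" and "c = complex_of_real (cos \<tau>)"
    have sc: "s * s + c * c = 1"
      unfolding s_def c_def of_real_mult[symmetric] of_real_add[symmetric] by (simp flip: power2_eq_square)
    have A': "A' = w * A + c * g" and D': "D' = w * D - s * g"
      by (simp_all add: A'_def D'_def slow_field_def w_def g_def s_def c_def A_def D_def Z_def)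
    have Z: "Z p \<tau> = s * A + c * D" and Y: "Y p \<tau> = c * A - s * D"
      by (simp_all add: Z_def Y_def slow_pos_def s_def c_def A_def D_def)
    \<comment> \<open>The passage from (A, D) to (z, y) is a rotation of the pair, with determinant
      sin^2 + cos^2 = 1, and therefore preserves the angular momentum.\<close>
    have h: "Im (cnj (Z p \<tau>) * Y p \<tau>) = Im (cnj D * A)"
    proof -
      have "cnj s = s" "cnj c = c" by (simp_all add: s_def c_def)
      then have "cnj (Z p \<tau>) * Y p \<tau> = s * c * (cnj A * A - cnj D * D) + (c * c) * (cnj D * A) - (s * s) * (cnj A * D)"
        unfolding Z Y by (simp add: algebra_simps)
      also have "\<dots> = of_real (sin \<tau> * cos \<tau> * ((cmod A)\<^sup>2 - (cmod D)\<^sup>2)) + of_real (cos \<tau> * cos \<tau>) * (cnj D * A)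
          - of_real (sin \<tau> * sin \<tau>) * cnj (cnj D * A)"
        by (simp add: s_def c_def complex_norm_square[symmetric] mult.commute flip: of_real_power)
      finally have "Im (cnj (Z p \<tau>) * Y p \<tau>) = (cos \<tau> * cos \<tau>) * Im (cnj D * A) + (sin \<tau> * sin \<tau>) * Im (cnj D * A)"
        by (simp only: minus_complex.sel plus_complex.sel Im_complex_of_real) (simp add: algebra_simps)
      also have "\<dots> = (cos \<tau> * cos \<tau> + sin \<tau> * sin \<tau>) * Im (cnj D * A)"
        by (rule distrib_right[symmetric])
      also have "cos \<tau> * cos \<tau> + sin \<tau> * sin \<tau> = 1" by (simp flip: power2_eq_square)
      finally show ?thesis by (simp only: mult_1)
    qed
    have g: "g = of_real (\<epsilon> * Im (cnj (Z p \<tau>) * Y p \<tau>)) * Z p \<tau> + of_real (\<kappa> * \<epsilon>\<^sup>2) * tide_force a (Z p \<tau>)"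
      unfolding h by (simp add: g_def slow_force_def A_def D_def Z_def)
    have "s * A' + c * A + (c * D' + of_real (- sin \<tau>) * D) = Y p \<tau> + w * Z p \<tau>"
      unfolding A' D' Z Y by (simp add: algebra_simps s_def)
    then have dZ': "(Z p has_vector_derivative Y p \<tau> + w * Z p \<tau>) (at \<tau> within {0..T})"
      using dZ unfolding s_def c_def by simp
    have "c * A' + of_real (- sin \<tau>) * A - (s * D' + c * D) = w * Y p \<tau> - Z p \<tau> + (s * s + c * c) * g"
      unfolding A' D' Z Y by (simp add: algebra_simps s_def)
    then have dY': "(Y p has_vector_derivative w * Y p \<tau> - Z p \<tau> + g) (at \<tau> within {0..T})"
      using dY unfolding sc unfolding s_def c_def by simp
    have "rtbp_field a \<kappa> \<epsilon> (Z p \<tau>, Y p \<tau>) = (Y p \<tau> + w * Z p \<tau>, w * Y p \<tau> - Z p \<tau> + g)"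
      unfolding rtbp_field_def prod.case g w_def by simp
    then show "((\<lambda>\<tau>. (Z p \<tau>, Y p \<tau>)) has_vector_derivative rtbp_field a \<kappa> \<epsilon> (Z p \<tau>, Y p \<tau>)) (at \<tau> within {0..T})"
      using has_vector_derivative_Pair[OF dZ' dY'] by simp
  qed
  moreover have "continuous_on (UNIV \<times> {0..T}) (\<lambda>x. Z (fst x) (snd x))"
    "continuous_on (UNIV \<times> {0..T}) (\<lambda>x. Y (fst x) (snd x))"
    unfolding Z_def Y_def slow_pos_def by (intro continuous_intros X)+
  moreover have "Z p 0 = 0" "Y p 0 = cis p" for p
    using X(2)[of p] by (simp_all add: Z_def Y_def slow_pos_def)
  ultimately show ?thesis using that by blast
qed

end

section \<open>Perturbed oscillations\<close>

locale rtbp_orbit = rtbp +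
  fixes Z Y :: "real \<Rightarrow> complex" and \<theta> :: real
  assumes sol: "rtbp_solution a \<kappa> \<epsilon> T Z Y" and Z0: "Z 0 = 0" and Y0: "Y 0 = cis \<theta>"
begin

definition ang_mom :: "real \<Rightarrow> real" where "ang_mom \<tau> = Im (cnj (Z \<tau>) * Y \<tau>)"

definition rot :: "real \<Rightarrow> complex" where "rot \<tau> = - \<i> * of_real (\<epsilon> / 2 * (cmod (Z \<tau>))\<^sup>2)"

definition pert :: "real \<Rightarrow> complex" where
  "pert \<tau> = of_real (\<epsilon> * ang_mom \<tau>) * Z \<tau> + of_real (\<kappa> * \<epsilon>\<^sup>2) * tide_force a (Z \<tau>)"

lemma Z_le: "\<tau> \<in> {0..T} \<Longrightarrow> cmod (Z \<tau>) \<le> 2" and Y_le: "\<tau> \<in> {0..T} \<Longrightarrow> cmod (Y \<tau>) \<le> 2"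
  using sol unfolding rtbp_solution_def by auto

lemma dZ: "\<tau> \<in> {0..T} \<Longrightarrow> (Z has_vector_derivative Y \<tau> + rot \<tau> * Z \<tau>) (at \<tau> within {0..T})"
  and dY: "\<tau> \<in> {0..T} \<Longrightarrow> (Y has_vector_derivative rot \<tau> * Y \<tau> - Z \<tau> + pert \<tau>) (at \<tau> within {0..T})"
proof -
  assume \<tau>: "\<tau> \<in> {0..T}"
  have d: "((\<lambda>\<tau>. (Z \<tau>, Y \<tau>)) has_vector_derivative (Y \<tau> + rot \<tau> * Z \<tau>, rot \<tau> * Y \<tau> - Z \<tau> + pert \<tau>)) (at \<tau> within {0..T})"
  proof -
    have "rtbp_field a \<kappa> \<epsilon> (Z \<tau>, Y \<tau>) = (Y \<tau> + rot \<tau> * Z \<tau>, rot \<tau> * Y \<tau> - Z \<tau> + pert \<tau>)"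
      by (simp add: rtbp_field_def rot_def pert_def ang_mom_def)
    then show ?thesis using sol \<tau> unfolding rtbp_solution_def by metis
  qed
  show "(Z has_vector_derivative Y \<tau> + rot \<tau> * Z \<tau>) (at \<tau> within {0..T})"
    using d unfolding has_vector_derivative_def by (auto dest: has_derivative_fst)
  show "(Y has_vector_derivative rot \<tau> * Y \<tau> - Z \<tau> + pert \<tau>) (at \<tau> within {0..T})"
    using d unfolding has_vector_derivative_def by (auto dest: has_derivative_snd)
qed

lemma cont_Z: "continuous_on {0..T} Z" and cont_Y: "continuous_on {0..T} Y"
  unfolding continuous_on_eq_continuous_within
  using dZ dY has_vector_derivative_continuous by blast+

lemma has_real_derivative_Im:
  "(f has_vector_derivative f') (at x within S) \<Longrightarrow> ((\<lambda>x. Im (f x)) has_real_derivative Im f') (at x within S)"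
  by (auto simp: has_real_derivative_iff_has_vector_derivative
      intro: bounded_linear.has_vector_derivative[OF bounded_linear_Im])

lemma has_real_derivative_Re:
  "(f has_vector_derivative f') (at x within S) \<Longrightarrow> ((\<lambda>x. Re (f x)) has_real_derivative Re f') (at x within S)"
  by (auto simp: has_real_derivative_iff_has_vector_derivative
      intro: bounded_linear.has_vector_derivative[OF bounded_linear_Re])

lemma d_ZY:
  assumes "\<tau> \<in> {0..T}"
  shows "((\<lambda>\<tau>. cnj (Z \<tau>) * Y \<tau>) has_vector_derivative
     cnj (Z \<tau>) * (rot \<tau> * Y \<tau> - Z \<tau> + pert \<tau>) + cnj (Y \<tau> + rot \<tau> * Z \<tau>) * Y \<tau>) (at \<tau> within {0..T})"
  by (intro has_vector_derivative_mult dY bounded_linear.has_vector_derivative[OF bounded_linear_cnj] dZ assms)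

text \<open>The frame rotation cancels since \<open>rot\<close> is purely imaginary. The first
  summand is real, so the imaginary part leaves only the torque; the real part is the derivative of
  \<open>rho\<close>.\<close>

lemma d_ZY_eq: "cnj (Z \<tau>) * (rot \<tau> * Y \<tau> - Z \<tau> + pert \<tau>) + cnj (Y \<tau> + rot \<tau> * Z \<tau>) * Y \<tau>
  = of_real ((cmod (Y \<tau>))\<^sup>2 - (1 - \<epsilon> * ang_mom \<tau>) * (cmod (Z \<tau>))\<^sup>2) + of_real (\<kappa> * \<epsilon>\<^sup>2) * (cnj (Z \<tau>) * tide_force a (Z \<tau>))"
proof -
  have "cnj (rot \<tau>) = - rot \<tau>" by (simp add: rot_def)
  then have "cnj (Z \<tau>) * (rot \<tau> * Y \<tau> - Z \<tau> + pert \<tau>) + cnj (Y \<tau> + rot \<tau> * Z \<tau>) * Y \<tau>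
      = Y \<tau> * cnj (Y \<tau>) - Z \<tau> * cnj (Z \<tau>) + cnj (Z \<tau>) * pert \<tau>"
    by (simp add: algebra_simps)
  also have "\<dots> = Y \<tau> * cnj (Y \<tau>) - Z \<tau> * cnj (Z \<tau>) + of_real (\<epsilon> * ang_mom \<tau>) * (Z \<tau> * cnj (Z \<tau>))
       + of_real (\<kappa> * \<epsilon>\<^sup>2) * (cnj (Z \<tau>) * tide_force a (Z \<tau>))"
    by (simp add: pert_def algebra_simps)
  finally show ?thesis unfolding complex_norm_square[symmetric] by (simp add: algebra_simps)
qed

lemma d_ang_mom:
  assumes "\<tau> \<in> {0..T}"
  shows "(ang_mom has_real_derivative \<kappa> * \<epsilon>\<^sup>2 * tide_torque a (Z \<tau>)) (at \<tau> within {0..T})"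
proof -
  have "Im (of_real ((cmod (Y \<tau>))\<^sup>2 - (1 - \<epsilon> * ang_mom \<tau>) * (cmod (Z \<tau>))\<^sup>2) + of_real (\<kappa> * \<epsilon>\<^sup>2) * (cnj (Z \<tau>) * tide_force a (Z \<tau>)))
      = \<kappa> * \<epsilon>\<^sup>2 * tide_torque a (Z \<tau>)"
    unfolding tide_torque_def plus_complex.sel Im_complex_of_real times_complex.sel Re_complex_of_real by simp
  with has_real_derivative_Im[OF d_ZY[OF assms]] show ?thesis
    unfolding d_ZY_eq by (simp only: ang_mom_def[abs_def])
qed

lemma ang_mom_lip:
  assumes "\<sigma> \<in> {0..T}" "\<tau> \<in> {0..T}" 
  shows "\<bar>ang_mom \<tau> - ang_mom \<sigma>\<bar> \<le> \<kappa> * \<epsilon>\<^sup>2 * B * \<bar>\<tau> - \<sigma>\<bar>"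
proof -
  have *: "\<bar>ang_mom \<tau> - ang_mom \<sigma>\<bar> \<le> \<kappa> * \<epsilon>\<^sup>2 * B * (\<tau> - \<sigma>)"
    if "0 \<le> \<sigma>" "\<sigma> \<le> \<tau>" "\<tau> \<le> T" for \<sigma> \<tau>
  proof -
    have "norm (ang_mom \<tau> - ang_mom \<sigma>) \<le> \<kappa> * \<epsilon>\<^sup>2 * B * \<tau> - \<kappa> * \<epsilon>\<^sup>2 * B * \<sigma>"
    proof (rule norm_diff_le_of_deriv[where f' = "\<lambda>s. \<kappa> * \<epsilon>\<^sup>2 * tide_torque a (Z s)" and \<phi>' = "\<lambda>s. \<kappa> * \<epsilon>\<^sup>2 * B" and S = "{0..T}"])
      fix s assume s: "s \<in> {\<sigma>..\<tau>}"
      then have s': "s \<in> {0..T}" using that by auto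
      show "(ang_mom has_vector_derivative \<kappa> * \<epsilon>\<^sup>2 * tide_torque a (Z s)) (at s within {0..T})"
        using d_ang_mom[OF s'] by (simp add: has_real_derivative_iff_has_vector_derivative)
      show "((*) (\<kappa> * \<epsilon>\<^sup>2 * B) has_real_derivative \<kappa> * \<epsilon>\<^sup>2 * B) (at s within {0..T})"
        by (auto intro!: derivative_eq_intros)
      have "\<kappa> * \<epsilon>\<^sup>2 * \<bar>tide_torque a (Z s)\<bar> \<le> \<kappa> * \<epsilon>\<^sup>2 * B"
        using torque_bound[OF Z_le[OF s']] kappa by (intro mult_left_mono) auto
      then show "norm (\<kappa> * \<epsilon>\<^sup>2 * tide_torque a (Z s)) \<le> \<kappa> * \<epsilon>\<^sup>2 * B" using kappa by (simp add: abs_mult)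
    qed (use that in auto)
    then show ?thesis by (simp add: algebra_simps)
  qed
  show ?thesis using *[of \<sigma> \<tau>] *[of \<tau> \<sigma>] assms by (cases "\<sigma> \<le> \<tau>") auto
qed

lemma ang_mom_0: "ang_mom 0 = 0" by (simp add: ang_mom_def Z0)

text \<open>The first bound keeps the factor \<kappa>, so that the term \<epsilon> h z of the field,
  h being the angular momentum, can be treated as a perturbation of the same order as the
  tide.\<close>

lemma ang_mom_bound:
  assumes "\<tau> \<in> {0..T}"
  shows "\<epsilon> * \<bar>ang_mom \<tau>\<bar> \<le> \<kappa> * \<epsilon>\<^sup>2 / 100000" "\<bar>ang_mom \<tau>\<bar> \<le> \<epsilon> / 100000"
proof -
  have "\<bar>ang_mom \<tau>\<bar> \<le> \<kappa> * \<epsilon>\<^sup>2 * B * \<tau>"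
    using ang_mom_lip[of 0 \<tau>] assms T1 by (simp add: ang_mom_0)
  then have "\<epsilon> * \<bar>ang_mom \<tau>\<bar> \<le> \<epsilon> * (\<kappa> * \<epsilon>\<^sup>2 * B * \<tau>)" using eps by (intro mult_left_mono) auto
  also have "\<dots> = \<kappa> * \<epsilon>\<^sup>2 * (B * (\<epsilon> * \<tau>))" by simp
  also have "\<dots> \<le> \<kappa> * \<epsilon>\<^sup>2 * (B * \<eta>)"
    using eps_tau[of \<tau>] assms kappa B1 by (intro mult_left_mono) auto
  also have "\<dots> \<le> \<kappa> * \<epsilon>\<^sup>2 * (1 / 100000)" using etaB(1) kappa by (intro mult_left_mono) (auto simp: mult.commute)
  finally show 1: "\<epsilon> * \<bar>ang_mom \<tau>\<bar> \<le> \<kappa> * \<epsilon>\<^sup>2 / 100000" by simp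
  have "\<kappa> * \<epsilon>\<^sup>2 \<le> 1 * \<epsilon>\<^sup>2" using kappa by (intro mult_right_mono) auto
  with 1 have "\<epsilon> * \<bar>ang_mom \<tau>\<bar> \<le> \<epsilon> * (\<epsilon> / 100000)" by (simp add: power2_eq_square)
  then show "\<bar>ang_mom \<tau>\<bar> \<le> \<epsilon> / 100000" using eps by simp
qed

lemma pert_bound:
  assumes "\<tau> \<in> {0..T}"
  shows "cmod (pert \<tau>) \<le> 2 * B * \<kappa> * \<epsilon>\<^sup>2"
proof -
  have "cmod (of_real (\<epsilon> * ang_mom \<tau>)) \<le> \<kappa> * \<epsilon>\<^sup>2 / 100000"
    using ang_mom_bound(1)[OF assms] eps unfolding norm_of_real abs_mult by simp
  from norm_mult_le[OF this Z_le[OF assms]] norm_mult_le[OF norm_kappa force_bound[OF Z_le[OF assms]]]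
  have "cmod (pert \<tau>) \<le> \<kappa> * \<epsilon>\<^sup>2 / 100000 * 2 + \<kappa> * \<epsilon>\<^sup>2 * B"
    unfolding pert_def by (intro order_trans[OF norm_triangle_ineq] add_mono)
  also have "\<kappa> * \<epsilon>\<^sup>2 / 100000 * 2 \<le> \<kappa> * \<epsilon>\<^sup>2 * 1" using kappa by simp
  also have "\<dots> \<le> \<kappa> * \<epsilon>\<^sup>2 * B" using B1 kappa by (intro mult_left_mono) auto
  finally show ?thesis by (simp add: algebra_simps)
qed

text \<open>Physical time: dt/ds = 4 r1 becomes \<epsilon> |Z|^2 after rescaling. The frame turns by
  t in the plane, hence by t / 2 in the Levi-Civita variable.\<close>

definition time :: "real \<Rightarrow> real" where "time \<tau> = integral {0..\<tau>} (\<lambda>s. \<epsilon> * (cmod (Z s))\<^sup>2)"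

lemma time_0: "time 0 = 0" by (simp add: time_def)

lemma d_time: "\<tau> \<in> {0..T} \<Longrightarrow> (time has_real_derivative \<epsilon> * (cmod (Z \<tau>))\<^sup>2) (at \<tau> within {0..T})"
  unfolding time_def by (intro integral_has_real_derivative continuous_intros cont_Z)

lemma time_diff:
  assumes "0 \<le> \<sigma>" "\<sigma> \<le> \<tau>" "\<tau> \<le> T"
  shows "0 \<le> time \<tau> - time \<sigma>" "time \<tau> - time \<sigma> \<le> 4 * \<epsilon> * (\<tau> - \<sigma>)"
proof -
  have sub: "{\<sigma>..\<tau>} \<subseteq> {0..T}" using assms by auto
  have "(\<lambda>_. 0::real) \<tau> - (\<lambda>_. 0) \<sigma> \<le> time \<tau> - time \<sigma>"
    by (rule diff_le_of_deriv[where f' = "\<lambda>_. 0" and \<phi>' = "\<lambda>s. \<epsilon> * (cmod (Z s))\<^sup>2", OF assms(2) _ _ sub])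
      (use sub d_time eps in auto)
  then show "0 \<le> time \<tau> - time \<sigma>" by simp
  have "time \<tau> - time \<sigma> \<le> 4 * \<epsilon> * \<tau> - 4 * \<epsilon> * \<sigma>"
  proof (rule diff_le_of_deriv[where f' = "\<lambda>s. \<epsilon> * (cmod (Z s))\<^sup>2" and \<phi>' = "\<lambda>s. 4 * \<epsilon>", OF assms(2) _ _ sub])
    fix s assume "s \<in> {\<sigma>..\<tau>}"
    then have s: "s \<in> {0..T}" using sub by auto
    show "(time has_real_derivative \<epsilon> * (cmod (Z s))\<^sup>2) (at s within {0..T})" by (rule d_time[OF s])
    show "((*) (4 * \<epsilon>) has_real_derivative 4 * \<epsilon>) (at s within {0..T})" by (auto intro!: derivative_eq_intros)
    have "(cmod (Z s))\<^sup>2 \<le> 2\<^sup>2" using Z_le[OF s] by (intro power_mono) auto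
    then show "\<epsilon> * (cmod (Z s))\<^sup>2 \<le> 4 * \<epsilon>" using eps by simp
  qed
  then show "time \<tau> - time \<sigma> \<le> 4 * \<epsilon> * (\<tau> - \<sigma>)" by (simp add: algebra_simps)
qed

text \<open>In the non-rotating frame the oscillator has constant coefficients \<open>osc1\<close>, \<open>osc2\<close> up to the small perturbation.\<close>

definition frame :: "real \<Rightarrow> complex" where "frame \<tau> = cis (time \<tau> / 2)"

definition osc1 :: "real \<Rightarrow> complex" where
  "osc1 \<tau> = frame \<tau> * (of_real (sin \<tau>) * Z \<tau> + of_real (cos \<tau>) * Y \<tau>)"

definition osc2 :: "real \<Rightarrow> complex" where
  "osc2 \<tau> = frame \<tau> * (of_real (cos \<tau>) * Z \<tau> - of_real (sin \<tau>) * Y \<tau>)"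

lemma norm_frame [simp]: "cmod (frame \<tau>) = 1" by (simp add: frame_def)

lemma d_frame:
  assumes "\<tau> \<in> {0..T}"
  shows "(frame has_vector_derivative - rot \<tau> * frame \<tau>) (at \<tau> within {0..T})"
proof -
  have "((\<lambda>\<tau>. cis (time \<tau> / 2)) has_derivative (\<lambda>x. (x * (\<epsilon> * (cmod (Z \<tau>))\<^sup>2) / 2) *\<^sub>R (\<i> * cis (time \<tau> / 2)))) (at \<tau> within {0..T})"
    using d_time[OF assms] unfolding has_real_derivative_iff_has_vector_derivative has_vector_derivative_def
    by (auto intro!: derivative_eq_intros)
  then show ?thesis
    unfolding has_vector_derivative_def frame_def[abs_def] rot_def
    by (rule has_derivative_eq_rhs) (simp add: fun_eq_iff scaleR_conv_of_real)
qed

lemma frame_Z: "frame \<tau> * Z \<tau> = of_real (sin \<tau>) * osc1 \<tau> + of_real (cos \<tau>) * osc2 \<tau>"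
  and frame_Y: "frame \<tau> * Y \<tau> = of_real (cos \<tau>) * osc1 \<tau> - of_real (sin \<tau>) * osc2 \<tau>"
proof -
  define s c where "s = complex_of_real (sin \<tau>)" and "c = complex_of_real (cos \<tau>)"
  have sc: "s * s + c * c = 1"
    unfolding s_def c_def of_real_mult[symmetric] of_real_add[symmetric] by (simp flip: power2_eq_square)
  have "s * osc1 \<tau> + c * osc2 \<tau> = (s * s + c * c) * (frame \<tau> * Z \<tau>)"
    unfolding osc1_def osc2_def s_def c_def by (simp add: algebra_simps)
  then show "frame \<tau> * Z \<tau> = of_real (sin \<tau>) * osc1 \<tau> + of_real (cos \<tau>) * osc2 \<tau>"
    unfolding sc unfolding s_def c_def by simp
  have "c * osc1 \<tau> - s * osc2 \<tau> = (s * s + c * c) * (frame \<tau> * Y \<tau>)"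
    unfolding osc1_def osc2_def s_def c_def by (simp add: algebra_simps)
  then show "frame \<tau> * Y \<tau> = of_real (cos \<tau>) * osc1 \<tau> - of_real (sin \<tau>) * osc2 \<tau>"
    unfolding sc unfolding s_def c_def by simp
qed

text \<open>The factor \<open>frame\<close> removes \<open>rot\<close> and the trigonometric
  coefficients remove the oscillation; only \<open>pert\<close>, of order \<kappa> \<epsilon>^2, is
  left.\<close>

lemma d_osc:
  assumes "\<tau> \<in> {0..T}"
  shows "(osc1 has_vector_derivative of_real (cos \<tau>) * frame \<tau> * pert \<tau>) (at \<tau> within {0..T})"
    and "(osc2 has_vector_derivative - of_real (sin \<tau>) * frame \<tau> * pert \<tau>) (at \<tau> within {0..T})"
proof -
  have ds: "((\<lambda>\<tau>. complex_of_real (sin \<tau>)) has_vector_derivative of_real (cos \<tau>)) (at \<tau> within {0..T})"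
    and dc: "((\<lambda>\<tau>. complex_of_real (cos \<tau>)) has_vector_derivative of_real (- sin \<tau>)) (at \<tau> within {0..T})"
    by (intro has_vector_derivative_of_real; auto intro!: derivative_eq_intros)+
  have "(osc1 has_vector_derivative frame \<tau> * ((of_real (sin \<tau>) * (Y \<tau> + rot \<tau> * Z \<tau>) + of_real (cos \<tau>) * Z \<tau>)
      + (of_real (cos \<tau>) * (rot \<tau> * Y \<tau> - Z \<tau> + pert \<tau>) + of_real (- sin \<tau>) * Y \<tau>))
      + (- rot \<tau> * frame \<tau>) * (of_real (sin \<tau>) * Z \<tau> + of_real (cos \<tau>) * Y \<tau>)) (at \<tau> within {0..T})"
    unfolding osc1_def[abs_def]
    by (intro has_vector_derivative_mult has_vector_derivative_add d_frame dZ dY ds dc assms)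
  then show "(osc1 has_vector_derivative of_real (cos \<tau>) * frame \<tau> * pert \<tau>) (at \<tau> within {0..T})"
    by (rule has_vector_derivative_eq_rhs) (simp add: algebra_simps)
  have "(osc2 has_vector_derivative frame \<tau> * ((of_real (cos \<tau>) * (Y \<tau> + rot \<tau> * Z \<tau>) + of_real (- sin \<tau>) * Z \<tau>)
      - (of_real (sin \<tau>) * (rot \<tau> * Y \<tau> - Z \<tau> + pert \<tau>) + of_real (cos \<tau>) * Y \<tau>))
      + (- rot \<tau> * frame \<tau>) * (of_real (cos \<tau>) * Z \<tau> - of_real (sin \<tau>) * Y \<tau>)) (at \<tau> within {0..T})"
    unfolding osc2_def[abs_def]
    by (intro has_vector_derivative_mult has_vector_derivative_diff d_frame dZ dY ds dc assms has_vector_derivative_add)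
  then show "(osc2 has_vector_derivative - of_real (sin \<tau>) * frame \<tau> * pert \<tau>) (at \<tau> within {0..T})"
    by (rule has_vector_derivative_eq_rhs) (simp add: algebra_simps)
qed

lemma osc_drift:
  assumes "0 \<le> \<sigma>" "\<sigma> \<le> \<tau>" "\<tau> \<le> T"
  shows "cmod (osc1 \<tau> - osc1 \<sigma>) \<le> 2 * B * \<kappa> * \<epsilon>\<^sup>2 * (\<tau> - \<sigma>)"
    and "cmod (osc2 \<tau> - osc2 \<sigma>) \<le> 2 * B * \<kappa> * \<epsilon>\<^sup>2 * (\<tau> - \<sigma>)"
proof -
  have sub: "{\<sigma>..\<tau>} \<subseteq> {0..T}" using assms by auto
  define M where "M = 2 * B * \<kappa> * \<epsilon>\<^sup>2"
  have M: "cmod (c * frame s * pert s) \<le> M" if "s \<in> {\<sigma>..\<tau>}" "cmod c \<le> 1" for s c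
  proof -
    have "cmod (c * frame s * pert s) \<le> (1 * 1) * M"
      by (intro norm_mult_le) (use that sub pert_bound in \<open>auto simp: M_def\<close>)
    then show ?thesis by simp
  qed
  have dM: "((*) M has_real_derivative M) (at s within {0..T})" for s by (auto intro!: derivative_eq_intros)
  have "cmod (osc1 \<tau> - osc1 \<sigma>) \<le> M * \<tau> - M * \<sigma>"
    by (rule norm_diff_le_of_deriv[where f' = "\<lambda>\<tau>. of_real (cos \<tau>) * frame \<tau> * pert \<tau>" and \<phi>' = "\<lambda>_. M" and S = "{0..T}"])
      (use assms sub d_osc dM M in auto)
  then show "cmod (osc1 \<tau> - osc1 \<sigma>) \<le> 2 * B * \<kappa> * \<epsilon>\<^sup>2 * (\<tau> - \<sigma>)" unfolding M_def by (simp add: algebra_simps)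
  have "cmod (osc2 \<tau> - osc2 \<sigma>) \<le> M * \<tau> - M * \<sigma>"
    by (rule norm_diff_le_of_deriv[where f' = "\<lambda>\<tau>. - of_real (sin \<tau>) * frame \<tau> * pert \<tau>" and \<phi>' = "\<lambda>_. M" and S = "{0..T}"])
      (use assms sub d_osc dM M[of _ "- of_real (sin _)"] in auto)
  then show "cmod (osc2 \<tau> - osc2 \<sigma>) \<le> 2 * B * \<kappa> * \<epsilon>\<^sup>2 * (\<tau> - \<sigma>)" unfolding M_def by (simp add: algebra_simps)
qed

lemma osc_0: "osc1 0 = cis \<theta>" "osc2 0 = 0"
  by (simp_all add: osc1_def osc2_def frame_def time_0 Z0 Y0)

lemma sin_cos_comb_le:
  assumes "cmod x \<le> d" "cmod y \<le> d"
  shows "cmod (of_real (sin \<tau>) * x + of_real (cos \<tau>) * y) \<le> 2 * d"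
    "cmod (of_real (cos \<tau>) * x - of_real (sin \<tau>) * y) \<le> 2 * d"
proof -
  have s: "cmod (of_real (sin \<tau>)) \<le> 1" "cmod (of_real (cos \<tau>)) \<le> 1" by auto
  show "cmod (of_real (sin \<tau>) * x + of_real (cos \<tau>) * y) \<le> 2 * d"
    using norm_triangle_ineq[of "of_real (sin \<tau>) * x" "of_real (cos \<tau>) * y"]
      norm_mult_le[OF s(1) assms(1)] norm_mult_le[OF s(2) assms(2)] by linarith
  show "cmod (of_real (cos \<tau>) * x - of_real (sin \<tau>) * y) \<le> 2 * d"
    using norm_triangle_ineq4[of "of_real (cos \<tau>) * x" "of_real (sin \<tau>) * y"]
      norm_mult_le[OF s(2) assms(1)] norm_mult_le[OF s(1) assms(2)] by linarith
qed

text \<open>As long as the frame factor is kept, the error over the whole orbit is only \<epsilon>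
  \<eta> B by \<open>B_kappa_eps2_tau\<close>. This precision locates the collisions.\<close>

lemma frame_close:
  assumes "\<tau> \<in> {0..T}"
  shows "cmod (frame \<tau> * Z \<tau> - of_real (sin \<tau>) * cis \<theta>) \<le> 4 * B * \<kappa> * \<epsilon>\<^sup>2 * \<tau>"
    and "cmod (frame \<tau> * Y \<tau> - of_real (cos \<tau>) * cis \<theta>) \<le> 4 * B * \<kappa> * \<epsilon>\<^sup>2 * \<tau>"
proof -
  have d: "cmod (osc1 \<tau> - cis \<theta>) \<le> 2 * B * \<kappa> * \<epsilon>\<^sup>2 * \<tau>" "cmod (osc2 \<tau>) \<le> 2 * B * \<kappa> * \<epsilon>\<^sup>2 * \<tau>"
    using osc_drift[of 0 \<tau>] assms by (auto simp: osc_0)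
  have "frame \<tau> * Z \<tau> - of_real (sin \<tau>) * cis \<theta> = of_real (sin \<tau>) * (osc1 \<tau> - cis \<theta>) + of_real (cos \<tau>) * osc2 \<tau>"
    "frame \<tau> * Y \<tau> - of_real (cos \<tau>) * cis \<theta> = of_real (cos \<tau>) * (osc1 \<tau> - cis \<theta>) - of_real (sin \<tau>) * osc2 \<tau>"
    unfolding frame_Z frame_Y by (simp_all add: algebra_simps)
  then show "cmod (frame \<tau> * Z \<tau> - of_real (sin \<tau>) * cis \<theta>) \<le> 4 * B * \<kappa> * \<epsilon>\<^sup>2 * \<tau>"
    "cmod (frame \<tau> * Y \<tau> - of_real (cos \<tau>) * cis \<theta>) \<le> 4 * B * \<kappa> * \<epsilon>\<^sup>2 * \<tau>"
    using sin_cos_comb_le[OF d, of \<tau>] by simp_all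
qed

lemma B_kappa_eps2_tau:
  assumes "\<tau> \<in> {0..T}"
  shows "4 * B * \<kappa> * \<epsilon>\<^sup>2 * \<tau> \<le> \<epsilon> * (\<eta> * B)" "4 * B * \<kappa> * \<epsilon>\<^sup>2 * \<tau> \<le> \<eta>"
proof -
  have "4 * B * \<kappa> * \<epsilon>\<^sup>2 * \<tau> = (4 * \<kappa>) * (\<epsilon> * B * (\<epsilon> * \<tau>))" by (simp add: power2_eq_square)
  also have "\<dots> \<le> 1 * (\<epsilon> * B * \<eta>)"
    using kappa eps B1 eps_tau[of \<tau>] assms by (intro mult_mono) auto
  finally show 1: "4 * B * \<kappa> * \<epsilon>\<^sup>2 * \<tau> \<le> \<epsilon> * (\<eta> * B)" by (simp add: mult_ac)
  have "\<epsilon> * (\<eta> * B) \<le> \<eta> * 1" using eps_le eps etaB(1) B1 eta_pos by (intro mult_mono) auto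
  with 1 show "4 * B * \<kappa> * \<epsilon>\<^sup>2 * \<tau> \<le> \<eta>" by simp
qed

lemma cis_diff_le: "cmod (cis x - 1) \<le> \<bar>x\<bar>"
proof -
  have "cmod (cis x - 1) = 2 * \<bar>sin (x / 2)\<bar>"
    using dist_exp_i_1[of x] by (simp add: cis_conv_exp)
  also have "\<dots> \<le> 2 * \<bar>x / 2\<bar>" by (intro mult_left_mono abs_sin_x_le_abs_x) auto
  finally show ?thesis by simp
qed

text \<open>Dropping the frame factor costs t / 2 \<le> 2 \<eta>; the second-order error of
  \<open>frame_close\<close> accounts for the third \<eta>.\<close>

lemma orbit_close:
  assumes "\<tau> \<in> {0..T}"
  shows "cmod (Z \<tau> - of_real (sin \<tau>) * cis \<theta>) \<le> 3 * \<eta>" "cmod (Y \<tau> - of_real (cos \<tau>) * cis \<theta>) \<le> 3 * \<eta>"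
proof -
  have t: "0 \<le> time \<tau>" "time \<tau> \<le> 4 * (\<epsilon> * \<tau>)"
    using time_diff[of 0 \<tau>] assms by (auto simp: time_0)
  have "cmod (frame \<tau> - 1) \<le> \<bar>time \<tau> / 2\<bar>" unfolding frame_def by (rule cis_diff_le)
  also have "\<dots> \<le> 2 * \<eta>" using t eps_tau[of \<tau>] assms by auto
  finally have f: "cmod (frame \<tau> - 1) \<le> 2 * \<eta>" .
  have *: "cmod (X - of_real r * cis \<theta>) \<le> 3 * \<eta>"
    if "cmod (frame \<tau> * X - of_real r * cis \<theta>) \<le> \<eta>" "\<bar>r\<bar> \<le> 1" for X r
  proof -
    have "cmod (X - of_real r * cis \<theta>) = cmod (frame \<tau> * (X - of_real r * cis \<theta>))" by (simp add: norm_mult)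
    also have "frame \<tau> * (X - of_real r * cis \<theta>)
      = (frame \<tau> * X - of_real r * cis \<theta>) - (frame \<tau> - 1) * (of_real r * cis \<theta>)" by (simp add: algebra_simps)
    also have "cmod \<dots> \<le> \<eta> + 2 * \<eta> * 1"
      by (intro order_trans[OF norm_triangle_ineq4] add_mono norm_mult_le f that(1)) (use that(2) in \<open>simp add: norm_mult\<close>)
    finally show ?thesis by simp
  qed
  show "cmod (Z \<tau> - of_real (sin \<tau>) * cis \<theta>) \<le> 3 * \<eta>" "cmod (Y \<tau> - of_real (cos \<tau>) * cis \<theta>) \<le> 3 * \<eta>"
    using frame_close[OF assms] B_kappa_eps2_tau(2)[OF assms] by (auto intro!: *)
qed

end

section \<open>Angular momentum\<close>

lemma torque_0_eq: "cmod z \<le> 2 \<Longrightarrow> tide_torque 0 z = - 3 * (cmod z)\<^sup>2 * Im (z ^ 4)"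
  using tide_torque_expand[of 0 z] by simp

lemma torque_0_polar:
  assumes "\<bar>s\<bar> \<le> 1"
  shows "tide_torque 0 (of_real s * cis x) = - 3 * s ^ 6 * sin (4 * x)"
proof -
  have 1: "cmod (of_real s * cis x) = \<bar>s\<bar>" by (simp add: norm_mult)
  have 2: "Im ((of_real s * cis x) ^ 4) = s ^ 4 * sin (4 * x)"
  proof -
    have "(cis x) ^ 4 = cis (4 * x)" using Complex.DeMoivre[of x 4] by simp
    then have "(of_real s * cis x) ^ 4 = of_real (s ^ 4) * cis (4 * x)"
      by (simp only: power_mult_distrib of_real_power)
    then show ?thesis by (simp only: times_complex.sel Im_complex_of_real Re_complex_of_real cis.sel mult_zero_left add_0_right)
  qed
  have "s\<^sup>2 * s ^ 4 = s ^ 6" by (simp flip: power_add)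
  then show ?thesis using torque_0_eq[of "of_real s * cis x"] assms unfolding 1 2 by simp
qed

text \<open>The tangent of x^3 at x = 1/2, evaluated at x = sin^2. It reduces all torque integrals
  to the integral of sin^2.\<close>

lemma sin_pow6_ge: "3 / 4 * (sin x)\<^sup>2 - 1 / 4 \<le> (sin x) ^ 6" for x :: real
proof -
  have "(sin x) ^ 6 - (3 / 4 * (sin x)\<^sup>2 - 1 / 4) = ((sin x)\<^sup>2 - 1 / 2)\<^sup>2 * ((sin x)\<^sup>2 + 1)"
    by (simp add: power2_eq_square eval_nat_numeral algebra_simps)
  also have "\<dots> \<ge> 0" by simp
  finally show ?thesis by simp
qed

lemma d_sin_cos: "((\<lambda>x. (x - sin x * cos x) / 2) has_real_derivative (sin x)\<^sup>2) (at x within S)"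
proof -
  have "((\<lambda>x. (x - sin x * cos x) / 2) has_real_derivative (1 - (cos x * cos x - sin x * sin x)) / 2) (at x within S)"
    by (auto intro!: derivative_eq_intros)
  moreover have "(1 - (cos x * cos x - sin x * sin x)) / 2 = (sin x)\<^sup>2"
    using sin_cos_squared_add[of x] by (simp add: power2_eq_square)
  ultimately show ?thesis by simp
qed

lemma sin_cos_le_half: "\<bar>sin x * cos x\<bar> \<le> 1 / 2" for x :: real
proof -
  have "\<bar>sin (2 * x)\<bar> \<le> 1" by simp
  then show ?thesis unfolding sin_double by (simp add: abs_mult)
qed

context rtbp_orbit
begin

text \<open>3 B \<eta> comes from replacing Z by the unperturbed oscillation, B \<eta> from the part
  of the torque proportional to a.\<close>

lemma torque_close:
  assumes "\<tau> \<in> {0..T}"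
  shows "\<bar>tide_torque a (Z \<tau>) + 3 * (sin \<tau>) ^ 6 * sin (4 * \<theta>)\<bar> \<le> 4 * B * \<eta>"
proof -
  define z where "z = of_real (sin \<tau>) * cis \<theta>"
  have "cmod z = \<bar>sin \<tau>\<bar>" by (simp add: z_def norm_mult)
  then have z: "cmod z \<le> 2" using abs_sin_le_one[of \<tau>] by linarith
  have zz: "cmod (Z \<tau>) \<le> 2" by (rule Z_le[OF assms])
  have "\<bar>tide_torque 0 (Z \<tau>) - tide_torque 0 z\<bar> \<le> B * cmod (Z \<tau> - z)" by (rule torque0_lip[OF zz z])
  also have "\<dots> \<le> B * (3 * \<eta>)" using orbit_close(1)[OF assms] B1 by (intro mult_left_mono) (auto simp: z_def)
  finally have 1: "\<bar>tide_torque 0 (Z \<tau>) - tide_torque 0 z\<bar> \<le> 3 * B * \<eta>" by simp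
  have 2: "tide_torque 0 z = - 3 * (sin \<tau>) ^ 6 * sin (4 * \<theta>)" unfolding z_def by (rule torque_0_polar) simp
  have 3: "tide_torque a (Z \<tau>) = tide_torque 0 (Z \<tau>) + a * tide_torque1 a (Z \<tau>)"
    using tide_torque_expand[OF a_le zz] torque_0_eq[OF zz] by simp
  have "\<bar>a * tide_torque1 a (Z \<tau>)\<bar> \<le> \<eta> * B"
    unfolding abs_mult using a_eta torque1_bound[OF zz] eta_pos by (intro mult_mono) auto
  with 1 2 3 show ?thesis by (simp add: mult_ac)
qed

text \<open>By the tangent bound the signed torque is at least 3 (5/6) (3/4 sin^2 - 1/4) - 4/100000,
  that is 15/8 sin^2 - 5/8 up to the error. Its mean is about 5/16, which outweighs the bounded
  oscillation of the integral once \<tau> \<ge> 5/2.\<close>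

lemma ang_mom_sign:
  assumes s: "s \<in> {-1, 1}" "5 / 6 \<le> - s * sin (4 * \<theta>)" and \<tau>: "\<tau> \<in> {0..T}" "5 / 2 \<le> \<tau>"
  shows "0 < s * ang_mom \<tau>"
proof -
  define c where "c = \<kappa> * \<epsilon>\<^sup>2"
  have c: "c > 0" using kappa eps by (simp add: c_def)
  have Be: "4 * B * \<eta> \<le> 4 / 100000" using etaB(1) by (simp add: mult_ac)
  define \<phi> where "\<phi> x = c * (15 / 8 * ((x - sin x * cos x) / 2) - (5 / 8 + 4 / 100000) * x)" for x
  have "\<phi> \<tau> - \<phi> 0 \<le> s * ang_mom \<tau> - s * ang_mom 0"
  proof (rule diff_le_of_deriv[where S = "{0..T}" and f' = "\<lambda>x. c * (15 / 8 * (sin x)\<^sup>2 - (5 / 8 + 4 / 100000))"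
        and \<phi>' = "\<lambda>x. s * (c * tide_torque a (Z x))"])
    fix x assume "x \<in> {0..\<tau>}"
    then have x: "x \<in> {0..T}" using \<tau> by auto
    show "((\<lambda>x. s * ang_mom x) has_real_derivative s * (c * tide_torque a (Z x))) (at x within {0..T})"
      unfolding c_def by (intro DERIV_cmult d_ang_mom x)
    show "(\<phi> has_real_derivative c * (15 / 8 * (sin x)\<^sup>2 - (5 / 8 + 4 / 100000))) (at x within {0..T})"
      unfolding \<phi>_def by (intro DERIV_cmult DERIV_diff d_sin_cos DERIV_cmult_Id)
    have "3 * (sin x) ^ 6 * (5 / 6) \<le> 3 * (sin x) ^ 6 * (- s * sin (4 * \<theta>))"
      using s by (intro mult_left_mono) auto
    moreover have "\<bar>s * (tide_torque a (Z x) + 3 * (sin x) ^ 6 * sin (4 * \<theta>))\<bar> \<le> 4 * B * \<eta>"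
      using torque_close[OF x] s by (auto simp: abs_mult)
    ultimately have "15 / 8 * (sin x)\<^sup>2 - (5 / 8 + 4 / 100000) \<le> s * tide_torque a (Z x)"
      using sin_pow6_ge[of x] Be by (simp add: algebra_simps)
    from mult_left_mono[OF this, of c] c
    show "c * (15 / 8 * (sin x)\<^sup>2 - (5 / 8 + 4 / 100000)) \<le> s * (c * tide_torque a (Z x))"
      by (simp add: mult.left_commute)
  qed (use \<tau> in auto)
  moreover have "\<phi> 0 = 0" by (simp add: \<phi>_def)
  moreover have "\<phi> \<tau> > 0"
    unfolding \<phi>_def using c sin_cos_le_half[of \<tau>] \<tau> by (intro mult_pos_pos) auto
  ultimately show ?thesis by (simp add: ang_mom_0)
qed

lemma norm_sq_close:
  assumes "\<tau> \<in> {0..T}"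
  shows "\<bar>(cmod (Z \<tau>))\<^sup>2 - (sin \<tau>)\<^sup>2\<bar> \<le> 9 * \<eta>" "\<bar>(cmod (Y \<tau>))\<^sup>2 - (cos \<tau>)\<^sup>2\<bar> \<le> 9 * \<eta>"
proof -
  have *: "\<bar>(cmod X)\<^sup>2 - r\<^sup>2\<bar> \<le> 9 * \<eta>" if "cmod (X - of_real r * cis \<theta>) \<le> 3 * \<eta>" "\<bar>r\<bar> \<le> 1" "cmod X \<le> 2" for X r
  proof -
    have "\<bar>cmod X - cmod (of_real r * cis \<theta>)\<bar> \<le> 3 * \<eta>"
      by (rule order_trans[OF norm_triangle_ineq3 that(1)])
    then have 1: "\<bar>cmod X - \<bar>r\<bar>\<bar> \<le> 3 * \<eta>" by (simp add: norm_mult)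
    have "(cmod X)\<^sup>2 - r\<^sup>2 = (cmod X - \<bar>r\<bar>) * (cmod X + \<bar>r\<bar>)"
      by (simp add: power2_eq_square algebra_simps)
    then have "\<bar>(cmod X)\<^sup>2 - r\<^sup>2\<bar> = \<bar>cmod X - \<bar>r\<bar>\<bar> * (cmod X + \<bar>r\<bar>)" by (simp add: abs_mult)
    also have "\<dots> \<le> 3 * \<eta> * 3" using 1 that by (intro mult_mono) auto
    finally show ?thesis by simp
  qed
  show "\<bar>(cmod (Z \<tau>))\<^sup>2 - (sin \<tau>)\<^sup>2\<bar> \<le> 9 * \<eta>" "\<bar>(cmod (Y \<tau>))\<^sup>2 - (cos \<tau>)\<^sup>2\<bar> \<le> 9 * \<eta>"
    by (intro * orbit_close assms Z_le Y_le abs_sin_le_one abs_cos_le_one)+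
qed

text \<open>The lower bound, from the integral \<pi>/2 of sin^2, drives the monotone change of the
  torque; the upper bound (|Z| \<le> 2 and \<pi> \<le> 7/2) controls the errors.\<close>

lemma time_period:
  assumes "0 \<le> \<tau>" "\<tau> + pi \<le> T"
  shows "\<epsilon> \<le> time (\<tau> + pi) - time \<tau>" "time (\<tau> + pi) - time \<tau> \<le> 14 * \<epsilon>"
proof -
  define \<phi> where "\<phi> x = \<epsilon> * ((x - sin x * cos x) / 2 - 9 * \<eta> * x)" for x
  have "\<phi> (\<tau> + pi) - \<phi> \<tau> \<le> time (\<tau> + pi) - time \<tau>"
  proof (rule diff_le_of_deriv[where S = "{0..T}" and f' = "\<lambda>x. \<epsilon> * ((sin x)\<^sup>2 - 9 * \<eta>)" and \<phi>' = "\<lambda>x. \<epsilon> * (cmod (Z x))\<^sup>2"])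
    fix x assume "x \<in> {\<tau>..\<tau> + pi}"
    then have x: "x \<in> {0..T}" using assms by auto
    show "(time has_real_derivative \<epsilon> * (cmod (Z x))\<^sup>2) (at x within {0..T})" by (rule d_time[OF x])
    show "(\<phi> has_real_derivative \<epsilon> * ((sin x)\<^sup>2 - 9 * \<eta>)) (at x within {0..T})"
      unfolding \<phi>_def by (intro DERIV_cmult DERIV_diff d_sin_cos DERIV_cmult_Id)
    show "\<epsilon> * ((sin x)\<^sup>2 - 9 * \<eta>) \<le> \<epsilon> * (cmod (Z x))\<^sup>2"
      using norm_sq_close(1)[OF x] eps by (intro mult_left_mono) auto
  qed (use assms in auto)
  moreover have "\<phi> (\<tau> + pi) - \<phi> \<tau> = \<epsilon> * (pi * (1 / 2 - 9 * \<eta>))"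
    by (simp add: \<phi>_def field_simps)
  moreover have "1 \<le> pi * (1 / 2 - 9 * \<eta>)"
  proof -
    have "3 * (1 / 3) \<le> pi * (1 / 2 - 9 * \<eta>)"
      using pi_gt3 etaB(2) by (intro mult_mono) auto
    then show ?thesis by simp
  qed
  then have "\<epsilon> * 1 \<le> \<epsilon> * (pi * (1 / 2 - 9 * \<eta>))" using eps by (intro mult_left_mono) auto
  ultimately show "\<epsilon> \<le> time (\<tau> + pi) - time \<tau>" by linarith
  have "time (\<tau> + pi) - time \<tau> \<le> 4 * \<epsilon> * pi" using time_diff(2)[of \<tau> "\<tau> + pi"] assms by simp
  also have "\<dots> \<le> 4 * \<epsilon> * (7 / 2)" using pi_less_4 eps pi_approx by (intro mult_left_mono) auto
  finally show "time (\<tau> + pi) - time \<tau> \<le> 14 * \<epsilon>" by simp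
qed

text \<open>A half period changes the sign of the oscillation, and the rotating frame turns the
  orbit backwards by half the elapsed physical time. Only the drift of \<open>osc1\<close> and
  \<open>osc2\<close> over one half period remains as error.\<close>

lemma half_turn:
  assumes "0 \<le> \<tau>" "\<tau> + pi \<le> T"
  shows "cmod (Z (\<tau> + pi) + cis (- ((time (\<tau> + pi) - time \<tau>) / 2)) * Z \<tau>) \<le> 4 * B * \<epsilon>\<^sup>2"
proof -
  define \<phi> where "\<phi> = (time (\<tau> + pi) - time \<tau>) / 2"
  have f: "frame \<tau> = frame (\<tau> + pi) * cis (- \<phi>)"
    unfolding frame_def cis_mult \<phi>_def by (rule arg_cong[where f = cis]) (simp add: field_simps)
  have d: "cmod (osc1 \<tau> - osc1 (\<tau> + pi)) \<le> 2 * B * \<kappa> * \<epsilon>\<^sup>2 * pi" "cmod (osc2 \<tau> - osc2 (\<tau> + pi)) \<le> 2 * B * \<kappa> * \<epsilon>\<^sup>2 * pi"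
    using osc_drift[of \<tau> "\<tau> + pi"] assms by (auto simp: norm_minus_commute)
  have "frame (\<tau> + pi) * Z (\<tau> + pi) + frame \<tau> * Z \<tau>
     = of_real (sin \<tau>) * (osc1 \<tau> - osc1 (\<tau> + pi)) + of_real (cos \<tau>) * (osc2 \<tau> - osc2 (\<tau> + pi))"
    unfolding frame_Z by (simp add: algebra_simps)
  then have "cmod (frame (\<tau> + pi) * Z (\<tau> + pi) + frame \<tau> * Z \<tau>) \<le> 2 * (2 * B * \<kappa> * \<epsilon>\<^sup>2 * pi)"
    using sin_cos_comb_le(1)[OF d] by simp
  also have "frame (\<tau> + pi) * Z (\<tau> + pi) + frame \<tau> * Z \<tau> = frame (\<tau> + pi) * (Z (\<tau> + pi) + cis (- \<phi>) * Z \<tau>)"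
    unfolding f by (simp add: algebra_simps)
  also have "cmod \<dots> = cmod (Z (\<tau> + pi) + cis (- \<phi>) * Z \<tau>)" by (simp add: norm_mult)
  finally have "cmod (Z (\<tau> + pi) + cis (- \<phi>) * Z \<tau>) \<le> (4 * \<kappa> * pi) * (B * \<epsilon>\<^sup>2)" by (simp add: mult_ac)
  also have "\<dots> \<le> (1 * 4) * (B * \<epsilon>\<^sup>2)"
    using kappa B1 pi_less_4 by (intro mult_right_mono mult_mono) auto
  finally show ?thesis by (simp add: \<phi>_def)
qed

text \<open>Successive revolutions differ by a rotation of order \<open>\<epsilon>\<close> and a remainder of order \<open>\<epsilon>\<^sup>2\<close>. Hence
  the torque changes monotonically from one revolution to the next where \<open>cos (4 \<theta>)\<close> has a sign, and
  the angular momentum at multiples of \<open>\<pi>\<close> is a strictly convex or concave sequence.\<close>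

lemma torque_change:
  assumes s: "s \<in> {-1, 1}" "1 / 2 \<le> s * cos (4 * \<theta>)" and \<tau>: "0 \<le> \<tau>" "\<tau> + pi \<le> T"
  shows "\<epsilon> * (9 / 4 * (sin \<tau>)\<^sup>2 - 3 / 4 - 1 / 100) \<le> s * (tide_torque a (Z (\<tau> + pi)) - tide_torque a (Z \<tau>))"
proof -
  define \<phi> where "\<phi> = (time (\<tau> + pi) - time \<tau>) / 2"
  have \<phi>: "\<epsilon> / 2 \<le> \<phi>" "\<phi> \<le> 7 * \<epsilon>" "0 \<le> \<phi>" using time_period[OF \<tau>] eps by (auto simp: \<phi>_def)
  have t: "\<tau> \<in> {0..T}" "\<tau> + pi \<in> {0..T}" using \<tau> pi_gt3 unfolding atLeastAtMost_iff by linarith+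
  define z0 z1 where "z0 = Z \<tau>" and "z1 = Z (\<tau> + pi)"
  have z: "cmod z0 \<le> 2" "cmod z1 \<le> 2" using Z_le t by (auto simp: z0_def z1_def)
  have rz: "cmod (cis x * z0) \<le> 2" for x using z by (simp add: norm_mult)
  have B2: "B * B * \<eta> \<le> 1 / 100000" using eta by (simp add: power2_eq_square mult_ac)
  \<comment> \<open>The torque is even, so the sign from the half turn disappears; Lipschitz
    constant B times remainder 4 B \<epsilon>^2 is where B^2 \<eta> enters.\<close>
  have 1: "\<bar>tide_torque a z1 - tide_torque a (cis (- \<phi>) * z0)\<bar> \<le> 4 / 100000 * \<epsilon>"
  proof -
    have "\<bar>tide_torque a (- z1) - tide_torque a (cis (- \<phi>) * z0)\<bar> \<le> B * cmod (- z1 - cis (- \<phi>) * z0)"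
      by (rule torque_lip) (use z rz in auto)
    also have "cmod (- z1 - cis (- \<phi>) * z0) = cmod (z1 + cis (- \<phi>) * z0)"
      by (metis minus_diff_eq diff_minus_eq_add norm_minus_cancel add.commute)
    also have "B * \<dots> \<le> B * (4 * B * \<epsilon>\<^sup>2)"
      using half_turn[OF \<tau>] B1 by (intro mult_left_mono) (auto simp: z0_def z1_def \<phi>_def)
    also have "\<dots> = 4 * (B * B * \<epsilon>) * \<epsilon>" by (simp add: power2_eq_square)
    also have "\<dots> \<le> 4 * (B * B * \<eta>) * \<epsilon>" using eps_le eps B1 by (intro mult_right_mono mult_left_mono) auto
    also have "\<dots> \<le> 4 / 100000 * \<epsilon>" using B2 eps by (intro mult_right_mono) auto
    finally show ?thesis by (simp add: tide_torque_minus)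
  qed
  have dz: "cmod (cis (- x) * z0 - z0) \<le> 14 * \<epsilon>" if "0 \<le> x" "x \<le> \<phi>" for x
  proof -
    have "cis (- x) * z0 - z0 = (cis (- x) - 1) * z0" by (simp add: algebra_simps)
    moreover have "cmod (cis (- x) - 1) \<le> 7 * \<epsilon>" using cis_diff_le[of "- x"] that \<phi> by simp
    ultimately show ?thesis using norm_mult_le[of "cis (- x) - 1" "7 * \<epsilon>" z0 2] z by simp
  qed
  have 2: "\<bar>a * tide_torque1 a (cis (- \<phi>) * z0) - a * tide_torque1 a z0\<bar> \<le> 14 / 100000 * \<epsilon>"
  proof -
    have "\<bar>a * tide_torque1 a (cis (- \<phi>) * z0) - a * tide_torque1 a z0\<bar>
       = \<bar>a\<bar> * \<bar>tide_torque1 a (cis (- \<phi>) * z0) - tide_torque1 a z0\<bar>"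
      by (simp add: abs_mult flip: right_diff_distrib)
    also have "\<dots> \<le> \<eta> * (B * (14 * \<epsilon>))"
      using order_trans[OF torque1_lip[OF rz z(1)] mult_left_mono[OF dz[of \<phi>], of B]] a_eta B1 \<phi> eta_pos eps
      by (intro mult_mono) auto
    also have "\<dots> = (\<eta> * B) * (14 * \<epsilon>)" by simp
    also have "\<dots> \<le> 1 / 100000 * (14 * \<epsilon>)" using etaB(1) eps by (intro mult_right_mono) auto
    finally show ?thesis by simp
  qed
  have 3: "\<phi> * (6 * (sin \<tau>) ^ 6 - 68 / 100000) \<le> s * (tide_torque 0 (cis (- \<phi>) * z0) - tide_torque 0 z0)"
  proof -
    \<comment> \<open>The leading torque while z0 is turned backwards through the angle x; g \<phi>
      - g 0 is the change over one half period up to smaller errors.\<close>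
    define g where "g x = - 3 * (cmod z0)\<^sup>2 * Im (cis (- (4 * x)) * z0 ^ 4)" for x
    define g' where "g' x = 12 * (cmod z0)\<^sup>2 * Re (cis (- (4 * x)) * z0 ^ 4)" for x
    have g: "g x = tide_torque 0 (cis (- x) * z0)" for x
      using torque_0_eq[OF rz] by (simp add: g_def norm_mult power_mult_distrib Complex.DeMoivre)
    \<comment> \<open>Differentiation advances the phase of z^4 by a quarter turn, that is the angle
      of z by \<pi>/8. So g' is again a leading torque, and \<open>torque0_lip\<close> estimates it
      without separate bounds on derivatives.\<close>
    have g': "g' x = - 4 * tide_torque 0 (cis (pi / 8) * (cis (- x) * z0))" for x
    proof -
      have "(cis (pi / 8)) ^ 4 = \<i>" by (simp add: Complex.DeMoivre)
      then have "(cis (pi / 8) * (cis (- x) * z0)) ^ 4 = \<i> * (cis (- (4 * x)) * z0 ^ 4)"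
        by (simp only: power_mult_distrib) (simp add: Complex.DeMoivre)
      moreover have "cmod (cis (pi / 8) * (cis (- x) * z0)) = cmod z0" by (simp add: norm_mult)
      ultimately show ?thesis using torque_0_eq[of "cis (pi / 8) * (cis (- x) * z0)"] z
        by (simp add: g'_def)
    qed
    have dg: "(g has_real_derivative g' x) (at x within S)" for x S
    proof -
      have "((\<lambda>x. sin (4 * x) * Re (z0 ^ 4) - cos (4 * x) * Im (z0 ^ 4)) has_real_derivative
          4 * (cos (4 * x) * Re (z0 ^ 4) + sin (4 * x) * Im (z0 ^ 4))) (at x within S)"
        by (auto intro!: derivative_eq_intros simp: algebra_simps)
      from DERIV_cmult[OF this, of "3 * (cmod z0)\<^sup>2"] show ?thesis
        unfolding g_def[abs_def] g'_def by (auto simp: algebra_simps elim!: DERIV_cong back_subst[of "\<lambda>f. (f has_real_derivative _) _"])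
    qed
    have "\<phi> * (6 * (sin \<tau>) ^ 6 - 68 / 100000) - 0 * (6 * (sin \<tau>) ^ 6 - 68 / 100000) \<le> s * g \<phi> - s * g 0"
    proof (rule diff_le_of_deriv[where S = UNIV and f' = "\<lambda>_. 6 * (sin \<tau>) ^ 6 - 68 / 100000" and \<phi>' = "\<lambda>x. s * g' x"])
      fix x assume x: "x \<in> {0..\<phi>}"
      show "((\<lambda>x. s * g x) has_real_derivative s * g' x) (at x)" by (intro DERIV_cmult dg)
      show "((\<lambda>x. x * (6 * sin \<tau> ^ 6 - 68 / 100000)) has_real_derivative 6 * sin \<tau> ^ 6 - 68 / 100000) (at x)"
        by (auto intro!: derivative_eq_intros)
      define w where "w = of_real (sin \<tau>) * cis \<theta>"
      have "cmod w = \<bar>sin \<tau>\<bar>" by (simp add: w_def norm_mult)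
      then have w: "cmod w \<le> 2" using abs_sin_le_one[of \<tau>] by linarith
      have "cmod (cis (pi / 8) * (cis (- x) * z0) - cis (pi / 8) * w) = cmod (cis (- x) * z0 - w)"
        by (simp add: norm_mult flip: right_diff_distrib)
      also have "\<dots> \<le> cmod (cis (- x) * z0 - z0) + cmod (z0 - w)"
        using norm_triangle_ineq[of "cis (- x) * z0 - z0" "z0 - w"] by simp
      \<comment> \<open>14 \<eta> for turning by at most \<phi> and 3 \<eta> from
        \<open>orbit_close\<close>; multiplied by B and by the factor 4 of g' this gives the error
        68/100000.\<close>
      also have "\<dots> \<le> 14 * \<eta> + 3 * \<eta>"
        using dz[of x] x orbit_close(1)[OF t(1)] eps_le by (intro add_mono) (auto simp: z0_def w_def)
      finally have d: "cmod (cis (pi / 8) * (cis (- x) * z0) - cis (pi / 8) * w) \<le> 17 * \<eta>" by simp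
      have "\<bar>tide_torque 0 (cis (pi / 8) * (cis (- x) * z0)) - tide_torque 0 (cis (pi / 8) * w)\<bar> \<le> B * (17 * \<eta>)"
        using order_trans[OF torque0_lip mult_left_mono[OF d, of B]] B1 z w by (auto simp: norm_mult)
      also have "\<dots> \<le> 17 / 100000" using etaB(1) by (simp add: mult_ac)
      finally have e: "\<bar>tide_torque 0 (cis (pi / 8) * (cis (- x) * z0)) - tide_torque 0 (cis (pi / 8) * w)\<bar> \<le> 17 / 100000" .
      have "tide_torque 0 (cis (pi / 8) * w) = tide_torque 0 (of_real (sin \<tau>) * cis (pi / 8 + \<theta>))"
        by (simp add: w_def mult.left_commute cis_mult)
      also have "\<dots> = - 3 * (sin \<tau>) ^ 6 * sin (4 * (pi / 8 + \<theta>))" by (rule torque_0_polar) simp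
      also have "sin (4 * (pi / 8 + \<theta>)) = cos (4 * \<theta>)" by (simp add: distrib_left sin_add)
      finally have f: "tide_torque 0 (cis (pi / 8) * w) = - 3 * (sin \<tau>) ^ 6 * cos (4 * \<theta>)" .
      define P where "P = (sin \<tau>) ^ 6 * cos (4 * \<theta>)"
      have "(sin \<tau>) ^ 6 * (1 / 2) \<le> (sin \<tau>) ^ 6 * (s * cos (4 * \<theta>))"
        using s by (intro mult_left_mono) auto
      then have P: "(sin \<tau>) ^ 6 \<le> 2 * (s * P)" by (simp add: P_def mult_ac)
      have "tide_torque 0 (cis (pi / 8) * w) = - 3 * P" using f by (simp add: P_def)
      then show "6 * (sin \<tau>) ^ 6 - 68 / 100000 \<le> s * g' x"
        using e P s(1) unfolding g' by (cases "s = 1") (auto simp: abs_real_def split: if_splits)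
    qed (use \<phi> in auto)
    then show ?thesis unfolding g by (simp add: right_diff_distrib)
  qed
  have 4: "\<epsilon> * (3 * (sin \<tau>) ^ 6) - 7 * \<epsilon> * (68 / 100000) \<le> \<phi> * (6 * (sin \<tau>) ^ 6 - 68 / 100000)"
  proof -
    have "\<epsilon> / 2 * (6 * (sin \<tau>) ^ 6) \<le> \<phi> * (6 * (sin \<tau>) ^ 6)" using \<phi> by (intro mult_right_mono) auto
    moreover have "\<phi> * (68 / 100000) \<le> 7 * \<epsilon> * (68 / 100000)" using \<phi> by (intro mult_right_mono) auto
    ultimately show ?thesis by (simp add: algebra_simps)
  qed
  have 5: "\<epsilon> * (3 / 4 * (sin \<tau>)\<^sup>2 - 1 / 4) \<le> \<epsilon> * (sin \<tau>) ^ 6"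
    using sin_pow6_ge eps by (intro mult_left_mono) auto
  have e: "tide_torque a (cis (- \<phi>) * z0) - tide_torque a z0 = (tide_torque 0 (cis (- \<phi>) * z0) - tide_torque 0 z0)
      + (a * tide_torque1 a (cis (- \<phi>) * z0) - a * tide_torque1 a z0)"
    using tide_torque_expand[OF a_le z(1)] torque_0_eq[OF z(1)]
      tide_torque_expand[OF a_le rz[of "- \<phi>"]] torque_0_eq[OF rz[of "- \<phi>"]] by simp
  have "s * (tide_torque a z1 - tide_torque a z0) = s * (tide_torque a z1 - tide_torque a (cis (- \<phi>) * z0))
     + s * (tide_torque 0 (cis (- \<phi>) * z0) - tide_torque 0 z0)
     + s * (a * tide_torque1 a (cis (- \<phi>) * z0) - a * tide_torque1 a z0)"
  proof -
    have "s * (tide_torque a z1 - tide_torque a z0) = s * (tide_torque a z1 - tide_torque a (cis (- \<phi>) * z0))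
        + s * (tide_torque a (cis (- \<phi>) * z0) - tide_torque a z0)"
      by (simp add: right_diff_distrib)
    then show ?thesis unfolding e by (simp only: distrib_left add.assoc)
  qed
  moreover have "\<bar>s * (tide_torque a z1 - tide_torque a (cis (- \<phi>) * z0))\<bar> \<le> 4 / 100000 * \<epsilon>"
    "\<bar>s * (a * tide_torque1 a (cis (- \<phi>) * z0) - a * tide_torque1 a z0)\<bar> \<le> 14 / 100000 * \<epsilon>"
    using 1 2 s by (auto simp: abs_mult abs_minus_commute)
  moreover have "\<epsilon> * (3 * (sin \<tau>) ^ 6) - 7 * \<epsilon> * (68 / 100000) \<le> s * (tide_torque 0 (cis (- \<phi>) * z0) - tide_torque 0 z0)"
    using 3 4 by (rule order_trans[rotated])
  \<comment> \<open>The reserve 1/100 absorbs the three errors, (4 + 14 + 7 * 68) / 100000 in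
    total.\<close>
  moreover have "\<epsilon> * (9 / 4 * (sin \<tau>)\<^sup>2 - 3 / 4 - 1 / 100) \<le> \<epsilon> * (3 * (sin \<tau>) ^ 6) - 1 / 100 * \<epsilon>"
    using 5 by (simp add: algebra_simps)
  ultimately show ?thesis using eps unfolding z0_def z1_def by linarith
qed

text \<open>Integrating \<open>torque_change\<close> over one half period: the mean of 9/4 sin^2 -
  3/4 - 1/100 is 3/8 - 1/100, and \<pi> times this exceeds 1.\<close>

lemma second_difference:
  assumes s: "s \<in> {-1, 1}" "1 / 2 \<le> s * cos (4 * \<theta>)" and k: "(real k + 2) * pi \<le> T"
  shows "\<kappa> * \<epsilon> ^ 3 \<le> s * (ang_mom ((real k + 2) * pi) - 2 * ang_mom ((real k + 1) * pi) + ang_mom (real k * pi))"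
proof -
  define c where "c = \<kappa> * \<epsilon>\<^sup>2"
  have c: "c > 0" using kappa eps by (simp add: c_def)
  define lo where "lo = real k * pi"
  have lo: "0 \<le> lo" "lo + 2 * pi \<le> T" using k by (auto simp: lo_def algebra_simps)
  define \<phi> where "\<phi> x = c * \<epsilon> * (9 / 4 * ((x - sin x * cos x) / 2) - (3 / 4 + 1 / 100) * x)" for x
  have "\<phi> (lo + pi) - \<phi> lo \<le> s * (ang_mom (lo + pi + pi) - ang_mom (lo + pi)) - s * (ang_mom (lo + pi) - ang_mom lo)"
  proof (rule diff_le_of_deriv[where S = "{lo..lo + pi}" and f' = "\<lambda>x. c * \<epsilon> * (9 / 4 * (sin x)\<^sup>2 - (3 / 4 + 1 / 100))"
        and \<phi>' = "\<lambda>x. s * (c * tide_torque a (Z (x + pi)) - c * tide_torque a (Z x))"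
        and \<phi> = "\<lambda>x. s * (ang_mom (x + pi) - ang_mom x)"])
    fix x assume x: "x \<in> {lo..lo + pi}"
    then have x0: "x \<in> {0..T}" "x + pi \<in> {0..T}" using lo pi_gt3 unfolding atLeastAtMost_iff by linarith+
    show "(\<phi> has_real_derivative c * \<epsilon> * (9 / 4 * (sin x)\<^sup>2 - (3 / 4 + 1 / 100))) (at x within {lo..lo + pi})"
      unfolding \<phi>_def by (intro DERIV_cmult DERIV_diff d_sin_cos DERIV_cmult_Id)
    have "((\<lambda>x. x + pi) has_real_derivative 1) (at x within {lo..lo + pi})"
      by (auto intro!: derivative_eq_intros)
    moreover have "(ang_mom has_real_derivative c * tide_torque a (Z (x + pi))) (at (x + pi) within (\<lambda>x. x + pi) ` {lo..lo + pi})"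
      by (rule DERIV_subset[OF d_ang_mom[OF x0(2), folded c_def]]) (use lo in auto)
    ultimately have "((\<lambda>x. ang_mom (x + pi)) has_real_derivative c * tide_torque a (Z (x + pi)) * 1) (at x within {lo..lo + pi})"
      by (metis DERIV_image_chain[unfolded o_def])
    moreover have "(ang_mom has_real_derivative c * tide_torque a (Z x)) (at x within {lo..lo + pi})"
      by (rule DERIV_subset[OF d_ang_mom[OF x0(1), folded c_def]]) (use lo pi_gt3 in auto)
    ultimately show "((\<lambda>x. s * (ang_mom (x + pi) - ang_mom x)) has_real_derivative
        s * (c * tide_torque a (Z (x + pi)) - c * tide_torque a (Z x))) (at x within {lo..lo + pi})"
      by (intro DERIV_cmult DERIV_diff) simp_all
    have "c * (\<epsilon> * (9 / 4 * (sin x)\<^sup>2 - 3 / 4 - 1 / 100)) \<le> c * (s * (tide_torque a (Z (x + pi)) - tide_torque a (Z x)))"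
      using torque_change[OF s, of x] x0 c by (intro mult_left_mono) auto
    then show "c * \<epsilon> * (9 / 4 * (sin x)\<^sup>2 - (3 / 4 + 1 / 100)) \<le> s * (c * tide_torque a (Z (x + pi)) - c * tide_torque a (Z x))"
      by (simp add: algebra_simps)
  qed auto
  moreover have "\<phi> (lo + pi) - \<phi> lo = c * \<epsilon> * (pi * (3 / 8 - 1 / 100))" by (simp add: \<phi>_def field_simps)
  moreover have "1 \<le> pi * (3 / 8 - 1 / 100)" using pi_gt3 by simp
  then have "c * \<epsilon> * 1 \<le> c * \<epsilon> * (pi * (3 / 8 - 1 / 100))" using c eps by (intro mult_left_mono) auto
  moreover have "lo + pi = (real k + 1) * pi" "lo + pi + pi = (real k + 2) * pi" by (simp_all add: lo_def algebra_simps)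
  ultimately show ?thesis
    by (simp add: lo_def c_def power2_eq_square power3_eq_cube algebra_simps)
qed

end

text \<open>Subtracting (d / 2) i^2, whose second difference is d, leaves a convex sequence, which
  lies below its chord from 0 to n. Everything is multiplied by n to avoid division.\<close>

lemma convex_sequence_chord:
  fixes X :: "nat \<Rightarrow> real"
  assumes "X 0 = 0" and c: "\<And>i. i + 2 \<le> n \<Longrightarrow> d \<le> X (i + 2) - 2 * X (i + 1) + X i" and k: "k \<le> n"
  shows "real n * X k \<le> real k * X n - d / 2 * (real k * real n * (real n - real k))"
proof -
  define Y where "Y i = X i - d / 2 * (real i)\<^sup>2" for i
  define D where "D i = Y (Suc i) - Y i" for i
  have D1: "D i \<le> D (Suc i)" if "i + 2 \<le> n" for i
    using c[OF that] by (simp add: D_def Y_def power2_eq_square algebra_simps)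
  have D: "D i \<le> D j" if "i \<le> j" "j < n" for i j
    using that
  proof (induction j)
    case (Suc j)
    then show ?case using D1[of j] by (cases "i = Suc j") auto
  qed simp
  \<comment> \<open>D k acts as slope of a supporting line: increments before k are at most D k,
    increments from k on are at least D k. \<open>low\<close> and \<open>high\<close> sum
    them.\<close>
  have low: "Y i \<le> real i * D k" if "i \<le> k" "k < n" for i
    using that
  proof (induction i)
    case (Suc i)
    then show ?case using D[of i k] by (simp add: D_def algebra_simps)
  qed (simp add: Y_def assms(1))
  have high: "real j * D k \<le> Y (k + j) - Y k" if "k + j \<le> n" "k < n" for j
    using that
  proof (induction j)
    case (Suc j)
    then show ?case using D[of k "k + j"] by (simp add: D_def algebra_simps)
  qed simp
  have "real n * Y k \<le> real k * Y n"
  proof (cases "k < n")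
    case True
    have 1: "Y k \<le> real k * D k" using low[of k] True by simp
    have 2: "(real n - real k) * D k \<le> Y n - Y k" using high[of "n - k"] True by (simp add: of_nat_diff)
    have "(real n - real k) * Y k \<le> (real n - real k) * (real k * D k)"
      using 1 True by (intro mult_left_mono) auto
    also have "\<dots> = real k * ((real n - real k) * D k)" by simp
    also have "\<dots> \<le> real k * (Y n - Y k)" using 2 by (intro mult_left_mono) auto
    finally show ?thesis by (simp add: algebra_simps)
  qed (use k in auto)
  then show ?thesis by (simp add: Y_def power2_eq_square algebra_simps)
qed

section \<open>Collisions and maxima of the distance\<close>

lemma half_le_cos:
  assumes "\<bar>x\<bar> \<le> pi / 3"
  shows "1 / 2 \<le> cos x"
proof -
  have "cos (pi / 3) \<le> cos \<bar>x\<bar>" using assms by (intro cos_monotone_0_pi_le) auto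
  then show ?thesis by (simp add: cos_60)
qed

lemma abs_le_2_sin:
  assumes "\<bar>x\<bar> \<le> pi / 3"
  shows "\<bar>x\<bar> \<le> 2 * \<bar>sin x\<bar>"
proof -
  have *: "x \<le> 2 * sin x" if "0 \<le> x" "x \<le> pi / 3" for x
  proof -
    have "x * (1 / 2) - 0 * (1 / 2) \<le> sin x - sin 0"
    proof (rule diff_le_of_deriv[where S = UNIV and f' = "\<lambda>_. 1 / 2" and \<phi>' = cos])
      show "1 / 2 \<le> cos y" if "y \<in> {0..x}" for y
        using that \<open>x \<le> pi / 3\<close> by (intro half_le_cos) auto
      show "(sin has_real_derivative cos y) (at y)" for y by (rule DERIV_sin)
      show "((\<lambda>y. y * (1 / 2)) has_real_derivative 1 / 2) (at y)" for y :: real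
        by (auto intro!: derivative_eq_intros)
    qed (use that in auto)
    then show ?thesis by simp
  qed
  show ?thesis
    using *[of x] *[of "- x"] assms by (cases "0 \<le> x") (auto simp: abs_if)
qed

text \<open>Between two points of a window of half width \<pi>/6 the doubled angle, relative to the
  centre, stays within \<pi>/3, where the cosine is at least 1/2.\<close>

lemma abs_double_between:
  fixes x :: real
  assumes "p \<le> x" "x \<le> q" "\<bar>p - m\<bar> \<le> pi / 6" "\<bar>q - m\<bar> \<le> pi / 6"
  shows "\<bar>2 * (x - m)\<bar> \<le> pi / 3"
proof -
  have "- (p - m) \<le> pi / 6" "q - m \<le> pi / 6" using assms(3,4) unfolding abs_le_iff by blast+
  then have "x - m \<le> pi / 6" "- (x - m) \<le> pi / 6" using assms(1,2) by linarith+
  then have "\<bar>x - m\<bar> \<le> pi / 6" by (rule abs_leI)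
  then show ?thesis unfolding abs_mult abs_numeral by simp
qed

lemma small_sin:
  assumes "\<bar>x\<bar> \<le> pi / 2" "\<bar>sin x\<bar> \<le> 1 / 2"
  shows "\<bar>x\<bar> \<le> pi / 6"
proof (rule ccontr)
  assume "\<not> ?thesis"
  then have "sin (pi / 6) < sin \<bar>x\<bar>" using assms by (intro sin_monotone_2pi) auto
  moreover have "sin \<bar>x\<bar> \<le> \<bar>sin x\<bar>" by (auto simp: abs_if)
  ultimately show False using assms by (simp add: sin_30)
qed

lemma nearest_multiple:
  assumes "- pi / 2 \<le> x"
  obtains k :: nat where "\<bar>x - real k * pi\<bar> \<le> pi / 2"
proof
  define j where "j = \<lfloor>x / pi + 1 / 2\<rfloor>"
  have "0 \<le> x / pi + 1 / 2" using assms by (simp add: field_simps)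
  then have j: "0 \<le> j" by (simp add: j_def)
  have "of_int j \<le> x / pi + 1 / 2" "x / pi + 1 / 2 < of_int j + 1" by (simp_all add: j_def)
  then have "of_int j * pi \<le> x + pi / 2" "x + pi / 2 < of_int j * pi + pi"
    by (simp_all add: field_simps)
  moreover have "real (nat j) * pi = of_int j * pi" using j by simp
  ultimately show "\<bar>x - real (nat j) * pi\<bar> \<le> pi / 2" by linarith
qed

lemma sin_nat_pi_add: "\<bar>sin (real k * pi + x)\<bar> = \<bar>sin x\<bar>"
  by (simp add: sin_add abs_mult)

lemma cos_2_nat_pi_add: "cos (2 * (real k * pi + x)) = cos (2 * x)"
proof -
  have "2 * (real k * pi + x) = 2 * x + 2 * real k * pi" by simp
  then show ?thesis
    by (simp only: cos_add cos_2npi sin_2npi mult_1_right mult_zero_right diff_zero)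
qed

lemma half_less_pi_div_6: "1 / 2 < pi / 6"
  using pi_gt3 by simp

context rtbp_orbit
begin

text \<open>Half the derivative of |Z|^2. Its zeros are the critical points of the distance;
  together with the angular momentum it determines \<open>cnj Z * Y\<close>, so it also serves as a
  shooting equation.\<close>

definition rho :: "real \<Rightarrow> real" where "rho \<tau> = Re (cnj (Z \<tau>) * Y \<tau>)"

lemma cont_rho: "continuous_on {0..T} rho"
  unfolding rho_def by (intro continuous_intros cont_Z cont_Y)

lemma rho_close:
  assumes "\<tau> \<in> {0..T}"
  shows "\<bar>rho \<tau> - sin (2 * \<tau>) / 2\<bar> \<le> 1 / 1000"
proof -
  define z y where "z = of_real (sin \<tau>) * cis \<theta>" and "y = of_real (cos \<tau>) * cis \<theta>"
  have "cmod z = \<bar>sin \<tau>\<bar>" "cmod y = \<bar>cos \<tau>\<bar>" by (simp_all add: z_def y_def norm_mult)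
  then have zy: "cmod z \<le> 1" "cmod y \<le> 1" by simp_all
  have "cmod (cnj (Z \<tau>) * Y \<tau> - cnj z * y) \<le> 2 * (3 * \<eta>) + 3 * \<eta> * 1"
    by (rule norm_mult_diff_le)
      (use Z_le[OF assms] orbit_close[OF assms] zy in \<open>auto simp: z_def y_def simp flip: complex_cnj_diff simp del: complex_cnj_mult\<close>)
  also have "\<dots> \<le> 1 / 1000" using etaB(2) by simp
  finally have "cmod (cnj (Z \<tau>) * Y \<tau> - cnj z * y) \<le> 1 / 1000" .
  moreover have "cnj z * y = of_real (sin (2 * \<tau>) / 2)"
  proof -
    have "cnj z * y = of_real (sin \<tau> * cos \<tau>) * (cis \<theta> * cnj (cis \<theta>))" by (simp add: z_def y_def)
    also have "cis \<theta> * cnj (cis \<theta>) = 1" by (simp add: cis_cnj cis_mult)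
    finally show ?thesis by (simp add: sin_double)
  qed
  ultimately have "\<bar>Re (cnj (Z \<tau>) * Y \<tau> - of_real (sin (2 * \<tau>) / 2))\<bar> \<le> 1 / 1000"
    by (metis abs_Re_le_cmod order_trans)
  then show ?thesis by (simp only: rho_def minus_complex.sel Re_complex_of_real)
qed

definition rho' :: "real \<Rightarrow> real" where
  "rho' \<tau> = (cmod (Y \<tau>))\<^sup>2 - (1 - \<epsilon> * ang_mom \<tau>) * (cmod (Z \<tau>))\<^sup>2 + \<kappa> * \<epsilon>\<^sup>2 * Re (cnj (Z \<tau>) * tide_force a (Z \<tau>))"

lemma d_rho:
  assumes "\<tau> \<in> {0..T}"
  shows "(rho has_real_derivative rho' \<tau>) (at \<tau> within {0..T})"
proof -
  have "Re (of_real ((cmod (Y \<tau>))\<^sup>2 - (1 - \<epsilon> * ang_mom \<tau>) * (cmod (Z \<tau>))\<^sup>2) + of_real (\<kappa> * \<epsilon>\<^sup>2) * (cnj (Z \<tau>) * tide_force a (Z \<tau>)))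
      = rho' \<tau>"
    unfolding rho'_def plus_complex.sel Im_complex_of_real times_complex.sel Re_complex_of_real by simp
  with has_real_derivative_Re[OF d_ZY[OF assms]] show ?thesis
    unfolding d_ZY_eq by (simp only: rho_def[abs_def])
qed

lemma rho'_close:
  assumes "\<tau> \<in> {0..T}"
  shows "\<bar>rho' \<tau> - cos (2 * \<tau>)\<bar> \<le> 1 / 1000"
proof -
  have n: "(cmod (Z \<tau>))\<^sup>2 \<le> 2\<^sup>2" using Z_le[OF assms] by (intro power_mono) auto
  have e: "\<epsilon> \<le> 1 / 100000" using eps_le etaB(2) by simp
  have "\<bar>\<epsilon> * ang_mom \<tau> * (cmod (Z \<tau>))\<^sup>2\<bar> = (\<epsilon> * \<bar>ang_mom \<tau>\<bar>) * (cmod (Z \<tau>))\<^sup>2"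
    using eps by (simp add: abs_mult)
  also have "\<dots> \<le> (\<kappa> * \<epsilon>\<^sup>2 / 100000) * 4"
    using ang_mom_bound(1)[OF assms] n eps kappa by (intro mult_mono) auto
  also have "\<dots> \<le> 1 / 100000" using kappa_eps2(2) e by simp
  finally have 1: "\<bar>\<epsilon> * ang_mom \<tau> * (cmod (Z \<tau>))\<^sup>2\<bar> \<le> 1 / 100000" .
  have "\<bar>Re (cnj (Z \<tau>) * tide_force a (Z \<tau>))\<bar> \<le> 2 * B"
    using abs_Re_le_cmod[of "cnj (Z \<tau>) * tide_force a (Z \<tau>)"]
      norm_mult_le[of "cnj (Z \<tau>)" 2 "tide_force a (Z \<tau>)" B] Z_le[OF assms] force_bound by auto
  from mult_left_mono[OF this, of "\<kappa> * \<epsilon>\<^sup>2"]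
  have "\<bar>\<kappa> * \<epsilon>\<^sup>2 * Re (cnj (Z \<tau>) * tide_force a (Z \<tau>))\<bar> \<le> \<kappa> * \<epsilon>\<^sup>2 * (2 * B)"
    using kappa by (simp only: abs_mult[of "\<kappa> * \<epsilon>\<^sup>2"]) simp
  also have "\<dots> \<le> 2 / 100000" using kappa_eps2(1) e by simp
  finally have 2: "\<bar>\<kappa> * \<epsilon>\<^sup>2 * Re (cnj (Z \<tau>) * tide_force a (Z \<tau>))\<bar> \<le> 2 / 100000" .
  have 3: "cos (2 * \<tau>) = (cos \<tau>)\<^sup>2 - (sin \<tau>)\<^sup>2" by (simp add: cos_double)
  have 4: "rho' \<tau> - cos (2 * \<tau>) = ((cmod (Y \<tau>))\<^sup>2 - (cos \<tau>)\<^sup>2) - ((cmod (Z \<tau>))\<^sup>2 - (sin \<tau>)\<^sup>2)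
     + \<epsilon> * ang_mom \<tau> * (cmod (Z \<tau>))\<^sup>2 + \<kappa> * \<epsilon>\<^sup>2 * Re (cnj (Z \<tau>) * tide_force a (Z \<tau>))"
    unfolding rho'_def 3 by (simp add: algebra_simps)
  show ?thesis unfolding 4 using 1 2 norm_sq_close[OF assms] etaB(2) by linarith
qed

definition dist_sq :: "real \<Rightarrow> real" where "dist_sq \<tau> = (cmod (Z \<tau>))\<^sup>2"

lemma cont_dist_sq: "continuous_on {0..T} dist_sq"
  unfolding dist_sq_def by (intro continuous_intros cont_Z)

lemma d_dist_sq:
  assumes "\<tau> \<in> {0..T}"
  shows "(dist_sq has_real_derivative 2 * rho \<tau>) (at \<tau> within {0..T})"
proof -
  have "((\<lambda>\<tau>. cnj (Z \<tau>) * Z \<tau>) has_vector_derivative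
      cnj (Z \<tau>) * (Y \<tau> + rot \<tau> * Z \<tau>) + cnj (Y \<tau> + rot \<tau> * Z \<tau>) * Z \<tau>) (at \<tau> within {0..T})"
    by (intro has_vector_derivative_mult bounded_linear.has_vector_derivative[OF bounded_linear_cnj] dZ assms)
  from has_real_derivative_Re[OF this]
  have "((\<lambda>\<tau>. Re (cnj (Z \<tau>) * Z \<tau>)) has_real_derivative Re (cnj (Z \<tau>) * (Y \<tau> + rot \<tau> * Z \<tau>) + cnj (Y \<tau> + rot \<tau> * Z \<tau>) * Z \<tau>)) (at \<tau> within {0..T})" .
  moreover have "(\<lambda>\<tau>. Re (cnj (Z \<tau>) * Z \<tau>)) = dist_sq"
    unfolding dist_sq_def[abs_def] cmod_power2 by (simp add: power2_eq_square)
  moreover have "Re (cnj (Z \<tau>) * (Y \<tau> + rot \<tau> * Z \<tau>) + cnj (Y \<tau> + rot \<tau> * Z \<tau>) * Z \<tau>) = 2 * rho \<tau>"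
  proof -
    have "cnj (rot \<tau>) = - rot \<tau>" by (simp add: rot_def)
    then have "cnj (Z \<tau>) * (Y \<tau> + rot \<tau> * Z \<tau>) + cnj (Y \<tau> + rot \<tau> * Z \<tau>) * Z \<tau> = cnj (Z \<tau>) * Y \<tau> + cnj (cnj (Z \<tau>) * Y \<tau>)"
      by (simp add: algebra_simps)
    then show ?thesis by (simp add: rho_def)
  qed
  ultimately show ?thesis by simp
qed

text \<open>\<open>rho'\<close> is within 1/1000 of cos (2x), so |rho'| \<ge> 1/4 on such an
  interval and \<open>rho\<close> has at most one zero there. This separates collisions near one
  multiple of \<pi> and makes the maximum in a window unique.\<close>

lemma rho_strict_mono:
  assumes s: "s \<in> {-1, 1}" and \<sigma>: "0 \<le> \<sigma>" "\<sigma> < \<tau>" "\<tau> \<le> T"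
    and c: "\<And>x. x \<in> {\<sigma>..\<tau>} \<Longrightarrow> 1 / 2 \<le> s * cos (2 * x)"
  shows "s * rho \<sigma> < s * rho \<tau>"
proof -
  have "\<tau> * (1 / 4) - \<sigma> * (1 / 4) \<le> s * rho \<tau> - s * rho \<sigma>"
  proof (rule diff_le_of_deriv[where S = "{0..T}" and f' = "\<lambda>_. 1 / 4" and \<phi>' = "\<lambda>x. s * rho' x"])
    fix x assume x: "x \<in> {\<sigma>..\<tau>}"
    then have x0: "x \<in> {0..T}" using \<sigma> by auto
    show "((\<lambda>x. s * rho x) has_real_derivative s * rho' x) (at x within {0..T})"
      by (intro DERIV_cmult d_rho x0)
    show "((\<lambda>x. x * (1 / 4)) has_real_derivative 1 / 4) (at x within {0..T})"
      by (auto intro!: derivative_eq_intros)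
    show "1 / 4 \<le> s * rho' x" using c[OF x] rho'_close[OF x0] s by (elim insertE emptyE; simp; linarith)
  qed (use \<sigma> in auto)
  then show ?thesis using \<sigma> by linarith
qed

lemma rho_0_collision: "Z \<tau> = 0 \<Longrightarrow> rho \<tau> = 0" "Z \<tau> = 0 \<Longrightarrow> ang_mom \<tau> = 0"
  by (simp_all add: rho_def ang_mom_def)

text \<open>At a collision \<open>frame_close\<close> forces |sin \<sigma>| \<le> \<epsilon> \<eta>
  B, so \<sigma> is that close to a multiple of \<pi>. The angular momentum vanishes at \<sigma> and
  can hardly change on the way to the multiple.\<close>

lemma near_collision:
  assumes "\<sigma> \<in> {0..T}" "Z \<sigma> = 0" "\<bar>\<sigma> - real k * pi\<bar> \<le> pi / 2" "real k * pi \<le> T"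
  shows "\<bar>\<sigma> - real k * pi\<bar> \<le> pi / 6" "\<bar>ang_mom (real k * pi)\<bar> \<le> \<kappa> * \<epsilon> ^ 3 / 8"
proof -
  define x where "x = \<sigma> - real k * pi"
  have "cmod (of_real (sin \<sigma>) * cis \<theta>) \<le> \<epsilon> * (\<eta> * B)"
    using frame_close(1)[OF assms(1)] B_kappa_eps2_tau(1)[OF assms(1)] assms(2) by simp
  then have "\<bar>sin \<sigma>\<bar> \<le> \<epsilon> * (\<eta> * B)" by (simp add: norm_mult)
  moreover have "\<sigma> = real k * pi + x" by (simp add: x_def)
  ultimately have s: "\<bar>sin x\<bar> \<le> \<epsilon> * (\<eta> * B)" using sin_nat_pi_add[of k x] by simp
  have "\<epsilon> * (\<eta> * B) \<le> 1 * (1 / 100000)" using etaB eps_le eps eta_pos B1 by (intro mult_mono) auto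
  then have x6: "\<bar>x\<bar> \<le> pi / 6" using small_sin[of x] assms(3) s by (simp add: x_def)
  then show "\<bar>\<sigma> - real k * pi\<bar> \<le> pi / 6" by (simp add: x_def)
  have x: "\<bar>x\<bar> \<le> 2 * (\<epsilon> * (\<eta> * B))" using abs_le_2_sin[of x] x6 s by linarith
  have "\<bar>ang_mom \<sigma> - ang_mom (real k * pi)\<bar> \<le> \<kappa> * \<epsilon>\<^sup>2 * B * \<bar>\<sigma> - real k * pi\<bar>"
    by (rule ang_mom_lip) (use assms in auto)
  also have "\<dots> \<le> \<kappa> * \<epsilon>\<^sup>2 * B * (2 * (\<epsilon> * (\<eta> * B)))"
    using x kappa B1 by (intro mult_left_mono) (auto simp: x_def)
  \<comment> \<open>The error has the same scale \<kappa> \<epsilon>^3 as the second difference and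
    is smaller by the factor 2 \<eta> B^2; this comparison is independent of \<mu> and n.\<close>
  also have "\<dots> = \<kappa> * \<epsilon> ^ 3 * (2 * (\<eta> * B\<^sup>2))" by (simp add: power2_eq_square power3_eq_cube)
  also have "\<dots> \<le> \<kappa> * \<epsilon> ^ 3 * (1 / 8)" using eta kappa eps by (intro mult_left_mono) auto
  finally show "\<bar>ang_mom (real k * pi)\<bar> \<le> \<kappa> * \<epsilon> ^ 3 / 8" using rho_0_collision(2)[OF assms(2)] by simp
qed

lemma no_intermediate_collision:
  assumes s: "s \<in> {-1, 1}" "1 / 2 \<le> s * cos (4 * \<theta>)"
    and U: "U \<in> {0..T}" "Z U = 0" "\<bar>U - real n * pi\<bar> \<le> 1 / 2" "real n * pi \<le> T"
    and \<sigma>: "0 < \<sigma>" "\<sigma> < U"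
  shows "Z \<sigma> \<noteq> 0"
proof
  assume Z\<sigma>: "Z \<sigma> = 0"
  have \<sigma>T: "\<sigma> \<in> {0..T}" using \<sigma> U by auto
  obtain k where k: "\<bar>\<sigma> - real k * pi\<bar> \<le> pi / 2" using nearest_multiple[of \<sigma>] \<sigma> pi_gt_zero by force
  have U2: "\<bar>U - real n * pi\<bar> \<le> pi / 2" using U half_less_pi_div_6 pi_gt3 by linarith
  have kn: "k \<le> n"
  proof (rule ccontr)
    assume "\<not> k \<le> n"
    then have "real n + 1 \<le> real k" by simp
    then have "(real n + 1) * pi \<le> real k * pi" by (intro mult_right_mono) auto
    then have "real n * pi + pi \<le> real k * pi" by (simp add: algebra_simps)
    then show False using k \<sigma> U pi_gt3 by linarith
  qed
  then have kT: "real k * pi \<le> T" using U(4) by (meson mult_right_mono of_nat_mono order_trans pi_ge_zero)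
  note near = near_collision[OF \<sigma>T Z\<sigma> k kT]
  \<comment> \<open>Two collisions in one window would be two zeros of \<open>rho\<close> where it
    is strictly increasing. This excludes collisions next to the ejection (k = 0) and next to U (k =
    n).\<close>
  have mono: False if "\<sigma>1 < \<sigma>2" "Z \<sigma>1 = 0" "Z \<sigma>2 = 0" "0 \<le> \<sigma>1" "\<sigma>2 \<le> T"
    "\<bar>\<sigma>1 - real j * pi\<bar> \<le> pi / 6" "\<bar>\<sigma>2 - real j * pi\<bar> \<le> pi / 6" for \<sigma>1 \<sigma>2 j
  proof -
    have "1 * rho \<sigma>1 < 1 * rho \<sigma>2"
    proof (rule rho_strict_mono)
      fix x assume "x \<in> {\<sigma>1..\<sigma>2}"
      then have "\<sigma>1 \<le> x" "x \<le> \<sigma>2" by auto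
      then have "\<bar>2 * (x - real j * pi)\<bar> \<le> pi / 3" using that(6,7) by (rule abs_double_between)
      then show "1 / 2 \<le> 1 * cos (2 * x)" using half_le_cos cos_2_nat_pi_add[of j "x - real j * pi"] by force
    qed (use that in auto)
    then show False using that rho_0_collision by simp
  qed
  consider "k = 0" | "k = n" | "0 < k" "k < n" using kn by linarith
  then show False
  proof cases
    case 1
    then show ?thesis using mono[of 0 \<sigma> 0] near \<sigma> \<sigma>T Z\<sigma> Z0 by auto
  next
    case 2
    then show ?thesis using mono[of \<sigma> U n] near \<sigma> \<sigma>T Z\<sigma> U half_less_pi_div_6 by auto
  next
    case 3
    define d where "d = \<kappa> * \<epsilon> ^ 3"
    have d: "d > 0" using kappa eps by (simp add: d_def)
    define X where "X i = s * ang_mom (real i * pi)" for i :: nat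
    have "real n * X k \<le> real k * X n - d / 2 * (real k * real n * (real n - real k))"
    proof (rule convex_sequence_chord)
      show "X 0 = 0" by (simp add: X_def ang_mom_0)
      fix i assume "i + 2 \<le> n"
      then have "(real i + 2) * pi \<le> real n * pi" by (intro mult_right_mono) auto
      then have "(real i + 2) * pi \<le> T" using U(4) by linarith
      from second_difference[OF s this]
      show "d \<le> X (i + 2) - 2 * X (i + 1) + X i" by (simp add: X_def d_def algebra_simps)
    qed (use kn in auto)
    \<comment> \<open>With |X k| and |X n| at most d / 8 and k (n - k) \<ge> 1, the chord inequality
      would give - n d / 8 \<le> n d / 8 - n d / 2, which is false.\<close>
    moreover have "\<bar>X k\<bar> \<le> d / 8" using near(2) s by (auto simp: X_def d_def)
    then have "real n * (- (d / 8)) \<le> real n * X k" by (intro mult_left_mono) auto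
    moreover have "\<bar>X n\<bar> \<le> d / 8"
      using near_collision(2)[OF U(1,2) U2 U(4)] s by (auto simp: X_def d_def)
    then have "real k * X n \<le> real k * (d / 8)" by (intro mult_left_mono) auto
    moreover have "real k * (d / 8) \<le> real n * (d / 8)" using 3 d by (intro mult_right_mono) auto
    moreover have "real n * 1 \<le> real n * (real k * (real n - real k))"
    proof (rule mult_left_mono)
      have "1 * 1 \<le> real k * (real n - real k)" using 3 by (intro mult_mono) auto
      then show "1 \<le> real k * (real n - real k)" by simp
    qed auto
    then have "d / 2 * real n \<le> d / 2 * (real k * real n * (real n - real k))"
      using d by (simp add: mult_ac)
    ultimately have "d * real n \<le> d * real n / 2" by (simp add: algebra_simps)
    moreover have "d * real n > 0" using d 3 by simp
    ultimately show False by simp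
  qed
qed

text \<open>At a zero of \<open>rho\<close> the value sin (2 \<tau>) is tiny, hence |cos (2 \<tau>)|
  \<ge> 1/2 and \<open>rho'\<close> has the sign of the cosine. Then the sign change of
  \<open>rho\<close> decides between maximum and strict minimum.\<close>

lemma local_max_iff:
  assumes U: "U \<le> T" and \<tau>: "0 < \<tau>" "\<tau> < U"
  shows "(\<forall>\<^sub>F \<sigma> in at \<tau>. (cmod (Z \<sigma>))\<^sup>2 \<le> (cmod (Z \<tau>))\<^sup>2) \<longleftrightarrow> rho \<tau> = 0 \<and> cos (2 * \<tau>) < 0"
proof -
  have \<tau>T: "\<tau> \<in> {0..T}" "0 < \<tau>" "\<tau> < T" using assms by auto
  have at: "at \<tau> within {0..T} = at \<tau>" using \<tau>T by (simp add: at_within_Icc_at)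
  have d1: "(dist_sq has_real_derivative 2 * rho \<sigma>) (at \<sigma>)" if "0 < \<sigma>" "\<sigma> < T" for \<sigma>
    using d_dist_sq[of \<sigma>] that by (simp add: at_within_Icc_at)
  have d2: "(rho has_real_derivative rho' \<tau>) (at \<tau>)" using d_rho[OF \<tau>T(1)] by (simp add: at)
  have gap: "\<bar>cos (2 * \<tau>)\<bar> \<ge> 1 / 2" if "rho \<tau> = 0"
  proof (rule ccontr)
    assume "\<not> ?thesis"
    then have "\<bar>cos (2 * \<tau>)\<bar>\<^sup>2 \<le> (1 / 2)\<^sup>2" by (intro power_mono) auto
    moreover have "\<bar>sin (2 * \<tau>)\<bar>\<^sup>2 \<le> (1 / 2)\<^sup>2" using rho_close[OF \<tau>T(1)] that by (intro power_mono) auto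
    ultimately show False using sin_cos_squared_add[of "2 * \<tau>"] by (simp add: power2_eq_square)
  qed
  obtain e where e: "e > 0" "\<And>\<sigma>. \<bar>\<sigma> - \<tau>\<bar> < e \<Longrightarrow> 0 < \<sigma> \<and> \<sigma> < T"
  proof
    show "min \<tau> (T - \<tau>) > 0" using \<tau>T by simp
  qed auto
  show ?thesis
  proof
    assume "\<forall>\<^sub>F \<sigma> in at \<tau>. (cmod (Z \<sigma>))\<^sup>2 \<le> (cmod (Z \<tau>))\<^sup>2"
    then obtain d where d: "d > 0" "\<And>\<sigma>. \<sigma> \<noteq> \<tau> \<Longrightarrow> \<bar>\<sigma> - \<tau>\<bar> < d \<Longrightarrow> dist_sq \<sigma> \<le> dist_sq \<tau>"
      unfolding eventually_at dist_sq_def by (auto simp: dist_real_def)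
    have r0: "rho \<tau> = 0"
    proof -
      have "2 * rho \<tau> = 0"
      proof (rule DERIV_local_max[OF d1[OF \<tau>T(2,3)] d(1)])
        show "\<forall>y. \<bar>\<tau> - y\<bar> < d \<longrightarrow> dist_sq y \<le> dist_sq \<tau>"
          using d(2) by (metis abs_minus_commute order_refl)
      qed
      then show ?thesis by simp
    qed
    moreover have "cos (2 * \<tau>) < 0"
    proof (rule ccontr)
      assume "\<not> cos (2 * \<tau>) < 0"
      then have "1 / 2 \<le> cos (2 * \<tau>)" using gap[OF r0] by linarith
      then have "rho' \<tau> > 0" using rho'_close[OF \<tau>T(1)] by linarith
      then obtain c where c: "c > 0" "\<And>h. 0 < h \<Longrightarrow> h < c \<Longrightarrow> rho \<tau> < rho (\<tau> + h)"
        using DERIV_pos_inc_right[OF d2] by auto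
      define h where "h = min (min c d) e / 2"
      have h: "0 < h" "h < c" "h < d" "h < e" using c d e by (auto simp: h_def)
      have "dist_sq \<tau> < dist_sq (\<tau> + h)"
      proof (rule DERIV_pos_imp_increasing_open[of \<tau> "\<tau> + h" dist_sq])
        show "\<exists>y. (dist_sq has_real_derivative y) (at x) \<and> 0 < y" if "\<tau> < x" "x < \<tau> + h" for x
          using d1[of x] e(2)[of x] c(2)[of "x - \<tau>"] that h r0 by (intro exI[of _ "2 * rho x"]) auto
        show "continuous_on {\<tau>..\<tau> + h} dist_sq"
          by (rule continuous_on_subset[OF cont_dist_sq]) (use e(2)[of "\<tau> + h"] h \<tau>T in auto)
      qed (use h in auto)
      then show False using d(2)[of "\<tau> + h"] h by auto
    qed
    ultimately show "rho \<tau> = 0 \<and> cos (2 * \<tau>) < 0" ..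
  next
    assume r: "rho \<tau> = 0 \<and> cos (2 * \<tau>) < 0"
    then have "cos (2 * \<tau>) \<le> - 1 / 2" using gap by linarith
    then have "rho' \<tau> < 0" using rho'_close[OF \<tau>T(1)] by linarith
    obtain c where c: "c > 0" "\<And>h. 0 < h \<Longrightarrow> h < c \<Longrightarrow> rho (\<tau> + h) < rho \<tau>"
      using DERIV_neg_dec_right[OF d2 \<open>rho' \<tau> < 0\<close>] by auto
    obtain c' where c': "c' > 0" "\<And>h. 0 < h \<Longrightarrow> h < c' \<Longrightarrow> rho \<tau> < rho (\<tau> - h)"
      using DERIV_neg_dec_left[OF d2 \<open>rho' \<tau> < 0\<close>] by auto
    have cont: "continuous_on {p..q} dist_sq" if "0 < p" "q < T" for p q
      by (rule continuous_on_subset[OF cont_dist_sq]) (use that in auto)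
    show "\<forall>\<^sub>F \<sigma> in at \<tau>. (cmod (Z \<sigma>))\<^sup>2 \<le> (cmod (Z \<tau>))\<^sup>2"
      unfolding eventually_at dist_sq_def[symmetric]
    proof (intro exI[of _ "min (min c c') e"] conjI ballI impI)
      show "0 < min (min c c') e" using c c' e by auto
      fix \<sigma> assume "\<sigma> \<noteq> \<tau> \<and> dist \<sigma> \<tau> < min (min c c') e"
      then have \<sigma>: "\<sigma> \<noteq> \<tau>" "\<bar>\<sigma> - \<tau>\<bar> < c" "\<bar>\<sigma> - \<tau>\<bar> < c'" "\<bar>\<sigma> - \<tau>\<bar> < e" by (auto simp: dist_real_def)
      show "dist_sq \<sigma> \<le> dist_sq \<tau>"
      proof (cases "\<tau> < \<sigma>")
        case True
        show ?thesis
        proof (rule DERIV_nonpos_imp_decreasing_open[of \<tau> \<sigma> dist_sq])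
          show "\<exists>y. (dist_sq has_real_derivative y) (at x) \<and> y \<le> 0" if "\<tau> < x" "x < \<sigma>" for x
            using d1[of x] e(2)[of x] c(2)[of "x - \<tau>"] that \<sigma> r by (intro exI[of _ "2 * rho x"]) auto
        qed (use True cont e(2)[OF \<sigma>(4)] \<tau>T in auto)
      next
        case False
        show ?thesis
        proof (rule DERIV_nonneg_imp_increasing_open[of \<sigma> \<tau> dist_sq])
          show "\<exists>y. (dist_sq has_real_derivative y) (at x) \<and> 0 \<le> y" if "\<sigma> < x" "x < \<tau>" for x
            using d1[of x] e(2)[of x] c'(2)[of "\<tau> - x"] that \<sigma> r by (intro exI[of _ "2 * rho x"]) auto
        qed (use False cont e(2)[OF \<sigma>(4)] \<tau>T in auto)
      qed
    qed
  qed
qed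

lemma card_local_max:
  assumes U: "U \<in> {0..T}" "\<bar>U - real n * pi\<bar> \<le> 1 / 2"
  defines "M \<equiv> {\<tau> \<in> {0<..<U}. \<forall>\<^sub>F \<sigma> in at \<tau>. (cmod (Z \<sigma>))\<^sup>2 \<le> (cmod (Z \<tau>))\<^sup>2}"
  shows "finite M \<and> card M = n"
proof -
  have M: "M = {\<tau> \<in> {0<..<U}. rho \<tau> = 0 \<and> cos (2 * \<tau>) < 0}"
    unfolding M_def using local_max_iff[of U] U by auto
  \<comment> \<open>The maxima of the unperturbed distance |sin \<tau>|; one true maximum is sought
    within \<pi>/6 of each.\<close>
  define c where "c k = real k * pi + pi / 2" for k :: nat
  have cc: "cos (2 * (c k + y)) = - cos (2 * y)" for k y
  proof -
    have "2 * (c k + y) = 2 * (real k * pi + (pi / 2 + y))" by (simp add: c_def)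
    then have "cos (2 * (c k + y)) = cos (2 * (pi / 2 + y))" by (simp only: cos_2_nat_pi_add)
    also have "2 * (pi / 2 + y) = pi + 2 * y" by simp
    finally show ?thesis by simp
  qed
  have ss: "\<bar>sin (2 * (c k + y))\<bar> = \<bar>sin (2 * y)\<bar>" for k y
  proof -
    have "2 * (c k + y) = real (2 * k + 1) * pi + 2 * y" by (simp add: c_def algebra_simps)
    then show ?thesis using sin_nat_pi_add[of "2 * k + 1" "2 * y"] by simp
  qed
  have ss': "sin (2 * (c k + y)) = - sin (2 * y)" for k y
  proof -
    have "2 * (c k + y) = 2 * y + pi + 2 * real k * pi" by (simp add: c_def algebra_simps)
    then show ?thesis by (simp add: sin_add)
  qed
  \<comment> \<open>The last window, k = n - 1, ends at n \<pi> - \<pi>/3, which is below U because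
    U is within 1/2 of n \<pi>.\<close>
  have win: "0 < c k - pi / 6" "c k + pi / 6 < U" if "k < n" for k
  proof -
    have "(real k + 1) * pi \<le> real n * pi" using that by (intro mult_right_mono) auto
    then have "real k * pi + pi \<le> real n * pi" by (simp add: algebra_simps)
    then have "real k * pi + pi \<le> U + 1 / 2" using U(2) by linarith
    then show "c k + pi / 6 < U" using half_less_pi_div_6 unfolding c_def by linarith
    have "0 \<le> real k * pi" by simp
    then show "0 < c k - pi / 6" using pi_gt3 unfolding c_def by linarith
  qed
  have ex: "\<exists>x. \<bar>x - c k\<bar> \<le> pi / 6 \<and> rho x = 0" if k: "k < n" for k
  proof -
    have T: "c k - pi / 6 \<in> {0..T}" "c k + pi / 6 \<in> {0..T}" using win[OF k] U pi_gt3 by auto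
    have sin3: "sin (pi / 3) > 1 / 2" by (simp add: sin_60)
    have e: "2 * (pi / 6) = pi / 3" "2 * - (pi / 6) = - (pi / 3)" by simp_all
    have 1: "rho (c k + pi / 6) \<le> 0" using rho_close[OF T(2), unfolded ss' e] sin3 by linarith
    have 2: "0 \<le> rho (c k - pi / 6)" using rho_close[OF T(1)] ss'[of k "- (pi / 6)", unfolded e sin_minus] sin3
      unfolding add_uminus_conv_diff by linarith
    have "continuous_on {c k - pi / 6..c k + pi / 6} rho"
      by (rule continuous_on_subset[OF cont_rho]) (use T in auto)
    then obtain x where x: "c k - pi / 6 \<le> x" "x \<le> c k + pi / 6" "rho x = 0"
      using IVT2'[of rho "c k + pi / 6" 0 "c k - pi / 6"] 1 2 pi_gt3 by auto
    then have "x - c k \<le> pi / 6" "- (x - c k) \<le> pi / 6" by linarith+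
    then have "\<bar>x - c k\<bar> \<le> pi / 6" by (rule abs_leI)
    then show ?thesis using x by blast
  qed
  have uniq: "x = y" if k: "k < n" and x: "\<bar>x - c k\<bar> \<le> pi / 6" "rho x = 0" and y: "\<bar>y - c k\<bar> \<le> pi / 6" "rho y = 0" for k x y
  proof -
    have *: False if "x < y" "\<bar>x - c k\<bar> \<le> pi / 6" "rho x = 0" "\<bar>y - c k\<bar> \<le> pi / 6" "rho y = 0" for x y
    proof -
      have "- 1 * rho x < - 1 * rho y"
      proof (rule rho_strict_mono)
        show "0 \<le> x" "y \<le> T" using win[OF k] that U unfolding atLeastAtMost_iff by linarith+
        fix z assume "z \<in> {x..y}"
        then have "x \<le> z" "z \<le> y" by auto
        then have "\<bar>2 * (z - c k)\<bar> \<le> pi / 3" using that(2,4) by (rule abs_double_between)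
        then show "1 / 2 \<le> - 1 * cos (2 * z)" using half_le_cos cc[of k "z - c k"] by force
      qed (use that in auto)
      then show False using that by simp
    qed
    then show ?thesis using x y by (meson linorder_neqE_linordered_idom)
  qed
  define m where "m k = (SOME x. \<bar>x - c k\<bar> \<le> pi / 6 \<and> rho x = 0)" for k
  have m: "\<bar>m k - c k\<bar> \<le> pi / 6" "rho (m k) = 0" if "k < n" for k
    using someI_ex[OF ex[OF that]] by (auto simp: m_def)
  have "M = m ` {..<n}"
  proof (intro equalityI subsetI)
    fix x assume "x \<in> m ` {..<n}"
    then obtain k where k: "k < n" "x = m k" by auto
    have "\<bar>2 * (m k - c k)\<bar> \<le> pi / 3" using m(1)[OF k(1)] m(1)[OF k(1)] by (intro abs_double_between[OF order_refl order_refl])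
    then have "cos (2 * m k) < 0" using half_le_cos[of "2 * (m k - c k)"] cc[of k "m k - c k"] by auto
    moreover have "0 < m k" "m k < U" using win[OF k(1)] m(1)[OF k(1)] by linarith+
    ultimately show "x \<in> M" using m k by (auto simp: M)
  next
    fix x assume "x \<in> M"
    then have x: "0 < x" "x < U" "rho x = 0" "cos (2 * x) < 0" by (auto simp: M)
    then have xT: "x \<in> {0..T}" using U by auto
    obtain k where k: "\<bar>(x - pi / 2) - real k * pi\<bar> \<le> pi / 2"
      using nearest_multiple[of "x - pi / 2"] x pi_gt_zero by force
    define y where "y = x - c k"
    have "y = x - pi / 2 - real k * pi" by (simp add: y_def c_def)
    then have y: "\<bar>y\<bar> \<le> pi / 2" "x = c k + y" using k by (simp_all only: y_def)
    have cy: "cos (2 * y) > 0" using x(4) cc[of k y] y by simp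
    have sy: "\<bar>sin (2 * y)\<bar> \<le> 1 / 500" using rho_close[OF xT] x(3) ss[of k y] y by simp
    have "\<bar>2 * y\<bar> \<le> pi / 2"
    proof (rule ccontr)
      assume "\<not> ?thesis"
      then have "cos \<bar>2 * y\<bar> \<le> cos (pi / 2)" using y by (intro cos_monotone_0_pi_le) auto
      then show False using cy by (simp add: abs_if split: if_splits)
    qed
    then have "\<bar>2 * y\<bar> \<le> pi / 6" using small_sin[of "2 * y"] sy by simp
    then have "\<bar>y\<bar> \<le> pi / 6" unfolding abs_mult abs_numeral using pi_gt_zero by linarith
    then have y6: "\<bar>x - c k\<bar> \<le> pi / 6" by (simp only: y_def)
    \<comment> \<open>A window with k \<ge> n starts at n \<pi> + \<pi>/3 or later, beyond
      U.\<close>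
    have "k < n"
    proof (rule ccontr)
      assume "\<not> k < n"
      then have "real n * pi \<le> real k * pi" by (intro mult_right_mono) auto
      then show False using y6 x(2) U(2) half_less_pi_div_6 unfolding c_def by linarith
    qed
    then have "x = m k" using uniq[of k x "m k"] y6 x m by auto
    then show "x \<in> m ` {..<n}" using \<open>k < n\<close> by auto
  qed
  moreover have "inj_on m {..<n}"
  proof (rule inj_onI)
    fix i j assume ij: "i \<in> {..<n}" "j \<in> {..<n}" "m i = m j"
    have *: False if "i < j" "m i = m j" "i < n" "j < n" for i j
    proof -
      have "(real i + 1) * pi \<le> real j * pi" using that by (intro mult_right_mono) auto
      then have "c i + pi \<le> c j" by (simp add: c_def algebra_simps)
      then show False using m(1)[of i] m(1)[of j] that pi_gt3 by linarith
    qed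
    show "i = j" using *[of i j] *[of j i] ij by (metis lessThan_iff linorder_neqE_nat)
  qed
  ultimately show ?thesis by (simp add: card_image)
qed

end

section \<open>Shooting\<close>

text \<open>The rescaled counterpart of \<open>ejection_collision\<close>. Only the length of the
  initial velocity is prescribed; its angle is normalized to the half circle when returning to the
  original variables.\<close>

definition scaled_EC :: "real \<Rightarrow> real \<Rightarrow> real \<Rightarrow> nat \<Rightarrow> real \<Rightarrow> (real \<Rightarrow> complex) \<Rightarrow> (real \<Rightarrow> complex) \<Rightarrow> bool" where
  "scaled_EC a \<kappa> \<epsilon> n U Z Y \<longleftrightarrow> 0 < U \<and> rtbp_solution a \<kappa> \<epsilon> U Z Y \<and> Z 0 = 0 \<and> cmod (Y 0) = 1 \<and> Z U = 0 \<and>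
     (\<forall>\<tau>\<in>{0<..<U}. Z \<tau> \<noteq> 0) \<and>
     finite {\<tau> \<in> {0<..<U}. \<forall>\<^sub>F \<sigma> in at \<tau>. (cmod (Z \<sigma>))\<^sup>2 \<le> (cmod (Z \<tau>))\<^sup>2} \<and>
     card {\<tau> \<in> {0<..<U}. \<forall>\<^sub>F \<sigma> in at \<tau>. (cmod (Z \<sigma>))\<^sup>2 \<le> (cmod (Z \<tau>))\<^sup>2} = n"

lemma rtbp_solution_subset:
  assumes "rtbp_solution a \<kappa> \<epsilon> T Z Y" "U \<le> T"
  shows "rtbp_solution a \<kappa> \<epsilon> U Z Y"
  unfolding rtbp_solution_def
proof (intro ballI conjI)
  fix \<tau> assume "\<tau> \<in> {0..U}"
  then have \<tau>: "\<tau> \<in> {0..T}" using assms by auto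
  show "cmod (Z \<tau>) \<le> 2" "cmod (Y \<tau>) \<le> 2" using assms \<tau> by (auto simp: rtbp_solution_def)
  show "((\<lambda>\<tau>. (Z \<tau>, Y \<tau>)) has_vector_derivative rtbp_field a \<kappa> \<epsilon> (Z \<tau>, Y \<tau>)) (at \<tau> within {0..U})"
    by (rule has_vector_derivative_within_subset[of _ _ _ "{0..T}"])
      (use assms \<tau> in \<open>auto simp: rtbp_solution_def\<close>)
qed

text \<open>Both reflections, in the real axis (s = 1) and in the imaginary axis (s = -1), reverse
  the field. Either one induces the reflection in the x axis, because the plane only sees
  z^2.\<close>

lemma rtbp_field_reverse:
  assumes "s \<in> {-1, 1 :: real}"
  shows "rtbp_field a \<kappa> \<epsilon> (of_real s * cnj z, - of_real s * cnj y)
    = (- of_real s * cnj (fst (rtbp_field a \<kappa> \<epsilon> (z, y))), of_real s * cnj (snd (rtbp_field a \<kappa> \<epsilon> (z, y))))"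
proof -
  have ss: "complex_of_real s * complex_of_real s = 1" using assms by auto
  have n: "cmod (of_real s * cnj z) = cmod z" using assms by (auto simp: norm_mult)
  have h: "Im (cnj (of_real s * cnj z) * (- of_real s * cnj y)) = Im (cnj z * y)"
    using assms by auto
  have f: "tide_force a (of_real s * cnj z) = of_real s * cnj (tide_force a z)"
    using assms by (auto simp: tide_force_minus tide_force_cnj)
  show ?thesis
    unfolding rtbp_field_def prod.case n h f fst_conv snd_conv
    by (simp add: algebra_simps)
qed

lemma rtbp_solution_reverse:
  assumes "rtbp_solution a \<kappa> \<epsilon> U Z Y" and s: "s \<in> {-1, 1 :: real}"
  shows "rtbp_solution a \<kappa> \<epsilon> U (\<lambda>\<tau>. of_real s * cnj (Z (U - \<tau>))) (\<lambda>\<tau>. - of_real s * cnj (Y (U - \<tau>)))"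
  unfolding rtbp_solution_def
proof (intro ballI conjI)
  fix \<tau> assume \<tau>: "\<tau> \<in> {0..U}"
  then have \<tau>': "U - \<tau> \<in> {0..U}" by auto
  have b: "cmod (Z (U - \<tau>)) \<le> 2" "cmod (Y (U - \<tau>)) \<le> 2"
    and d: "((\<lambda>\<tau>. (Z \<tau>, Y \<tau>)) has_vector_derivative rtbp_field a \<kappa> \<epsilon> (Z (U - \<tau>), Y (U - \<tau>))) (at (U - \<tau>) within {0..U})"
    using assms(1) \<tau>' by (auto simp: rtbp_solution_def)
  show "cmod (of_real s * cnj (Z (U - \<tau>))) \<le> 2" "cmod (- of_real s * cnj (Y (U - \<tau>))) \<le> 2"
    using b s by (auto simp: norm_mult)
  define F where "F = rtbp_field a \<kappa> \<epsilon> (Z (U - \<tau>), Y (U - \<tau>))"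
  have im: "(\<lambda>\<tau>. U - \<tau>) ` {0..U} = {0..U}"
  proof -
    have "x \<in> (\<lambda>\<tau>. U - \<tau>) ` {0..U}" if "x \<in> {0..U}" for x
      using that by (intro image_eqI[of _ _ "U - x"]) auto
    then show ?thesis by auto
  qed
  have "((\<lambda>\<tau>. U - \<tau>) has_vector_derivative - 1) (at \<tau> within {0..U})"
    by (auto intro!: derivative_eq_intros)
  from vector_diff_chain_within[OF this] d
  have "((\<lambda>\<tau>. (Z (U - \<tau>), Y (U - \<tau>))) has_vector_derivative - F) (at \<tau> within {0..U})"
    by (simp add: im o_def F_def)
  then have ZF: "((\<lambda>\<tau>. Z (U - \<tau>)) has_vector_derivative - fst F) (at \<tau> within {0..U})"
    and YF: "((\<lambda>\<tau>. Y (U - \<tau>)) has_vector_derivative - snd F) (at \<tau> within {0..U})"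
    unfolding has_vector_derivative_def by (auto dest: has_derivative_fst has_derivative_snd)
  have "((\<lambda>\<tau>. of_real s * cnj (Z (U - \<tau>))) has_vector_derivative of_real s * cnj (- fst F)) (at \<tau> within {0..U})"
    "((\<lambda>\<tau>. - of_real s * cnj (Y (U - \<tau>))) has_vector_derivative - of_real s * cnj (- snd F)) (at \<tau> within {0..U})"
    by (intro has_vector_derivative_mult_right bounded_linear.has_vector_derivative[OF bounded_linear_cnj] ZF YF)+
  from has_vector_derivative_Pair[OF this]
  show "((\<lambda>\<tau>. (of_real s * cnj (Z (U - \<tau>)), - of_real s * cnj (Y (U - \<tau>)))) has_vector_derivative
      rtbp_field a \<kappa> \<epsilon> (of_real s * cnj (Z (U - \<tau>)), - of_real s * cnj (Y (U - \<tau>)))) (at \<tau> within {0..U})"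
    unfolding rtbp_field_reverse[OF s] F_def by simp
qed

context rtbp
begin

text \<open>This constant feeds only the uniqueness theorem, so it may be crude and need not be
  small with \<epsilon>.\<close>

lemma rtbp_field_lip:
  assumes "cmod z \<le> 2" "cmod y \<le> 2" "cmod z' \<le> 2" "cmod y' \<le> 2"
  shows "norm (rtbp_field a \<kappa> \<epsilon> (z, y) - rtbp_field a \<kappa> \<epsilon> (z', y')) \<le> (40 + B) * norm ((z, y) - (z', y'))"
proof -
  define D where "D = norm ((z, y) - (z', y'))"
  have D0: "0 \<le> D" by (simp add: D_def)
  have d: "cmod (z - z') \<le> D" "cmod (y - y') \<le> D"
    using norm_fst_snd_le[of "(z, y) - (z', y')"] by (auto simp: D_def)
  have e1: "\<epsilon> \<le> 1" using eps_le etaB(2) by simp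
  define w where "w z = - \<i> * of_real (\<epsilon> / 2 * (cmod z)\<^sup>2)" for z
  define g where "g z y = of_real (\<epsilon> * Im (cnj z * y)) * z" for z y
  have sq: "(cmod z)\<^sup>2 \<le> 2\<^sup>2" using assms by (intro power_mono) auto
  have "cmod (w z) = \<epsilon> / 2 * (cmod z)\<^sup>2" unfolding w_def using eps by (simp add: norm_mult norm_power)
  also have "\<dots> \<le> 1 / 2 * 4" using e1 eps sq by (intro mult_mono) auto
  finally have w1: "cmod (w z) \<le> 2" by simp
  have "\<bar>cmod z - cmod z'\<bar> * (cmod z + cmod z') \<le> D * 4"
    using assms D0 by (intro mult_mono order_trans[OF norm_triangle_ineq3 d(1)]) auto
  moreover have "(cmod z)\<^sup>2 - (cmod z')\<^sup>2 = (cmod z - cmod z') * (cmod z + cmod z')"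
    by (simp add: power2_eq_square algebra_simps)
  ultimately have sqd: "\<bar>(cmod z)\<^sup>2 - (cmod z')\<^sup>2\<bar> \<le> D * 4" by (simp add: abs_mult)
  have "w z - w z' = - \<i> * of_real (\<epsilon> / 2 * ((cmod z)\<^sup>2 - (cmod z')\<^sup>2))"
    by (simp add: w_def algebra_simps)
  then have "cmod (w z - w z') = \<epsilon> / 2 * \<bar>(cmod z)\<^sup>2 - (cmod z')\<^sup>2\<bar>"
    using eps by (simp only: norm_mult norm_of_real abs_mult) simp
  also have "\<dots> \<le> 1 / 2 * (D * 4)" using sqd e1 eps by (intro mult_mono) auto
  finally have w2: "cmod (w z - w z') \<le> 2 * D" by simp
  have wz: "cmod (w z * z - w z' * z') \<le> 2 * D + 2 * D * 2" by (rule norm_mult_diff_le[OF w1 assms(3) w2 d(1)])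
  have wy: "cmod (w z * y - w z' * y') \<le> 2 * D + 2 * D * 2" by (rule norm_mult_diff_le[OF w1 assms(4) w2 d(2)])
  have "\<bar>Im (cnj z * y)\<bar> \<le> 2 * 2"
    by (rule order_trans[OF abs_Im_le_cmod norm_mult_le]) (use assms in auto)
  then have "\<epsilon> * \<bar>Im (cnj z * y)\<bar> \<le> 1 * 4" using e1 eps by (intro mult_mono) auto
  then have h1: "cmod (of_real (\<epsilon> * Im (cnj z * y))) \<le> 4" unfolding norm_of_real abs_mult using eps by simp
  have "\<bar>Im (cnj z * y) - Im (cnj z' * y')\<bar> \<le> cmod (cnj z * y - cnj z' * y')"
    using abs_Im_le_cmod[of "cnj z * y - cnj z' * y'"] by simp
  also have "\<dots> \<le> 2 * D + D * 2"
    by (rule norm_mult_diff_le) (use assms d in \<open>auto simp flip: complex_cnj_diff\<close>)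
  finally have "\<epsilon> * \<bar>Im (cnj z * y) - Im (cnj z' * y')\<bar> \<le> 1 * (4 * D)"
    using eps e1 D0 by (intro mult_mono) auto
  then have h2: "cmod (of_real (\<epsilon> * Im (cnj z * y)) - of_real (\<epsilon> * Im (cnj z' * y'))) \<le> 4 * D"
    unfolding of_real_diff[symmetric] norm_of_real right_diff_distrib[symmetric] abs_mult using eps by simp
  have gd: "cmod (g z y - g z' y') \<le> 4 * D + 4 * D * 2"
    unfolding g_def by (rule norm_mult_diff_le[OF h1 assms(3) h2 d(1)])
  have "cmod (of_real (\<kappa> * \<epsilon>\<^sup>2) * (tide_force a z - tide_force a z')) \<le> \<kappa> * \<epsilon>\<^sup>2 * (B * D)"
    by (rule norm_mult_le[OF norm_kappa])
      (use B1 in \<open>auto intro!: order_trans[OF force_lip[OF assms(1,3)]] mult_left_mono d\<close>)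
  also have "\<dots> \<le> 1 * (B * D)" using kappa_eps2(2) e1 eps B1 D0 by (intro mult_right_mono) auto
  finally have fd: "cmod (of_real (\<kappa> * \<epsilon>\<^sup>2) * tide_force a z - of_real (\<kappa> * \<epsilon>\<^sup>2) * tide_force a z') \<le> B * D"
    by (simp only: right_diff_distrib mult_1)
  have F: "rtbp_field a \<kappa> \<epsilon> (z, y) = (y + w z * z, w z * y - z + (g z y + of_real (\<kappa> * \<epsilon>\<^sup>2) * tide_force a z))" for z y
    by (simp add: rtbp_field_def w_def g_def)
  have "rtbp_field a \<kappa> \<epsilon> (z, y) - rtbp_field a \<kappa> \<epsilon> (z', y')
     = ((y - y') + (w z * z - w z' * z'), ((w z * y - w z' * y') - (z - z')) +
        ((g z y - g z' y') + (of_real (\<kappa> * \<epsilon>\<^sup>2) * tide_force a z - of_real (\<kappa> * \<epsilon>\<^sup>2) * tide_force a z')))"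
    unfolding F by simp
  also have "norm \<dots> \<le> (D + (2 * D + 2 * D * 2)) + (((2 * D + 2 * D * 2) + D) + ((4 * D + 4 * D * 2) + B * D))"
    by (intro order_trans[OF norm_Pair_le] add_mono order_trans[OF norm_triangle_ineq] order_trans[OF norm_triangle_ineq4]
        d wz wy gd fd)
  also have "\<dots> \<le> (40 + B) * D" using D0 by (simp add: algebra_simps)
  finally show ?thesis by (simp add: D_def)
qed

text \<open>The time at which \<open>rho\<close> vanishes is found together with \<theta>: near m
  \<pi>/2 \<open>rho\<close> is close to sin (2 \<tau>) / 2 and changes sign across the window,
  while F changes sign across the range of angles.\<close>

lemma shooting:
  fixes Z Y :: "real \<Rightarrow> real \<Rightarrow> complex" and F :: "real \<times> real \<Rightarrow> real" and m :: nat
  defines "c \<equiv> real m * (pi / 2)"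
  assumes cont: "continuous_on (UNIV \<times> {0..T}) (\<lambda>x. Z (fst x) (snd x))"
      "continuous_on (UNIV \<times> {0..T}) (\<lambda>x. Y (fst x) (snd x))"
    and orb: "\<And>\<theta>. rtbp_orbit B a \<kappa> \<epsilon> T \<eta> (Z \<theta>) (Y \<theta>) \<theta>"
    and m: "1 \<le> m" "c + 1 / 4 \<le> T" and \<theta>: "\<theta>1 \<le> \<theta>2"
    and F: "continuous_on ({\<theta>1..\<theta>2} \<times> {c - 1 / 4..c + 1 / 4}) F"
      "\<And>\<tau>. \<tau> \<in> {c - 1 / 4..c + 1 / 4} \<Longrightarrow> F (\<theta>1, \<tau>) \<le> 0" "\<And>\<tau>. \<tau> \<in> {c - 1 / 4..c + 1 / 4} \<Longrightarrow> 0 \<le> F (\<theta>2, \<tau>)"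
  obtains \<theta> \<tau> where "\<theta> \<in> {\<theta>1..\<theta>2}" "\<tau> \<in> {c - 1 / 4..c + 1 / 4}" "F (\<theta>, \<tau>) = 0" "Re (cnj (Z \<theta> \<tau>) * Y \<theta> \<tau>) = 0"
proof -
  \<comment> \<open>The sign with which sin (2 \<tau>) crosses 0 at m \<pi>/2; multiplied by it,
    \<open>rho\<close> always crosses upwards. At the window ends sin (1/2) / 2 exceeds the error
    1/1000 by far.\<close>
  define s where "s = cos (real m * pi)"
  have s: "s \<in> {-1, 1}"
    by (cases "even m") (auto simp: s_def cos_npi)
  have "1 * (pi / 2) \<le> c" unfolding c_def using m(1) by (intro mult_right_mono) auto
  then have c: "1 / 4 \<le> c" using pi_gt3 by linarith
  have sin2: "1 / 4 \<le> sin (1 / 2 :: real)"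
  proof -
    have "\<bar>1 / 2 :: real\<bar> \<le> 2 * \<bar>sin (1 / 2)\<bar>" using pi_gt3 by (intro abs_le_2_sin) auto
    moreover have "0 \<le> sin (1 / 2 :: real)" using pi_gt3 by (intro sin_ge_zero) auto
    ultimately show ?thesis by simp
  qed
  have sinc: "sin (2 * (c + x)) = s * sin (2 * x)" for x
  proof -
    have "2 * (c + x) = real m * pi + 2 * x" by (simp add: c_def)
    then show ?thesis by (simp add: sin_add s_def)
  qed
  define G where "G x = s * Re (cnj (Z (fst x) (snd x)) * Y (fst x) (snd x))" for x
  obtain \<theta> \<tau> where "\<theta> \<in> {\<theta>1..\<theta>2}" "\<tau> \<in> {c - 1 / 4..c + 1 / 4}" "F (\<theta>, \<tau>) = 0" "G (\<theta>, \<tau>) = 0"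
  proof (rule poincare_miranda[OF \<theta> _ F(1) _ F(2,3)])
    show "c - 1 / 4 \<le> c + 1 / 4" by simp
    have sub: "{\<theta>1..\<theta>2} \<times> {c - 1 / 4..c + 1 / 4} \<subseteq> UNIV \<times> {0..T}" using c m by auto
    show "continuous_on ({\<theta>1..\<theta>2} \<times> {c - 1 / 4..c + 1 / 4}) G"
      unfolding G_def by (intro continuous_intros continuous_on_subset[OF cont(1) sub] continuous_on_subset[OF cont(2) sub])
    fix \<theta>
    interpret rtbp_orbit B a \<kappa> \<epsilon> T \<eta> "Z \<theta>" "Y \<theta>" \<theta> by (rule orb)
    have 1: "\<bar>s * rho \<tau> - s * sin (2 * \<tau>) / 2\<bar> \<le> 1 / 1000" if "\<tau> \<in> {0..T}" for \<tau>
      using rho_close[OF that] s by (auto simp: abs_minus_commute)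
    have ss: "s * (s * x) = x" for x using s by auto
    have g: "G (\<theta>, \<tau>) = s * rho \<tau>" for \<tau> by (simp add: G_def rho_def)
    have "s * sin (2 * (c - 1 / 4)) = - sin (1 / 2)" using sinc[of "- 1 / 4"] ss by simp
    moreover have "\<bar>s * rho (c - 1 / 4) - s * sin (2 * (c - 1 / 4)) / 2\<bar> \<le> 1 / 1000"
      by (rule 1) (use c m in auto)
    ultimately show "G (\<theta>, c - 1 / 4) \<le> 0" using sin2 unfolding g by linarith
    have "s * sin (2 * (c + 1 / 4)) = sin (1 / 2)" using sinc[of "1 / 4"] ss by simp
    moreover have "\<bar>s * rho (c + 1 / 4) - s * sin (2 * (c + 1 / 4)) / 2\<bar> \<le> 1 / 1000"
      by (rule 1) (use c m in auto)
    ultimately show "0 \<le> G (\<theta>, c + 1 / 4)" using sin2 unfolding g by linarith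
  qed auto
  moreover have "s \<noteq> 0" using s by auto
  ultimately show ?thesis using that by (auto simp: G_def)
qed

end

context rtbp_orbit
begin

lemma scaled_EC_orbit:
  assumes s: "s \<in> {-1, 1}" "1 / 2 \<le> s * cos (4 * \<theta>)"
    and U: "U \<in> {0..T}" "Z U = 0" "\<bar>U - real n * pi\<bar> \<le> 1 / 2" "real n * pi \<le> T" and n: "1 \<le> n"
  shows "scaled_EC a \<kappa> \<epsilon> n U Z Y"
proof -
  have "1 * pi \<le> real n * pi" using n by (intro mult_right_mono) auto
  then have "0 < U" using U(3) pi_gt3 by linarith
  then show ?thesis
    unfolding scaled_EC_def
    using card_local_max[OF U(1,3)] no_intermediate_collision[OF s U] rtbp_solution_subset[OF sol, of U] U Z0 Y0
    by auto
qed

lemma orbit_sq_close: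
  assumes "\<tau> \<in> {0..T}"
  shows "cmod ((Z \<tau>)\<^sup>2 - of_real ((sin \<tau>)\<^sup>2) * cis (2 * \<theta>)) \<le> 1 / 1000"
proof -
  define w where "w = of_real (sin \<tau>) * cis \<theta>"
  have "cmod w = \<bar>sin \<tau>\<bar>" by (simp add: w_def norm_mult)
  then have w: "cmod w \<le> 1" by simp
  have d: "cmod (Z \<tau> - w) \<le> 3 * \<eta>" using orbit_close(1)[OF assms] by (simp add: w_def)
  have "cmod (Z \<tau> * Z \<tau> - w * w) \<le> 2 * (3 * \<eta>) + 3 * \<eta> * 1"
    by (rule norm_mult_diff_le[OF Z_le[OF assms] w d d])
  also have "\<dots> \<le> 1 / 1000" using etaB(2) by simp
  finally have "cmod ((Z \<tau>)\<^sup>2 - w\<^sup>2) \<le> 1 / 1000" by (simp add: power2_eq_square)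
  moreover have "w\<^sup>2 = of_real ((sin \<tau>)\<^sup>2) * cis (2 * \<theta>)"
    unfolding w_def power_mult_distrib of_real_power by (simp add: Complex.DeMoivre)
  ultimately show ?thesis by simp
qed

text \<open>The orbit and its reversed mirror image solve the same equation and agree at U / 2, so
  by uniqueness they agree on the second half. As s^2 = 1, the identity carries over to the first
  half.\<close>

lemma symmetric_orbit:
  assumes s: "s \<in> {-1, 1}" and U: "0 \<le> U" "U \<le> T"
    and mid: "Z (U / 2) = of_real s * cnj (Z (U / 2))" "Y (U / 2) = - of_real s * cnj (Y (U / 2))"
    and \<tau>: "\<tau> \<in> {0..U}"
  shows "Z \<tau> = of_real s * cnj (Z (U - \<tau>))"
proof -
  define W where "W \<tau> = (Z \<tau>, Y \<tau>)" for \<tau>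
  define V where "V \<tau> = (of_real s * cnj (Z (U - \<tau>)), - of_real s * cnj (Y (U - \<tau>)))" for \<tau>
  have solU: "rtbp_solution a \<kappa> \<epsilon> U Z Y" by (rule rtbp_solution_subset[OF sol U(2)])
  note rev = rtbp_solution_reverse[OF solU s]
  have eq: "W \<tau> = V \<tau>" if "\<tau> \<in> {U / 2..U}" for \<tau>
  proof (rule ode_unique[where f = "rtbp_field a \<kappa> \<epsilon>" and a = "U / 2" and b = U and L = "40 + B"])
    show "U / 2 \<le> U" using U by simp
    fix \<sigma> assume \<sigma>: "\<sigma> \<in> {U / 2..U}"
    then have \<sigma>0: "\<sigma> \<in> {0..U}" using U by auto
    have sub: "{U / 2..U} \<subseteq> {0..U}" using U by auto
    have "(W has_vector_derivative rtbp_field a \<kappa> \<epsilon> (W \<sigma>)) (at \<sigma> within {0..U})"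
      using solU \<sigma>0 unfolding rtbp_solution_def W_def by blast
    then show "(W has_vector_derivative rtbp_field a \<kappa> \<epsilon> (W \<sigma>)) (at \<sigma> within {U / 2..U})"
      by (rule has_vector_derivative_within_subset[OF _ sub])
    have "(V has_vector_derivative rtbp_field a \<kappa> \<epsilon> (V \<sigma>)) (at \<sigma> within {0..U})"
      using rev \<sigma>0 unfolding rtbp_solution_def V_def by blast
    then show "(V has_vector_derivative rtbp_field a \<kappa> \<epsilon> (V \<sigma>)) (at \<sigma> within {U / 2..U})"
      by (rule has_vector_derivative_within_subset[OF _ sub])
    show "norm (rtbp_field a \<kappa> \<epsilon> (W \<sigma>) - rtbp_field a \<kappa> \<epsilon> (V \<sigma>)) \<le> (40 + B) * norm (W \<sigma> - V \<sigma>)"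
      unfolding W_def V_def
      by (rule rtbp_field_lip) (use solU rev \<sigma>0 in \<open>unfold rtbp_solution_def, blast+\<close>)
  next
    show "W (U / 2) = V (U / 2)" using mid by (simp add: W_def V_def)
  qed (use that in auto)
  show ?thesis
  proof (cases "U / 2 \<le> \<tau>")
    case True
    then show ?thesis using eq[of \<tau>] \<tau> by (simp add: W_def V_def)
  next
    case False
    then have "Z (U - \<tau>) = of_real s * cnj (Z \<tau>)" using eq[of "U - \<tau>"] \<tau> by (simp add: W_def V_def)
    then show ?thesis using s by auto
  qed
qed

end

context rtbp
begin

lemma orbit_family:
  obtains Z Y :: "real \<Rightarrow> real \<Rightarrow> complex"
  where "continuous_on (UNIV \<times> {0..T}) (\<lambda>x. Z (fst x) (snd x))"
    "continuous_on (UNIV \<times> {0..T}) (\<lambda>x. Y (fst x) (snd x))"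
    "\<And>\<theta>. rtbp_orbit B a \<kappa> \<epsilon> T \<eta> (Z \<theta>) (Y \<theta>) \<theta>"
proof -
  obtain Z Y :: "real \<Rightarrow> real \<Rightarrow> complex"
    where ZY: "continuous_on (UNIV \<times> {0..T}) (\<lambda>x. Z (fst x) (snd x))"
      "continuous_on (UNIV \<times> {0..T}) (\<lambda>x. Y (fst x) (snd x))"
      "\<And>\<theta>. Z \<theta> 0 = 0" "\<And>\<theta>. Y \<theta> 0 = cis \<theta>" "\<And>\<theta>. rtbp_solution a \<kappa> \<epsilon> T (Z \<theta>) (Y \<theta>)"
    using solutions_exist by blast
  have "rtbp_orbit B a \<kappa> \<epsilon> T \<eta> (Z \<theta>) (Y \<theta>) \<theta>" for \<theta>
    by unfold_locales (use ZY in auto)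
  with ZY show ?thesis using that by blast
qed

text \<open>F is the angular momentum. On the sides \<pi>/6 and \<pi>/3 the value of sin (4
  \<theta>) is plus or minus sqrt 3 / 2, above the 5/6 that \<open>ang_mom_sign\<close> asks for,
  and cos (4 \<theta>) \<le> -1/2 holds throughout the range.\<close>

lemma oblique_EC_exists:
  assumes n: "1 \<le> n" "real n * pi + 1 / 2 \<le> T"
  obtains U Z Y \<theta> where "scaled_EC a \<kappa> \<epsilon> n U Z Y" "\<theta> \<in> {pi / 6..pi / 3}" "pi / 2 \<le> U"
    "\<And>\<tau>. \<tau> \<in> {0..U} \<Longrightarrow> cmod ((Z \<tau>)\<^sup>2 - of_real ((sin \<tau>)\<^sup>2) * cis (2 * \<theta>)) \<le> 1 / 1000"
proof -
  obtain Z Y where ZY: "continuous_on (UNIV \<times> {0..T}) (\<lambda>x. Z (fst x) (snd x))"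
    "continuous_on (UNIV \<times> {0..T}) (\<lambda>x. Y (fst x) (snd x))"
    "\<And>\<theta>. rtbp_orbit B a \<kappa> \<epsilon> T \<eta> (Z \<theta>) (Y \<theta>) \<theta>"
    using orbit_family by blast
  define c where "c = real (2 * n) * (pi / 2)"
  have c: "c = real n * pi" by (simp add: c_def)
  have "1 * pi \<le> real n * pi" using n by (intro mult_right_mono) auto
  then have c3: "pi \<le> c" by (simp add: c)
  have win: "\<tau> \<in> {0..T}" "5 / 2 \<le> \<tau>" if "\<tau> \<in> {c - 1 / 4..c + 1 / 4}" for \<tau>
    using that c3 n(2) pi_gt3 unfolding c atLeastAtMost_iff by linarith+
  have root3: "5 / 6 \<le> sqrt 3 / 2"
  proof -
    have "5 / 3 \<le> sqrt (3 :: real)" by (rule real_le_rsqrt) (simp add: power2_eq_square)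
    then show ?thesis by simp
  qed
  define F where "F x = Im (cnj (Z (fst x) (snd x)) * Y (fst x) (snd x))" for x
  have F: "F (\<theta>, \<tau>) = rtbp_orbit.ang_mom (Z \<theta>) (Y \<theta>) \<tau>" for \<theta> \<tau>
    unfolding rtbp_orbit.ang_mom_def[OF ZY(3)] by (simp add: F_def)
  obtain \<theta> U where \<theta>: "\<theta> \<in> {pi / 6..pi / 3}" and U: "U \<in> {c - 1 / 4..c + 1 / 4}"
    and F0: "F (\<theta>, U) = 0" and R0: "Re (cnj (Z \<theta> U) * Y \<theta> U) = 0"
    unfolding c_def
  proof (rule shooting[OF ZY, of "2 * n" "pi / 6" "pi / 3" F], fold c_def)
    show "1 \<le> 2 * n" using n by simp
    show "c + 1 / 4 \<le> T" using n by (simp add: c)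
    have sub: "{pi / 6..pi / 3} \<times> {c - 1 / 4..c + 1 / 4} \<subseteq> UNIV \<times> {0..T}" using win by auto
    show "continuous_on ({pi / 6..pi / 3} \<times> {c - 1 / 4..c + 1 / 4}) F"
      unfolding F_def by (intro continuous_intros continuous_on_subset[OF ZY(1) sub] continuous_on_subset[OF ZY(2) sub])
    fix \<tau> assume \<tau>: "\<tau> \<in> {c - 1 / 4..c + 1 / 4}"
    have "4 * (pi / 6) = pi - pi / 3" by simp
    then have "sin (4 * (pi / 6)) = sqrt 3 / 2" by (simp only: sin_pi_minus sin_60)
    then show "F (pi / 6, \<tau>) \<le> 0"
      using rtbp_orbit.ang_mom_sign[OF ZY(3), of "-1" "pi / 6" \<tau>] win[OF \<tau>] root3 unfolding F by simp
    have "4 * (pi / 3) = pi / 3 + pi" by simp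
    then have "sin (4 * (pi / 3)) = - (sqrt 3 / 2)" by (simp only: sin_periodic_pi sin_60)
    then show "0 \<le> F (pi / 3, \<tau>)"
      using rtbp_orbit.ang_mom_sign[OF ZY(3), of "1" "pi / 3" \<tau>] win[OF \<tau>] root3 unfolding F by simp
  qed auto
  interpret orb: rtbp_orbit B a \<kappa> \<epsilon> T \<eta> "Z \<theta>" "Y \<theta>" \<theta> by (rule ZY(3))
  have UT: "U \<in> {0..T}" by (rule win(1)[OF U])
  have Uc: "\<bar>U - real n * pi\<bar> \<le> 1 / 4"
    by (rule abs_leI) (use U[unfolded c] in auto)
  have "cos (U - real n * pi) \<ge> 1 / 2" by (rule half_le_cos) (use Uc pi_gt3 in linarith)
  moreover have "\<bar>cos U\<bar> = \<bar>cos (U - real n * pi)\<bar>"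
    using cos_add[of "U - real n * pi" "real n * pi"] by (simp add: abs_mult)
  ultimately have "(1 / 2)\<^sup>2 \<le> \<bar>cos U\<bar>\<^sup>2" by (intro power_mono) auto
  then have "Y \<theta> U \<noteq> 0" using orb.norm_sq_close(2)[OF UT] etaB(2) by (auto simp: power2_eq_square)
  \<comment> \<open>\<open>rho\<close> and the angular momentum are the two parts of this product.
    Near n \<pi> the speed is close to 1, so the position must be the factor that vanishes.\<close>
  moreover have "cnj (Z \<theta> U) * Y \<theta> U = 0" using F0 R0 by (simp add: F_def complex_eq_iff)
  ultimately have ZU: "Z \<theta> U = 0" by simp
  have "cos (2 * pi / 3) = - 1 / 2"
    using cos_pi_minus[of "pi / 3"] by (simp add: cos_60)
  have c4: "1 / 2 \<le> - 1 * cos (4 * \<theta>)"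
  proof -
    have "1 / 2 \<le> cos (4 * \<theta> - pi)" by (intro half_le_cos abs_leI) (use \<theta> in auto)
    then show ?thesis by (simp add: cos_diff)
  qed
  have EC: "scaled_EC a \<kappa> \<epsilon> n U (Z \<theta>) (Y \<theta>)"
    by (rule orb.scaled_EC_orbit[OF _ c4 UT ZU]) (use Uc n in auto)
  have "pi / 2 \<le> U" using Uc c3 pi_gt3 unfolding c by linarith
  then show ?thesis using that[OF EC \<theta>] orb.orbit_sq_close UT by auto
qed

text \<open>The orbit is followed only to h near n \<pi>/2, where it should meet one of the symmetry
  lines of z perpendicularly; the collision at 2 h then mirrors the ejection. The range of \<theta>
  keeps cos (4 \<theta>) \<ge> 1/2.\<close>

lemma symmetric_EC_exists:
  assumes n: "1 \<le> n" "real n * pi + 1 / 2 \<le> T"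
  obtains U Z Y \<theta> s where "scaled_EC a \<kappa> \<epsilon> n U Z Y" "\<theta> \<in> {- (pi / 12)..pi / 12}" "pi / 2 \<le> U"
    "\<And>\<tau>. \<tau> \<in> {0..U} \<Longrightarrow> cmod ((Z \<tau>)\<^sup>2 - of_real ((sin \<tau>)\<^sup>2) * cis (2 * \<theta>)) \<le> 1 / 1000"
    "s \<in> {-1, 1 :: real}" "\<And>\<tau>. \<tau> \<in> {0..U} \<Longrightarrow> Z \<tau> = of_real s * cnj (Z (U - \<tau>))"
proof -
  obtain Z Y where ZY: "continuous_on (UNIV \<times> {0..T}) (\<lambda>x. Z (fst x) (snd x))"
    "continuous_on (UNIV \<times> {0..T}) (\<lambda>x. Y (fst x) (snd x))"
    "\<And>\<theta>. rtbp_orbit B a \<kappa> \<epsilon> T \<eta> (Z \<theta>) (Y \<theta>) \<theta>"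
    using orbit_family by blast
  define c where "c = real n * (pi / 2)"
  have npi: "1 * pi \<le> real n * pi" using n by (intro mult_right_mono) auto
  then have c3: "pi / 2 \<le> c" by (simp add: c_def)
  have c2: "2 * c = real n * pi" by (simp add: c_def)
  have win: "\<tau> \<in> {0..T}" if "\<tau> \<in> {c - 1 / 4..c + 1 / 4}" for \<tau>
    using that c3 n(2) pi_gt3 c2 unfolding atLeastAtMost_iff by linarith
  \<comment> \<open>Up to sign this is Im Y for even n, when h is near a passage of the origin, and
    Im Z for odd n, when h is near a maximal distance. In both cases it is close to sin \<theta> cos
    (\<tau> - c).\<close>
  define F where "F x = Im (Z (fst x) (snd x)) * sin c + Im (Y (fst x) (snd x)) * cos c" for x
  have F: "\<bar>F (\<theta>, \<tau>) - sin \<theta> * cos (\<tau> - c)\<bar> \<le> 1 / 1000" if "\<tau> \<in> {c - 1 / 4..c + 1 / 4}" for \<theta> \<tau>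
  proof -
    interpret orb: rtbp_orbit B a \<kappa> \<epsilon> T \<eta> "Z \<theta>" "Y \<theta>" \<theta> by (rule ZY(3))
    have z: "\<bar>Im (Z \<theta> \<tau>) - sin \<tau> * sin \<theta>\<bar> \<le> 3 * \<eta>" "\<bar>Im (Y \<theta> \<tau>) - cos \<tau> * sin \<theta>\<bar> \<le> 3 * \<eta>"
      using order_trans[OF abs_Im_le_cmod orb.orbit_close(1)[OF win[OF that]]]
        order_trans[OF abs_Im_le_cmod orb.orbit_close(2)[OF win[OF that]]] by simp_all
    have "F (\<theta>, \<tau>) - sin \<theta> * cos (\<tau> - c) = (Im (Z \<theta> \<tau>) - sin \<tau> * sin \<theta>) * sin c + (Im (Y \<theta> \<tau>) - cos \<tau> * sin \<theta>) * cos c"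
      by (simp add: F_def cos_diff algebra_simps)
    also have "\<bar>\<dots>\<bar> \<le> 3 * \<eta> * 1 + 3 * \<eta> * 1"
      by (intro order_trans[OF abs_triangle_ineq] add_mono; unfold abs_mult; intro mult_mono z) (use eta_pos in auto)
    also have "\<dots> \<le> 1 / 1000" using etaB(2) by simp
    finally show ?thesis .
  qed
  have s12: "1 / 8 \<le> sin (pi / 12)"
  proof -
    have "\<bar>pi / 12\<bar> \<le> 2 * \<bar>sin (pi / 12)\<bar>" by (intro abs_le_2_sin) auto
    moreover have "0 \<le> sin (pi / 12)" by (intro sin_ge_zero) auto
    ultimately show ?thesis using pi_gt3 by simp
  qed
  have cw: "1 / 2 \<le> cos (\<tau> - c)" if "\<tau> \<in> {c - 1 / 4..c + 1 / 4}" for \<tau>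
  proof (rule half_le_cos)
    have "\<bar>\<tau> - c\<bar> \<le> 1 / 4" by (rule abs_leI) (use that in auto)
    then show "\<bar>\<tau> - c\<bar> \<le> pi / 3" using pi_gt3 by linarith
  qed
  obtain \<theta> h where \<theta>: "\<theta> \<in> {- (pi / 12)..pi / 12}" and h: "h \<in> {c - 1 / 4..c + 1 / 4}"
    and F0: "F (\<theta>, h) = 0" and R0: "Re (cnj (Z \<theta> h) * Y \<theta> h) = 0"
    unfolding c_def
  proof (rule shooting[OF ZY, of n "- (pi / 12)" "pi / 12" F], fold c_def)
    show "1 \<le> n" using n by simp
    show "c + 1 / 4 \<le> T" using n(2) c2 npi pi_gt3 by linarith
    have sub: "{- (pi / 12)..pi / 12} \<times> {c - 1 / 4..c + 1 / 4} \<subseteq> UNIV \<times> {0..T}" using win by auto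
    show "continuous_on ({- (pi / 12)..pi / 12} \<times> {c - 1 / 4..c + 1 / 4}) F"
      unfolding F_def by (intro continuous_intros continuous_on_subset[OF ZY(1) sub] continuous_on_subset[OF ZY(2) sub])
    fix \<tau> assume \<tau>: "\<tau> \<in> {c - 1 / 4..c + 1 / 4}"
    have p: "1 / 8 * (1 / 2) \<le> sin (pi / 12) * cos (\<tau> - c)" using s12 cw[OF \<tau>] by (intro mult_mono) auto
    show "F (- (pi / 12), \<tau>) \<le> 0" using F[OF \<tau>, of "- (pi / 12)"] p unfolding sin_minus mult_minus_left by linarith
    show "0 \<le> F (pi / 12, \<tau>)" using F[OF \<tau>, of "pi / 12"] p by linarith
  qed auto
  interpret orb: rtbp_orbit B a \<kappa> \<epsilon> T \<eta> "Z \<theta>" "Y \<theta>" \<theta> by (rule ZY(3))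
  define U where "U = 2 * h"
  have hT: "h \<in> {0..T}" by (rule win[OF h])
  have Uc: "\<bar>U - real n * pi\<bar> \<le> 1 / 2"
    unfolding U_def c2[symmetric] by (rule abs_leI) (use h in auto)
  have UT: "U \<in> {0..T}" using Uc n(2) npi pi_gt3 unfolding atLeastAtMost_iff by linarith
  have hc: "(1 / 2)\<^sup>2 \<le> (cos (h - c))\<^sup>2" using cw[OF h] by (intro power_mono) auto
  have R0': "Re (Z \<theta> h) * Re (Y \<theta> h) + Im (Z \<theta> h) * Im (Y \<theta> h) = 0" using R0 by simp
  obtain s where s: "s \<in> {-1, 1 :: real}" "Z \<theta> h = of_real s * cnj (Z \<theta> h)" "Y \<theta> h = - of_real s * cnj (Y \<theta> h)"
  \<comment> \<open>For even n: Y is real and nonzero, so \<open>rho\<close> = 0 makes Z imaginary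
    and s = -1. For odd n: Z is real and nonzero, so Y is imaginary and s = 1.\<close>
  proof (cases "even n")
    case True
    then obtain k where k: "n = 2 * k" by blast
    have sc: "sin c = 0" "cos c \<noteq> 0" by (simp_all add: c_def k)
    then have Im: "Im (Y \<theta> h) = 0" using F0 by (simp add: F_def)
    have "(cos c)\<^sup>2 = 1" using sin_cos_squared_add[of c] sc by simp
    then have "(cos h)\<^sup>2 = (cos (h - c))\<^sup>2" by (simp add: cos_diff power_mult_distrib sc)
    then have "Y \<theta> h \<noteq> 0" using hc orb.norm_sq_close(2)[OF hT] etaB(2) by (auto simp: power2_eq_square)
    then have "Re (Z \<theta> h) = 0" using R0' Im by (auto simp: complex_eq_iff)
    then show ?thesis using Im by (intro that[of "-1"]) (auto simp: complex_eq_iff)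
  next
    case False
    then obtain k where k: "n = 2 * k + 1" using oddE by blast
    have cc: "c = real k * pi + pi / 2" by (simp add: c_def k algebra_simps)
    have sc: "cos c = 0" "sin c = cos (real k * pi)" by (simp_all add: cc cos_add sin_add)
    then have "sin c \<noteq> 0" by simp
    then have Im: "Im (Z \<theta> h) = 0" using F0 sc by (simp add: F_def)
    have "(sin c)\<^sup>2 = 1" using sin_cos_squared_add[of c] sc(1) by simp
    then have "(sin h)\<^sup>2 = (cos (h - c))\<^sup>2" by (simp add: cos_diff power_mult_distrib sc(1))
    then have "Z \<theta> h \<noteq> 0" using hc orb.norm_sq_close(1)[OF hT] etaB(2) by (auto simp: power2_eq_square)
    then have "Re (Y \<theta> h) = 0" using R0' Im by (auto simp: complex_eq_iff)
    then show ?thesis using Im by (intro that[of "1"]) (auto simp: complex_eq_iff)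
  qed
  have sym: "Z \<theta> \<tau> = of_real s * cnj (Z \<theta> (U - \<tau>))" if "\<tau> \<in> {0..U}" for \<tau>
    by (rule orb.symmetric_orbit[OF s(1) _ _ _ _ that]) (use UT s(2,3) in \<open>auto simp: U_def\<close>)
  have ZU: "Z \<theta> U = 0" using sym[of U] UT orb.Z0 by simp
  have c4: "1 / 2 \<le> 1 * cos (4 * \<theta>)"
  proof -
    have "1 / 2 \<le> cos (4 * \<theta>)" by (intro half_le_cos abs_leI) (use \<theta> in auto)
    then show ?thesis by simp
  qed
  have EC: "scaled_EC a \<kappa> \<epsilon> n U (Z \<theta>) (Y \<theta>)"
    by (rule orb.scaled_EC_orbit[OF _ c4 UT ZU Uc]) (use n in auto)
  have "pi / 2 \<le> U" using Uc npi pi_gt3 by linarith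
  then show ?thesis using that[OF EC \<theta> _ _ s(1) sym] orb.orbit_sq_close UT by auto
qed

end

section \<open>Back to the restricted three-body problem\<close>

lemma eventually_at_affine:
  fixes m d s :: real
  assumes "m \<noteq> 0"
  shows "(\<forall>\<^sub>F x in at s. Q (m * x + d)) \<longleftrightarrow> (\<forall>\<^sub>F y in at (m * s + d). Q y)"
proof
  assume "\<forall>\<^sub>F x in at s. Q (m * x + d)"
  then obtain e where e: "e > 0" "\<And>x. x \<noteq> s \<Longrightarrow> dist x s < e \<Longrightarrow> Q (m * x + d)"
    unfolding eventually_at by auto
  show "\<forall>\<^sub>F y in at (m * s + d). Q y"
    unfolding eventually_at
  proof (intro exI[of _ "\<bar>m\<bar> * e"] conjI ballI impI)
    show "0 < \<bar>m\<bar> * e" using e assms by simp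
    fix y assume y: "y \<noteq> m * s + d \<and> dist y (m * s + d) < \<bar>m\<bar> * e"
    define x where "x = (y - d) / m"
    have x: "y = m * x + d" using assms by (simp add: x_def)
    have "dist y (m * s + d) = \<bar>m\<bar> * dist x s"
      by (simp add: x dist_real_def abs_mult flip: right_diff_distrib)
    then have "dist x s < e" using y assms by simp
    moreover have "x \<noteq> s" using y x by auto
    ultimately show "Q y" using e(2) x by simp
  qed
next
  assume "\<forall>\<^sub>F y in at (m * s + d). Q y"
  then obtain e where e: "e > 0" "\<And>y. y \<noteq> m * s + d \<Longrightarrow> dist y (m * s + d) < e \<Longrightarrow> Q y"
    unfolding eventually_at by auto
  show "\<forall>\<^sub>F x in at s. Q (m * x + d)"
    unfolding eventually_at
  proof (intro exI[of _ "e / \<bar>m\<bar>"] conjI ballI impI)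
    show "0 < e / \<bar>m\<bar>" using e assms by simp
    fix x assume x: "x \<noteq> s \<and> dist x s < e / \<bar>m\<bar>"
    have "dist (m * x + d) (m * s + d) = \<bar>m\<bar> * dist x s"
      by (simp add: dist_real_def abs_mult flip: right_diff_distrib)
    also have "\<dots> < e" using x assms by (simp add: field_simps)
    finally show "Q (m * x + d)" using e(2) x assms by simp
  qed
qed

text \<open>Used for the change of time scale and, with m = -1, for time reversal.\<close>

lemma card_local_max_affine:
  fixes f :: "real \<Rightarrow> real" and m d :: real
  assumes "m \<noteq> 0" and g: "\<And>x. g x = c * f (m * x + d)" and c: "0 < c"
    and A: "\<And>x. x \<in> A \<longleftrightarrow> m * x + d \<in> B"
  shows "finite {x \<in> A. \<forall>\<^sub>F x' in at x. g x' \<le> g x} \<longleftrightarrow> finite {y \<in> B. \<forall>\<^sub>F y' in at y. f y' \<le> f y}"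
    "card {x \<in> A. \<forall>\<^sub>F x' in at x. g x' \<le> g x} = card {y \<in> B. \<forall>\<^sub>F y' in at y. f y' \<le> f y}"
proof -
  have *: "(\<forall>\<^sub>F x' in at x. g x' \<le> g x) \<longleftrightarrow> (\<forall>\<^sub>F y' in at (m * x + d). f y' \<le> f (m * x + d))" for x
    using eventually_at_affine[OF assms(1), of "\<lambda>y'. f y' \<le> f (m * x + d)" d x] c by (simp add: g)
  have "bij_betw (\<lambda>x. m * x + d) {x \<in> A. \<forall>\<^sub>F x' in at x. g x' \<le> g x} {y \<in> B. \<forall>\<^sub>F y' in at y. f y' \<le> f y}"
  proof (rule bij_betwI[where g = "\<lambda>y. (y - d) / m"])
    show "(\<lambda>y. (y - d) / m) \<in> {y \<in> B. \<forall>\<^sub>F y' in at y. f y' \<le> f y} \<rightarrow> {x \<in> A. \<forall>\<^sub>F x' in at x. g x' \<le> g x}"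
      using assms(1) by (auto simp: * A)
  qed (use assms(1) A * in auto)
  then show "finite {x \<in> A. \<forall>\<^sub>F x' in at x. g x' \<le> g x} \<longleftrightarrow> finite {y \<in> B. \<forall>\<^sub>F y' in at y. f y' \<le> f y}"
    "card {x \<in> A. \<forall>\<^sub>F x' in at x. g x' \<le> g x} = card {y \<in> B. \<forall>\<^sub>F y' in at y. f y' \<le> f y}"
    by (auto simp: bij_betw_finite bij_betw_same_card)
qed

text \<open>The sign \<sigma> is the freedom of exchanging (u, v) and (-u, -v), which brings every
  direction into the range of \<theta> used for ejection orbits.\<close>

lemma polar_half_circle:
  fixes x y \<rho> :: real
  assumes "0 < \<rho>" "x\<^sup>2 + y\<^sup>2 = \<rho>\<^sup>2"
  obtains \<theta> \<sigma> where "\<theta> \<in> {0..<pi}" "\<sigma> \<in> {-1, 1 :: real}" "\<sigma> * x = \<rho> * cos \<theta>" "\<sigma> * y = \<rho> * sin \<theta>"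
proof -
  have "(x / \<rho>)\<^sup>2 + (y / \<rho>)\<^sup>2 = 1"
    using assms by (simp add: power_divide flip: add_divide_distrib)
  then obtain t where t: "0 \<le> t" "t < 2 * pi" "x / \<rho> = cos t" "y / \<rho> = sin t"
    using sincos_total_2pi by metis
  then have xy: "x = \<rho> * cos t" "y = \<rho> * sin t" using assms by (simp_all add: field_simps)
  show ?thesis
  proof (cases "t < pi")
    case True
    then show ?thesis using that[of t 1] t xy by simp
  next
    case False
    then have "cos (t - pi) = - cos t" "sin (t - pi) = - sin t" by (simp_all add: cos_diff sin_diff)
    then show ?thesis using that[of "t - pi" "-1"] False t xy by simp
  qed
qed

lemma r2_levi_civita:
  "r2 \<mu> (levi_civita \<mu> u v) = sqrt (1 + (2 * (u\<^sup>2 - v\<^sup>2) + (u\<^sup>2 + v\<^sup>2)\<^sup>2))"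
proof -
  have "(u\<^sup>2 - v\<^sup>2 + 1)\<^sup>2 + (2 * u * v)\<^sup>2 = 1 + (2 * (u\<^sup>2 - v\<^sup>2) + (u\<^sup>2 + v\<^sup>2)\<^sup>2)"
    by (simp add: power2_eq_square algebra_simps)
  then show ?thesis by (simp add: r2_def levi_civita_def)
qed

lemma tide_root_1: "tide_root 1 (Complex u v) = sqrt (1 + (2 * (u\<^sup>2 - v\<^sup>2) + (u\<^sup>2 + v\<^sup>2)\<^sup>2))"
  and tide_arg_1: "tide_arg 1 (Complex u v) = 2 * (u\<^sup>2 - v\<^sup>2) + (u\<^sup>2 + v\<^sup>2)\<^sup>2"
proof -
  have "(cmod (Complex u v)) ^ 4 = ((cmod (Complex u v))\<^sup>2)\<^sup>2" by (simp flip: power_mult)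
  then have "(cmod (Complex u v)) ^ 4 = (u\<^sup>2 + v\<^sup>2)\<^sup>2" by (simp add: cmod_power2)
  then show 1: "tide_arg 1 (Complex u v) = 2 * (u\<^sup>2 - v\<^sup>2) + (u\<^sup>2 + v\<^sup>2)\<^sup>2"
    by (simp add: tide_arg_def power2_eq_square)
  then show "tide_root 1 (Complex u v) = sqrt (1 + (2 * (u\<^sup>2 - v\<^sup>2) + (u\<^sup>2 + v\<^sup>2)\<^sup>2))"
    by (simp add: tide_root_def)
qed

text \<open>Here the cancelled fractions are multiplied out again: i is the inverse distance to the
  second primary, in terms of which the gradient of the regularized potential is computed.\<close>

lemma tide_force_1:
  fixes u v :: real
  defines "q \<equiv> 2 * (u\<^sup>2 - v\<^sup>2) + (u\<^sup>2 + v\<^sup>2)\<^sup>2" and "R \<equiv> u\<^sup>2 + v\<^sup>2"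
  assumes q: "0 < 1 + q"
  defines "i \<equiv> 1 / sqrt (1 + q)"
  shows "Re (tide_force 1 (Complex u v)) = u * (2 * i - 2 + q - 3 * R\<^sup>2 + 2 * R * (1 + R) * (1 - i ^ 3))"
    "Im (tide_force 1 (Complex u v)) = v * (2 * i - 2 + q - 3 * R\<^sup>2 + 2 * R * (R - 1) * (1 - i ^ 3))"
proof -
  define S where "S = sqrt (1 + q)"
  have S: "S > 0" "S\<^sup>2 = 1 + q" "i = 1 / S" using q by (simp_all add: S_def i_def)
  have e: "q\<^sup>2 * tide_e S = i - 1 + q / 2" using tide_e_eq[OF S(1)] S by simp
  have k: "2 * (q * tide_k S) = 1 - i ^ 3" using tide_k_eq[OF S(1)] S by (simp add: power_one_over)
  have n2: "(cmod (Complex u v))\<^sup>2 = R" by (simp add: cmod_power2 R_def)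
  have n4: "(cmod (Complex u v)) ^ 4 = R\<^sup>2" using arg_cong[OF n2, of "\<lambda>x. x\<^sup>2"] by (simp flip: power_mult)
  have r: "tide_root 1 (Complex u v) = S" "tide_arg 1 (Complex u v) = q"
    using tide_root_1[of u v] tide_arg_1[of u v] by (simp_all add: S_def q_def)
  have F: "tide_force 1 (Complex u v) = of_real (2 * (q\<^sup>2 * tide_e S) - 3 * R\<^sup>2) * Complex u v
     + of_real (2 * R * (2 * (q * tide_k S))) * (cnj (Complex u v) + of_real R * Complex u v)"
    unfolding tide_force_def n2 n4 r by (simp add: mult.assoc)
  show "Re (tide_force 1 (Complex u v)) = u * (2 * i - 2 + q - 3 * R\<^sup>2 + 2 * R * (1 + R) * (1 - i ^ 3))"
    "Im (tide_force 1 (Complex u v)) = v * (2 * i - 2 + q - 3 * R\<^sup>2 + 2 * R * (R - 1) * (1 - i ^ 3))"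
    unfolding F e k by (simp_all add: algebra_simps)
qed

text \<open>A chain rule along an arbitrary curve: freezing u or v yields the partial derivatives,
  and the general case yields conservation of the energy.\<close>

lemma reg_potential_derivative:
  fixes u v :: "real \<Rightarrow> real"
  assumes u: "(u has_real_derivative p) (at s within S)" and v: "(v has_real_derivative q) (at s within S)"
    and r: "0 < 1 + (2 * ((u s)\<^sup>2 - (v s)\<^sup>2) + ((u s)\<^sup>2 + (v s)\<^sup>2)\<^sup>2)"
  shows "((\<lambda>s. reg_potential \<mu> C (u s) (v s)) has_real_derivative
      p * ((12 * ((u s)\<^sup>2 + (v s)\<^sup>2)\<^sup>2 - 4 * (C - 3 * \<mu>)) * u s + 4 * \<mu> * Re (tide_force 1 (Complex (u s) (v s))))
    + q * ((12 * ((u s)\<^sup>2 + (v s)\<^sup>2)\<^sup>2 - 4 * (C - 3 * \<mu>)) * v s + 4 * \<mu> * Im (tide_force 1 (Complex (u s) (v s)))))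
    (at s within S)"
proof -
  define N where "N s = 1 + (2 * ((u s)\<^sup>2 - (v s)\<^sup>2) + ((u s)\<^sup>2 + (v s)\<^sup>2)\<^sup>2)" for s
  define N' where "N' = 4 * (u s * p - v s * q) + 4 * ((u s)\<^sup>2 + (v s)\<^sup>2) * (u s * p + v s * q)"
  define i where "i = 1 / sqrt (N s)"
  have N0: "0 < N s" using r by (simp add: N_def)
  have dN: "(N has_real_derivative N') (at s within S)"
    unfolding N_def[abs_def] N'_def by (auto intro!: derivative_eq_intros u v simp: power2_eq_square algebra_simps)
  have "((\<lambda>s. inverse (sqrt (N s))) has_real_derivative - (inverse (sqrt (N s)) * (N' * (inverse (sqrt (N s)) / 2)) * inverse (sqrt (N s)))) (at s within S)"
    using N0 by (intro DERIV_inverse' DERIV_chain2[OF DERIV_real_sqrt, THEN DERIV_cong]) (auto intro!: derivative_eq_intros dN)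
  then have "((\<lambda>s. inverse (sqrt (N s))) has_real_derivative - (i ^ 3 * N' / 2)) (at s within S)"
    by (rule DERIV_cong) (simp only: i_def inverse_eq_divide power3_eq_cube, simp)
  then have di: "((\<lambda>s. 1 / sqrt (N s)) has_real_derivative - (i ^ 3 * N' / 2)) (at s within S)"
    by (simp only: inverse_eq_divide)
  have V: "reg_potential \<mu> C (u s) (v s) = 4 * (1 - \<mu>) + 4 * ((u s)\<^sup>2 + (v s)\<^sup>2) *
      (((\<mu> + (u s)\<^sup>2 - (v s)\<^sup>2)\<^sup>2 + (2 * u s * v s)\<^sup>2) / 2 + \<mu> * (1 / sqrt (N s)) + \<mu> * (1 - \<mu>) / 2 - C / 2)" for s
    unfolding reg_potential_def Let_def r2_levi_civita N_def by (simp add: levi_civita_def)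
  have tf: "Re (tide_force 1 (Complex (u s) (v s))) = u s * (2 * i - 2 + (N s - 1) - 3 * ((u s)\<^sup>2 + (v s)\<^sup>2)\<^sup>2
        + 2 * ((u s)\<^sup>2 + (v s)\<^sup>2) * (1 + ((u s)\<^sup>2 + (v s)\<^sup>2)) * (1 - i ^ 3))"
    "Im (tide_force 1 (Complex (u s) (v s))) = v s * (2 * i - 2 + (N s - 1) - 3 * ((u s)\<^sup>2 + (v s)\<^sup>2)\<^sup>2
        + 2 * ((u s)\<^sup>2 + (v s)\<^sup>2) * (((u s)\<^sup>2 + (v s)\<^sup>2) - 1) * (1 - i ^ 3))"
    using tide_force_1[OF r] by (simp_all add: i_def N_def)
  have "((\<lambda>s. 4 * (1 - \<mu>) + 4 * ((u s)\<^sup>2 + (v s)\<^sup>2) *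
      (((\<mu> + (u s)\<^sup>2 - (v s)\<^sup>2)\<^sup>2 + (2 * u s * v s)\<^sup>2) / 2 + \<mu> * (1 / sqrt (N s)) + \<mu> * (1 - \<mu>) / 2 - C / 2)) has_real_derivative
      8 * (u s * p + v s * q) * (((\<mu> + (u s)\<^sup>2 - (v s)\<^sup>2)\<^sup>2 + (2 * u s * v s)\<^sup>2) / 2 + \<mu> * (1 / sqrt (N s)) + \<mu> * (1 - \<mu>) / 2 - C / 2)
      + 4 * ((u s)\<^sup>2 + (v s)\<^sup>2) * (2 * (\<mu> + (u s)\<^sup>2 - (v s)\<^sup>2) * (u s * p - v s * q)
          + 4 * u s * v s * (p * v s + u s * q) + \<mu> * (- (i ^ 3 * N' / 2)))) (at s within S)"
  proof -
    have dX: "((\<lambda>s. ((\<mu> + (u s)\<^sup>2 - (v s)\<^sup>2)\<^sup>2 + (2 * u s * v s)\<^sup>2) / 2) has_real_derivative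
        2 * (\<mu> + (u s)\<^sup>2 - (v s)\<^sup>2) * (u s * p - v s * q) + 4 * u s * v s * (p * v s + u s * q)) (at s within S)"
      by (auto intro!: derivative_eq_intros u v simp: power2_eq_square field_simps)
    have dR: "((\<lambda>s. 4 * ((u s)\<^sup>2 + (v s)\<^sup>2)) has_real_derivative 8 * (u s * p + v s * q)) (at s within S)"
      by (auto intro!: derivative_eq_intros u v simp: algebra_simps)
    show ?thesis
      using DERIV_add[OF DERIV_const[of "4 * (1 - \<mu>)"] DERIV_mult[OF dR DERIV_diff[OF DERIV_add[OF DERIV_add[OF dX DERIV_cmult[OF di, of \<mu>]]
        DERIV_const[of "\<mu> * (1 - \<mu>) / 2"]] DERIV_const[of "C / 2"]]]]
      by (rule DERIV_cong) (simp add: mult.commute)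
  qed
  then show ?thesis
    unfolding V i_def[symmetric]
    by (rule DERIV_cong) (simp add: tf N'_def N_def field_simps power2_eq_square power3_eq_cube)
qed

lemma reg_potential_partials:
  assumes r: "0 < 1 + (2 * (u\<^sup>2 - v\<^sup>2) + (u\<^sup>2 + v\<^sup>2)\<^sup>2)"
  shows "deriv (\<lambda>a. reg_potential \<mu> C a v) u = (12 * (u\<^sup>2 + v\<^sup>2)\<^sup>2 - 4 * (C - 3 * \<mu>)) * u + 4 * \<mu> * Re (tide_force 1 (Complex u v))"
    "deriv (\<lambda>b. reg_potential \<mu> C u b) v = (12 * (u\<^sup>2 + v\<^sup>2)\<^sup>2 - 4 * (C - 3 * \<mu>)) * v + 4 * \<mu> * Im (tide_force 1 (Complex u v))"
proof -
  show "deriv (\<lambda>a. reg_potential \<mu> C a v) u = (12 * (u\<^sup>2 + v\<^sup>2)\<^sup>2 - 4 * (C - 3 * \<mu>)) * u + 4 * \<mu> * Re (tide_force 1 (Complex u v))"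
    using reg_potential_derivative[of "\<lambda>x. x" 1 u UNIV "\<lambda>x. v" 0 \<mu> C] r by (intro DERIV_imp_deriv) simp
  show "deriv (\<lambda>b. reg_potential \<mu> C u b) v = (12 * (u\<^sup>2 + v\<^sup>2)\<^sup>2 - 4 * (C - 3 * \<mu>)) * v + 4 * \<mu> * Im (tide_force 1 (Complex u v))"
    using reg_potential_derivative[of "\<lambda>x. u" 0 v UNIV "\<lambda>x. x" 1 \<mu> C] r by (intro DERIV_imp_deriv) simp
qed

text \<open>P is the velocity in the rotating frame. Eliminating y turns the two halves of the
  rotation into the Coriolis term with coefficient 2 \<epsilon> |z|^2 and the term 3/4 \<epsilon>^2
  |z|^4 z, which is the rescaled 12 R^2 w for w = u + i v.\<close>

lemma rtbp_second_order:
  assumes sol: "rtbp_solution a \<kappa> \<epsilon> T Z Y" and \<tau>: "\<tau> \<in> {0..T}"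
  defines "P \<equiv> \<lambda>\<tau>. Y \<tau> - \<i> * of_real (\<epsilon> / 2 * (cmod (Z \<tau>))\<^sup>2) * Z \<tau>"
  shows "(Z has_vector_derivative P \<tau>) (at \<tau> within {0..T})"
    "(P has_vector_derivative - \<i> * of_real (2 * \<epsilon> * (cmod (Z \<tau>))\<^sup>2) * P \<tau> - Z \<tau>
        + of_real (3 / 4 * \<epsilon>\<^sup>2 * (cmod (Z \<tau>)) ^ 4) * Z \<tau> + of_real (\<kappa> * \<epsilon>\<^sup>2) * tide_force a (Z \<tau>)) (at \<tau> within {0..T})"
proof -
  define N where "N = of_real (\<kappa> * \<epsilon>\<^sup>2) * tide_force a (Z \<tau>)"
  define z y where "z = Z \<tau>" and "y = Y \<tau>"
  define Y' where "Y' = - \<i> * of_real (\<epsilon> / 2 * (cmod z)\<^sup>2) * y - z + (of_real (\<epsilon> * Im (cnj z * y)) * z + N)"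
  have d: "((\<lambda>\<tau>. (Z \<tau>, Y \<tau>)) has_vector_derivative (P \<tau>, Y')) (at \<tau> within {0..T})"
  proof -
    have "rtbp_field a \<kappa> \<epsilon> (Z \<tau>, Y \<tau>) = (P \<tau>, Y')"
      by (simp add: rtbp_field_def P_def Y'_def N_def z_def y_def)
    then show ?thesis using sol \<tau> unfolding rtbp_solution_def by metis
  qed
  show dZ: "(Z has_vector_derivative P \<tau>) (at \<tau> within {0..T})"
    using d unfolding has_vector_derivative_def by (auto dest: has_derivative_fst)
  have dY: "(Y has_vector_derivative Y') (at \<tau> within {0..T})"
    using d unfolding has_vector_derivative_def by (auto dest: has_derivative_snd)
  have "((\<lambda>\<tau>. Y \<tau> - (\<i> * of_real (\<epsilon> / 2)) * (Z \<tau> * cnj (Z \<tau>) * Z \<tau>)) has_vector_derivative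
     Y' - (\<i> * of_real (\<epsilon> / 2)) * (z * cnj z * P \<tau> + (z * cnj (P \<tau>) + P \<tau> * cnj z) * z)) (at \<tau> within {0..T})"
    unfolding z_def
    by (intro has_vector_derivative_diff has_vector_derivative_mult_right has_vector_derivative_mult dY dZ
        bounded_linear.has_vector_derivative[OF bounded_linear_cnj])
  moreover have "(\<lambda>\<tau>. Y \<tau> - (\<i> * of_real (\<epsilon> / 2)) * (Z \<tau> * cnj (Z \<tau>) * Z \<tau>)) = P"
    unfolding P_def complex_norm_square[symmetric] by (simp add: fun_eq_iff mult_ac)
  moreover have "Y' - (\<i> * of_real (\<epsilon> / 2)) * (z * cnj z * P \<tau> + (z * cnj (P \<tau>) + P \<tau> * cnj z) * z)
      = - \<i> * of_real (2 * \<epsilon> * (cmod z)\<^sup>2) * P \<tau> - z + of_real (3 / 4 * \<epsilon>\<^sup>2 * (cmod z) ^ 4) * z + N"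
  proof -
    have zz: "of_real ((cmod z)\<^sup>2) = z * cnj z" by (rule complex_norm_square)
    have z4: "of_real ((cmod z) ^ 4) = (z * cnj z) * (z * cnj z)"
      unfolding zz[symmetric] of_real_mult[symmetric] by (simp flip: power_add)
    have h: "of_real (Im (cnj z * y)) = - (\<i> / 2) * (cnj z * y - z * cnj y)"
      by (simp add: complex_eq_iff diff_divide_distrib)
    have Pt: "P \<tau> = y - \<i> * of_real (\<epsilon> / 2) * (z * cnj z) * z"
      unfolding P_def z_def y_def complex_norm_square[symmetric] by simp
    have cP: "cnj (P \<tau>) = cnj y + \<i> * of_real (\<epsilon> / 2) * (z * cnj z) * cnj z"
      unfolding Pt by simp
    show ?thesis
      unfolding Y'_def of_real_mult zz z4 h cP Pt
      by (simp add: field_simps power2_eq_square)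
  qed
  ultimately show "(P has_vector_derivative - \<i> * of_real (2 * \<epsilon> * (cmod (Z \<tau>))\<^sup>2) * P \<tau> - Z \<tau>
        + of_real (3 / 4 * \<epsilon>\<^sup>2 * (cmod (Z \<tau>)) ^ 4) * Z \<tau> + of_real (\<kappa> * \<epsilon>\<^sup>2) * tide_force a (Z \<tau>)) (at \<tau> within {0..T})"
    unfolding N_def z_def by simp
qed

lemma levi_civita_scale:
  assumes "\<sigma> \<in> {-1, 1 :: real}"
  shows "levi_civita \<mu> (\<sigma> * A * Re z) (\<sigma> * A * Im z) = (\<mu> + A\<^sup>2 * Re (z\<^sup>2), A\<^sup>2 * Im (z\<^sup>2))"
proof -
  have "\<sigma> * \<sigma> * x = x" for x using assms by auto
  note \<sigma> = this
  have "levi_civita \<mu> (\<sigma> * A * Re z) (\<sigma> * A * Im z)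
      = (\<mu> + \<sigma> * \<sigma> * (A\<^sup>2 * Re (z\<^sup>2)), \<sigma> * \<sigma> * (A\<^sup>2 * Im (z\<^sup>2)))"
    by (simp add: levi_civita_def power2_eq_square algebra_simps)
  then show ?thesis unfolding \<sigma> .
qed

lemma r2_pos_near_P1:
  fixes u v :: real
  assumes "u\<^sup>2 + v\<^sup>2 \<le> 1 / 4"
  shows "0 < 1 + (2 * (u\<^sup>2 - v\<^sup>2) + (u\<^sup>2 + v\<^sup>2)\<^sup>2)"
proof -
  have "v\<^sup>2 \<le> 1 / 4" using assms by (smt (verit) zero_le_power2)
  moreover have "0 \<le> u\<^sup>2" "0 \<le> (u\<^sup>2 + v\<^sup>2)\<^sup>2" by simp_all
  ultimately show ?thesis unfolding right_diff_distrib by linarith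
qed

text \<open>The substitution is u + i v = \<sigma> A Z(\<omega> s). Then \<omega>^2 = 4 c normalizes
  the linear force, A \<omega> = 2 sqrt (2 (1 - \<mu>)) turns unit speed into the ejection speed,
  and \<epsilon> \<omega> = 4 A^2 matches the Coriolis term.\<close>

lemma n_EC_orbit_of_scaled_EC:
  fixes \<mu> c A :: real
  assumes \<mu>: "0 < \<mu>" "\<mu> < 1" and c: "0 < c" "C = 3 * \<mu> + c" and A: "0 < A" "A\<^sup>2 = 2 * (1 - \<mu>) / c" "A\<^sup>2 \<le> 1 / 32"
    and \<epsilon>: "\<epsilon> = 2 * A\<^sup>2 / sqrt c"
    and EC: "scaled_EC (A\<^sup>2) (\<mu> / 4) \<epsilon> n U Z Y"
  shows "n_EC_orbit \<mu> C n ((\<lambda>\<tau>. (\<mu> + A\<^sup>2 * Re ((Z \<tau>)\<^sup>2), A\<^sup>2 * Im ((Z \<tau>)\<^sup>2))) ` {0..U})"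
proof -
  define \<omega> where "\<omega> = 2 * sqrt c"
  have \<omega>: "0 < \<omega>" "\<omega>\<^sup>2 = 4 * c" using c by (simp_all add: \<omega>_def power_mult_distrib)
  have \<epsilon>\<omega>: "\<epsilon> * \<omega> = 4 * A\<^sup>2" using c by (simp add: \<epsilon> \<omega>_def)
  have U: "0 < U" and sol: "rtbp_solution (A\<^sup>2) (\<mu> / 4) \<epsilon> U Z Y" and Z0: "Z 0 = 0" and Y0: "cmod (Y 0) = 1" and ZU: "Z U = 0"
    and nz: "\<And>\<tau>. \<tau> \<in> {0<..<U} \<Longrightarrow> Z \<tau> \<noteq> 0"
    using EC by (auto simp: scaled_EC_def)
  define P where "P \<tau> = Y \<tau> - \<i> * of_real (\<epsilon> / 2 * (cmod (Z \<tau>))\<^sup>2) * Z \<tau>" for \<tau>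
  note dZ = rtbp_second_order[OF sol, folded P_def]
  have P0: "P 0 = Y 0" by (simp add: P_def Z0)
  obtain \<theta> \<sigma> where \<theta>: "\<theta> \<in> {0..<pi}" and \<sigma>: "\<sigma> \<in> {-1, 1 :: real}"
    and Y\<theta>: "\<sigma> * Re (Y 0) = 1 * cos \<theta>" "\<sigma> * Im (Y 0) = 1 * sin \<theta>"
  proof (rule polar_half_circle[of 1 "Re (Y 0)" "Im (Y 0)"])
    show "(Re (Y 0))\<^sup>2 + (Im (Y 0))\<^sup>2 = 1\<^sup>2" using Y0 by (simp flip: cmod_power2)
  qed auto
  have \<sigma>2: "\<sigma> * \<sigma> = 1" using \<sigma> by auto
  define u v p q where "u s = \<sigma> * A * Re (Z (\<omega> * s))" and "v s = \<sigma> * A * Im (Z (\<omega> * s))"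
    and "p s = \<sigma> * A * \<omega> * Re (P (\<omega> * s))" and "q s = \<sigma> * A * \<omega> * Im (P (\<omega> * s))" for s
  define T where "T = U / \<omega>"
  have T: "0 < T" "\<omega> * T = U" using U \<omega> by (auto simp: T_def)
  have sT: "\<omega> * s \<in> {0..U}" if "s \<in> {0..T}" for s
    using that \<omega> T mult_left_mono[of s T \<omega>] by auto
  have im: "(*) \<omega> ` {0..T} = {0..U}"
  proof -
    have "x \<in> (*) \<omega> ` {0..T}" if "x \<in> {0..U}" for x
      using that \<omega> by (intro image_eqI[of _ _ "x / \<omega>"]) (auto simp: T_def divide_right_mono)
    then show ?thesis using sT by auto
  qed
  have R: "(u s)\<^sup>2 + (v s)\<^sup>2 = A\<^sup>2 * (cmod (Z (\<omega> * s)))\<^sup>2" for s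
    using \<sigma> unfolding u_def v_def cmod_power2 by (auto simp: power_mult_distrib algebra_simps)
  have R4: "(u s)\<^sup>2 + (v s)\<^sup>2 \<le> 1 / 4" if "s \<in> {0..T}" for s
  proof -
    have "cmod (Z (\<omega> * s)) \<le> 2" using sol sT[OF that] unfolding rtbp_solution_def by blast
    then have "(cmod (Z (\<omega> * s)))\<^sup>2 \<le> 2\<^sup>2" by (intro power_mono) auto
    then have "A\<^sup>2 * (cmod (Z (\<omega> * s)))\<^sup>2 \<le> 1 / 32 * 4" using A by (intro mult_mono) auto
    then show ?thesis by (simp add: R)
  qed
  note r = r2_pos_near_P1[OF R4]
  define VU VV where
    "VU s = (12 * ((u s)\<^sup>2 + (v s)\<^sup>2)\<^sup>2 - 4 * c) * u s + 4 * \<mu> * Re (tide_force 1 (Complex (u s) (v s)))"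
    and "VV s = (12 * ((u s)\<^sup>2 + (v s)\<^sup>2)\<^sup>2 - 4 * c) * v s + 4 * \<mu> * Im (tide_force 1 (Complex (u s) (v s)))" for s
  have partials: "deriv (\<lambda>a. reg_potential \<mu> C a (v s)) (u s) = VU s" "deriv (\<lambda>b. reg_potential \<mu> C (u s) b) (v s) = VV s"
    if "s \<in> {0..T}" for s
    using reg_potential_partials[OF r[OF that]] c(2) by (simp_all add: VU_def VV_def)
  have comp: "((\<lambda>s. X (\<omega> * s)) has_vector_derivative \<omega> *\<^sub>R X') (at s within {0..T})"
    if "(X has_vector_derivative X') (at (\<omega> * s) within {0..U})" "s \<in> {0..T}" for X :: "real \<Rightarrow> complex" and X' s
  proof -
    have "((*) \<omega> has_vector_derivative \<omega>) (at s within {0..T})" by (auto intro!: derivative_eq_intros)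
    from vector_diff_chain_within[OF this, of X X'] that show ?thesis by (simp add: im o_def)
  qed
  have ReD: "((\<lambda>x. k * Re (f x)) has_real_derivative k * Re f') (at s within S)"
    and ImD: "((\<lambda>x. k * Im (f x)) has_real_derivative k * Im f') (at s within S)"
    if "(f has_vector_derivative f') (at s within S)" for f :: "real \<Rightarrow> complex" and f' s S k
    using that unfolding has_real_derivative_iff_has_vector_derivative
    by (auto intro!: has_vector_derivative_mult_right intro: bounded_linear.has_vector_derivative[OF bounded_linear_Re]
        bounded_linear.has_vector_derivative[OF bounded_linear_Im])
  have du: "(u has_real_derivative p s) (at s within {0..T})" and dv: "(v has_real_derivative q s) (at s within {0..T})"
    if "s \<in> {0..T}" for s
    using ReD[OF comp[OF dZ(1)[OF sT[OF that]] that], of "\<sigma> * A"] ImD[OF comp[OF dZ(1)[OF sT[OF that]] that], of "\<sigma> * A"]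
    by (simp_all add: u_def[abs_def] v_def[abs_def] p_def q_def mult_ac)
  have dpq: "(p has_real_derivative 8 * ((u s)\<^sup>2 + (v s)\<^sup>2) * q s + VU s) (at s within {0..T})"
    "(q has_real_derivative - 8 * ((u s)\<^sup>2 + (v s)\<^sup>2) * p s + VV s) (at s within {0..T})"
    if s: "s \<in> {0..T}" for s
  proof -
    define z w where "z = Z (\<omega> * s)" and "w = P (\<omega> * s)"
    define N where "N = tide_force (A\<^sup>2) z"
    define X' where "X' = - \<i> * of_real (2 * \<epsilon> * (cmod z)\<^sup>2) * w - z + of_real (3 / 4 * \<epsilon>\<^sup>2 * (cmod z) ^ 4) * z + of_real (\<mu> / 4 * \<epsilon>\<^sup>2) * N"
    have d: "((\<lambda>s. P (\<omega> * s)) has_vector_derivative \<omega> *\<^sub>R X') (at s within {0..T})"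
      using comp[OF dZ(2)[OF sT[OF s]] s] by (simp add: X'_def z_def w_def N_def)
    have tf: "tide_force 1 (Complex (u s) (v s)) = of_real (\<sigma> * A ^ 5) * N"
    proof -
      have "Complex (u s) (v s) = of_real \<sigma> * (of_real A * z)" by (simp add: u_def v_def z_def complex_eq_iff)
      then have "tide_force 1 (Complex (u s) (v s)) = of_real \<sigma> * tide_force 1 (of_real A * z)"
        using \<sigma> by (auto simp: tide_force_minus)
      then show ?thesis using tide_force_scale[OF A(1), of z] by (simp add: N_def mult.assoc)
    qed
    have e1: "\<epsilon> * \<omega>\<^sup>2 = 4 * A\<^sup>2 * \<omega>" using \<epsilon>\<omega> by (simp add: power2_eq_square)
    have e2: "\<epsilon>\<^sup>2 * \<omega>\<^sup>2 = 16 * A ^ 4" unfolding power_mult_distrib[symmetric] \<epsilon>\<omega> by (simp add: power_mult_distrib flip: power_mult)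
    have z4: "(cmod z) ^ 4 = ((cmod z)\<^sup>2)\<^sup>2" by (simp flip: power_mult)
    have p': "\<sigma> * A * \<omega> * Re (\<omega> *\<^sub>R X') = 8 * ((u s)\<^sup>2 + (v s)\<^sup>2) * q s + VU s"
    proof -
      have "\<sigma> * A * \<omega> * Re (\<omega> *\<^sub>R X') = \<sigma> * A * (2 * (\<epsilon> * \<omega>\<^sup>2) * (cmod z)\<^sup>2 * Im w - \<omega>\<^sup>2 * Re z
         + 3 / 4 * (\<epsilon>\<^sup>2 * \<omega>\<^sup>2) * (cmod z) ^ 4 * Re z + \<mu> / 4 * (\<epsilon>\<^sup>2 * \<omega>\<^sup>2) * Re N)"
        unfolding X'_def by (simp add: power2_eq_square[of \<omega>] algebra_simps)
      also have "\<dots> = 8 * ((u s)\<^sup>2 + (v s)\<^sup>2) * q s + VU s"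
        unfolding e1 e2 unfolding \<omega>(2) VU_def R tf z_def[symmetric] z4
        by (simp add: q_def u_def z_def w_def algebra_simps eval_nat_numeral)
      finally show ?thesis .
    qed
    have q': "\<sigma> * A * \<omega> * Im (\<omega> *\<^sub>R X') = - 8 * ((u s)\<^sup>2 + (v s)\<^sup>2) * p s + VV s"
    proof -
      have "\<sigma> * A * \<omega> * Im (\<omega> *\<^sub>R X') = \<sigma> * A * (- 2 * (\<epsilon> * \<omega>\<^sup>2) * (cmod z)\<^sup>2 * Re w - \<omega>\<^sup>2 * Im z
         + 3 / 4 * (\<epsilon>\<^sup>2 * \<omega>\<^sup>2) * (cmod z) ^ 4 * Im z + \<mu> / 4 * (\<epsilon>\<^sup>2 * \<omega>\<^sup>2) * Im N)"
        unfolding X'_def by (simp add: power2_eq_square[of \<omega>] algebra_simps)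
      also have "\<dots> = - 8 * ((u s)\<^sup>2 + (v s)\<^sup>2) * p s + VV s"
        unfolding e1 e2 unfolding \<omega>(2) VV_def R tf z_def[symmetric] z4
        by (simp add: p_def v_def z_def w_def algebra_simps eval_nat_numeral)
      finally show ?thesis .
    qed
    show "(p has_real_derivative 8 * ((u s)\<^sup>2 + (v s)\<^sup>2) * q s + VU s) (at s within {0..T})"
      "(q has_real_derivative - 8 * ((u s)\<^sup>2 + (v s)\<^sup>2) * p s + VV s) (at s within {0..T})"
      using ReD[OF d, of "\<sigma> * A * \<omega>"] ImD[OF d, of "\<sigma> * A * \<omega>"] unfolding p' q'
      by (simp_all add: p_def[abs_def] q_def[abs_def])
  qed
  have A\<omega>: "A * \<omega> = 2 * sqrt (2 * (1 - \<mu>))"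
  proof (rule power2_eq_imp_eq)
    show "(A * \<omega>)\<^sup>2 = (2 * sqrt (2 * (1 - \<mu>)))\<^sup>2"
      unfolding power_mult_distrib \<omega>(2) A(2) using c \<mu> by simp
  qed (use A \<omega> \<mu> in auto)
  have uv0: "u 0 = 0" "v 0 = 0" by (simp_all add: u_def v_def Z0)
  have pq0: "p 0 = 2 * sqrt (2 * (1 - \<mu>)) * cos \<theta>" "q 0 = 2 * sqrt (2 * (1 - \<mu>)) * sin \<theta>"
    unfolding A\<omega>[symmetric] using Y\<theta> by (simp_all add: p_def q_def P0 mult_ac flip: Y\<theta>)
  have energy: "(p s)\<^sup>2 + (q s)\<^sup>2 = 2 * reg_potential \<mu> C (u s) (v s)" if s: "s \<in> {0..T}" for s
  proof -
    \<comment> \<open>The rescaled equations do not contain the Jacobi relation. E is constant along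
      solutions, and it vanishes at s = 0 because the ejection speed was chosen for C.\<close>
    define E where "E s = (p s)\<^sup>2 + (q s)\<^sup>2 - 2 * reg_potential \<mu> C (u s) (v s)" for s
    have "norm (E s - E 0) \<le> 0 - 0"
    proof (rule norm_diff_le_of_deriv[where f = E and \<phi> = "\<lambda>_. 0" and S = "{0..T}" and f' = "\<lambda>_. 0" and \<phi>' = "\<lambda>_. 0"])
      fix x assume "x \<in> {0..s}"
      then have x: "x \<in> {0..T}" using s by auto
      have V: "((\<lambda>s. reg_potential \<mu> C (u s) (v s)) has_real_derivative p x * VU x + q x * VV x) (at x within {0..T})"
        using reg_potential_derivative[OF du[OF x] dv[OF x] r[OF x], of \<mu> C] c(2) by (simp add: VU_def VV_def)
      have "(E has_real_derivative 0) (at x within {0..T})"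
        unfolding E_def[abs_def]
        by (auto intro!: derivative_eq_intros dpq[OF x] V simp: algebra_simps)
      then show "(E has_vector_derivative 0) (at x within {0..T})"
        by (simp add: has_real_derivative_iff_has_vector_derivative)
    qed (use s in auto)
    then have "E s = E 0" by simp
    moreover have "E 0 = 0"
    proof -
      have "(p 0)\<^sup>2 + (q 0)\<^sup>2 = (2 * sqrt (2 * (1 - \<mu>)))\<^sup>2 * ((cos \<theta>)\<^sup>2 + (sin \<theta>)\<^sup>2)"
        unfolding pq0 by (simp only: power_mult_distrib distrib_left)
      also have "\<dots> = 8 * (1 - \<mu>)" using \<mu> by (simp add: power_mult_distrib)
      finally show ?thesis by (simp add: E_def uv0 reg_potential_def)
    qed
    ultimately show ?thesis by (simp add: E_def)
  qed
  have reg: "reg_solution \<mu> C T u v p q"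
    unfolding reg_solution_def
  proof (intro ballI conjI)
    fix s assume s: "s \<in> {0..T}"
    show "r2 \<mu> (levi_civita \<mu> (u s) (v s)) \<noteq> 0" unfolding r2_levi_civita using r[OF s] by simp
    show "(p has_real_derivative 8 * ((u s)\<^sup>2 + (v s)\<^sup>2) * q s + deriv (\<lambda>a. reg_potential \<mu> C a (v s)) (u s)) (at s within {0..T})"
      "(q has_real_derivative - 8 * ((u s)\<^sup>2 + (v s)\<^sup>2) * p s + deriv (\<lambda>b. reg_potential \<mu> C (u s) b) (v s)) (at s within {0..T})"
      unfolding partials[OF s] by (rule dpq[OF s])+
  qed (use du dv energy in auto)
  have g: "r1 \<mu> (levi_civita \<mu> (u s) (v s)) = A\<^sup>2 * (\<lambda>\<tau>. (cmod (Z \<tau>))\<^sup>2) (\<omega> * s + 0)" for s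
    unfolding r1_levi_civita R by simp
  have ivl: "s \<in> {0<..<T} \<longleftrightarrow> \<omega> * s + 0 \<in> {0<..<U}" for s
    using \<omega> T mult_less_cancel_left_pos[of \<omega> s T] by (auto simp: zero_less_mult_iff)
  have nonzero: "\<omega> \<noteq> 0" "0 < A\<^sup>2" using \<omega> A(1) by simp_all
  note max = card_local_max_affine[of \<omega> "\<lambda>s. r1 \<mu> (levi_civita \<mu> (u s) (v s))" "A\<^sup>2" "\<lambda>\<tau>. (cmod (Z \<tau>))\<^sup>2" 0 "{0<..<T}" "{0<..<U}",
      OF nonzero(1) g nonzero(2) ivl]
  have EC': "ejection_collision \<mu> C n \<theta> T u v p q"
    unfolding ejection_collision_def
  proof (intro conjI ballI)
    show "(u s, v s) \<noteq> (0, 0)" if "s \<in> {0<..<T}" for s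
      using nz[of "\<omega> * s"] ivl[of s] that A \<sigma> by (auto simp: u_def v_def complex_eq_iff)
    show "u T = 0" "v T = 0" by (simp_all add: u_def v_def T ZU)
    show "finite {s \<in> {0<..<T}. \<forall>\<^sub>F s' in at s. r1 \<mu> (levi_civita \<mu> (u s') (v s')) \<le> r1 \<mu> (levi_civita \<mu> (u s) (v s))}"
      "card {s \<in> {0<..<T}. \<forall>\<^sub>F s' in at s. r1 \<mu> (levi_civita \<mu> (u s') (v s')) \<le> r1 \<mu> (levi_civita \<mu> (u s) (v s))} = n"
      unfolding max using EC unfolding scaled_EC_def by blast+
  qed (rule T(1) reg uv0 pq0)+
  moreover have "(\<lambda>\<tau>. (\<mu> + A\<^sup>2 * Re ((Z \<tau>)\<^sup>2), A\<^sup>2 * Im ((Z \<tau>)\<^sup>2))) ` {0..U} = (\<lambda>s. levi_civita \<mu> (u s) (v s)) ` {0..T}"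
  proof -
    have "levi_civita \<mu> (u s) (v s) = (\<mu> + A\<^sup>2 * Re ((Z (\<omega> * s))\<^sup>2), A\<^sup>2 * Im ((Z (\<omega> * s))\<^sup>2))" for s
      unfolding u_def v_def by (rule levi_civita_scale[OF \<sigma>])
    then show ?thesis by (simp only: image_image flip: im)
  qed
  ultimately show ?thesis unfolding n_EC_orbit_def by (intro bexI[OF _ \<theta>] exI conjI)
qed

text \<open>Reflection in the \<open>x\<close> axis becomes a symmetry when combined with time reversal.\<close>

lemma n_EC_orbit_reflect:
  assumes \<mu>: "\<mu> < 1" and "n_EC_orbit \<mu> C n \<Gamma>"
  shows "n_EC_orbit \<mu> C n (reflect_x_axis ` \<Gamma>)"
proof -
  obtain \<theta>0 T u v p q where EC: "ejection_collision \<mu> C n \<theta>0 T u v p q"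
    and \<Gamma>: "\<Gamma> = (\<lambda>s. levi_civita \<mu> (u s) (v s)) ` {0..T}"
    using assms(2) unfolding n_EC_orbit_def by (elim bexE exE conjE)
  have T: "0 < T" and reg: "reg_solution \<mu> C T u v p q" and uv: "u 0 = 0" "v 0 = 0" "u T = 0" "v T = 0"
    using EC unfolding ejection_collision_def by auto
  define \<rho> where "\<rho> = 2 * sqrt (2 * (1 - \<mu>))"
  have \<rho>: "0 < \<rho>" "\<rho>\<^sup>2 = 8 * (1 - \<mu>)" using \<mu> by (simp_all add: \<rho>_def power_mult_distrib)
  \<comment> \<open>At the final collision the energy relation gives the same speed as at ejection,
    so the reversed orbit is again an ejection orbit.\<close>
  have "(p T)\<^sup>2 + (q T)\<^sup>2 = \<rho>\<^sup>2"
  proof -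
    have "(p T)\<^sup>2 + (q T)\<^sup>2 = 2 * reg_potential \<mu> C (u T) (v T)" using reg T unfolding reg_solution_def by auto
    then show ?thesis by (simp add: uv \<rho> reg_potential_def)
  qed
  then have "(- p T)\<^sup>2 + (q T)\<^sup>2 = \<rho>\<^sup>2" by simp
  then obtain \<theta> \<sigma> where \<theta>: "\<theta> \<in> {0..<pi}" and \<sigma>: "\<sigma> \<in> {-1, 1 :: real}"
    and pq: "\<sigma> * (- p T) = \<rho> * cos \<theta>" "\<sigma> * q T = \<rho> * sin \<theta>"
    using polar_half_circle[OF \<rho>(1)] by metis
  \<comment> \<open>Reversal negates both velocities and the reflection negates v; hence q, affected
    twice, keeps its sign and p changes it.\<close>
  define u' v' p' q' where "u' s = \<sigma> * u (T - s)" and "v' s = - \<sigma> * v (T - s)"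
    and "p' s = - \<sigma> * p (T - s)" and "q' s = \<sigma> * q (T - s)" for s
  have sq: "(u' s)\<^sup>2 = (u (T - s))\<^sup>2" "(v' s)\<^sup>2 = (v (T - s))\<^sup>2" "(p' s)\<^sup>2 = (p (T - s))\<^sup>2" "(q' s)\<^sup>2 = (q (T - s))\<^sup>2" for s
    using \<sigma> by (auto simp: u'_def v'_def p'_def q'_def)
  have uv': "u' s * v' s = - (u (T - s) * v (T - s))" for s using \<sigma> by (auto simp: u'_def v'_def)
  have lc: "levi_civita \<mu> (u' s) (v' s) = reflect_x_axis (levi_civita \<mu> (u (T - s)) (v (T - s)))" for s
    using uv'[of s] by (simp add: levi_civita_def reflect_x_axis_def sq mult.assoc)
  have im: "(\<lambda>s. T - s) ` {0..T} = {0..T}"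
  proof -
    have "x \<in> (\<lambda>s. T - s) ` {0..T}" if "x \<in> {0..T}" for x
      using that by (intro image_eqI[of _ _ "T - x"]) auto
    then show ?thesis by auto
  qed
  have rev: "((\<lambda>s. f (T - s)) has_real_derivative - f') (at s within {0..T})"
    if "(f has_real_derivative f') (at (T - s) within {0..T})" for f f' s
  proof -
    have "((\<lambda>s. T - s) has_real_derivative - 1) (at s within {0..T})" by (auto intro!: derivative_eq_intros)
    from DERIV_image_chain[OF _ this, of f f'] that show ?thesis by (simp add: im o_def)
  qed
  have reg': "reg_solution \<mu> C T u' v' p' q'"
    unfolding reg_solution_def
  proof (intro ballI)
    fix s assume s: "s \<in> {0..T}"
    define t where "t = T - s"
    have t: "t \<in> {0..T}" using s by (auto simp: t_def)
    have r: "r2 \<mu> (levi_civita \<mu> (u t) (v t)) \<noteq> 0"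
      and du: "(u has_real_derivative p t) (at t within {0..T})"
      and dv: "(v has_real_derivative q t) (at t within {0..T})"
      and dp: "(p has_real_derivative 8 * ((u t)\<^sup>2 + (v t)\<^sup>2) * q t + deriv (\<lambda>a. reg_potential \<mu> C a (v t)) (u t)) (at t within {0..T})"
      and dq: "(q has_real_derivative - 8 * ((u t)\<^sup>2 + (v t)\<^sup>2) * p t + deriv (\<lambda>b. reg_potential \<mu> C (u t) b) (v t)) (at t within {0..T})"
      and en: "(p t)\<^sup>2 + (q t)\<^sup>2 = 2 * reg_potential \<mu> C (u t) (v t)"
      using reg t unfolding reg_solution_def by blast+
    have r2: "r2 \<mu> (levi_civita \<mu> (u' s) (v' s)) = r2 \<mu> (levi_civita \<mu> (u t) (v t))"
      unfolding r2_levi_civita sq t_def ..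
    have V: "reg_potential \<mu> C (u' s) (v' s) = reg_potential \<mu> C (u t) (v t)"
      unfolding reg_potential_def Let_def r2 unfolding lc sq t_def by (simp add: reflect_x_axis_def)
    \<comment> \<open>The expression is the square of the distance to the second primary; as a sum
      of squares it is nonnegative, and \<open>reg_solution\<close> excludes 0.\<close>
    have pos: "0 < 1 + (2 * ((u t)\<^sup>2 - (v t)\<^sup>2) + ((u t)\<^sup>2 + (v t)\<^sup>2)\<^sup>2)"
    proof -
      have "1 + (2 * ((u t)\<^sup>2 - (v t)\<^sup>2) + ((u t)\<^sup>2 + (v t)\<^sup>2)\<^sup>2) = ((u t)\<^sup>2 - (v t)\<^sup>2 + 1)\<^sup>2 + (2 * u t * v t)\<^sup>2"
        by (simp add: power2_eq_square algebra_simps)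
      then have "0 \<le> 1 + (2 * ((u t)\<^sup>2 - (v t)\<^sup>2) + ((u t)\<^sup>2 + (v t)\<^sup>2)\<^sup>2)" by simp
      then show ?thesis using r unfolding r2_levi_civita by simp
    qed
    have C: "Complex (u' s) (v' s) = of_real \<sigma> * cnj (Complex (u t) (v t))"
      by (simp add: u'_def v'_def t_def complex_eq_iff)
    have tf: "tide_force 1 (Complex (u' s) (v' s)) = of_real \<sigma> * cnj (tide_force 1 (Complex (u t) (v t)))"
      unfolding C using \<sigma> by (auto simp: tide_force_minus tide_force_cnj)
    have pos': "0 < 1 + (2 * ((u' s)\<^sup>2 - (v' s)\<^sup>2) + ((u' s)\<^sup>2 + (v' s)\<^sup>2)\<^sup>2)"
      using pos unfolding sq t_def .
    have VU: "deriv (\<lambda>a. reg_potential \<mu> C a (v' s)) (u' s) = \<sigma> * deriv (\<lambda>a. reg_potential \<mu> C a (v t)) (u t)"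
      "deriv (\<lambda>b. reg_potential \<mu> C (u' s) b) (v' s) = - \<sigma> * deriv (\<lambda>b. reg_potential \<mu> C (u t) b) (v t)"
      unfolding reg_potential_partials[OF pos] reg_potential_partials[OF pos'] sq tf t_def[symmetric]
      by (simp_all add: u'_def v'_def t_def[symmetric] algebra_simps)
    have "(u' has_real_derivative \<sigma> * - p t) (at s within {0..T})" "(v' has_real_derivative - \<sigma> * - q t) (at s within {0..T})"
      "(p' has_real_derivative - \<sigma> * - (8 * ((u t)\<^sup>2 + (v t)\<^sup>2) * q t + deriv (\<lambda>a. reg_potential \<mu> C a (v t)) (u t))) (at s within {0..T})"
      "(q' has_real_derivative \<sigma> * - (- 8 * ((u t)\<^sup>2 + (v t)\<^sup>2) * p t + deriv (\<lambda>b. reg_potential \<mu> C (u t) b) (v t))) (at s within {0..T})"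
      unfolding u'_def[abs_def] v'_def[abs_def] p'_def[abs_def] q'_def[abs_def]
      by (intro DERIV_cmult rev[of _ _ s, folded t_def] du dv dp dq)+
    moreover have "\<sigma>\<^sup>2 = 1" using \<sigma> by auto
    ultimately show "r2 \<mu> (levi_civita \<mu> (u' s) (v' s)) \<noteq> 0 \<and>
      (u' has_real_derivative p' s) (at s within {0..T}) \<and> (v' has_real_derivative q' s) (at s within {0..T}) \<and>
      (p' has_real_derivative 8 * ((u' s)\<^sup>2 + (v' s)\<^sup>2) * q' s + deriv (\<lambda>a. reg_potential \<mu> C a (v' s)) (u' s)) (at s within {0..T}) \<and>
      (q' has_real_derivative - 8 * ((u' s)\<^sup>2 + (v' s)\<^sup>2) * p' s + deriv (\<lambda>b. reg_potential \<mu> C (u' s) b) (v' s)) (at s within {0..T}) \<and>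
      (p' s)\<^sup>2 + (q' s)\<^sup>2 = 2 * reg_potential \<mu> C (u' s) (v' s)"
      unfolding VU V r2 using r en
      by (simp add: sq p'_def q'_def t_def[symmetric] power_mult_distrib algebra_simps)
  qed
  have g: "r1 \<mu> (levi_civita \<mu> (u' s) (v' s)) = 1 * (\<lambda>s. r1 \<mu> (levi_civita \<mu> (u s) (v s))) (- 1 * s + T)" for s
    unfolding r1_levi_civita sq by simp
  have ivl: "s \<in> {0<..<T} \<longleftrightarrow> - 1 * s + T \<in> {0<..<T}" for s by auto
  note max = card_local_max_affine[of "- 1" "\<lambda>s. r1 \<mu> (levi_civita \<mu> (u' s) (v' s))" 1
      "\<lambda>s. r1 \<mu> (levi_civita \<mu> (u s) (v s))" T "{0<..<T}" "{0<..<T}", OF _ g _ ivl]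
  have "ejection_collision \<mu> C n \<theta> T u' v' p' q'"
    unfolding ejection_collision_def
  proof (intro conjI ballI)
    fix s assume "s \<in> {0<..<T}"
    then have "(u (T - s), v (T - s)) \<noteq> (0, 0)" using EC unfolding ejection_collision_def by auto
    then show "(u' s, v' s) \<noteq> (0, 0)" using \<sigma> by (auto simp: u'_def v'_def)
  next
    show "p' 0 = 2 * sqrt (2 * (1 - \<mu>)) * cos \<theta>" "q' 0 = 2 * sqrt (2 * (1 - \<mu>)) * sin \<theta>"
      unfolding \<rho>_def[symmetric] using pq by (simp_all add: p'_def q'_def)
  qed (use T reg' max EC in \<open>auto simp: u'_def v'_def uv ejection_collision_def\<close>)
  moreover have "reflect_x_axis ` \<Gamma> = (\<lambda>s. levi_civita \<mu> (u' s) (v' s)) ` {0..T}"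
    unfolding \<Gamma> lc image_image by (subst im[symmetric]) (simp only: image_image)
  ultimately show ?thesis unfolding n_EC_orbit_def by (intro bexI[OF _ \<theta>] exI conjI)
qed

text \<open>Ejection near \<theta> = 0 becomes ejection near \<theta> = \<pi>/2, which in the plane
  is the opposite direction of the x axis. So one existence proof, run with both signs of a, gives
  both symmetric orbits.\<close>

lemma scaled_EC_ii:
  assumes "scaled_EC (- a) \<kappa> \<epsilon> n U Z Y"
  shows "scaled_EC a \<kappa> \<epsilon> n U (\<lambda>\<tau>. \<i> * Z \<tau>) (\<lambda>\<tau>. \<i> * Y \<tau>)"
proof -
  have "rtbp_solution a \<kappa> \<epsilon> U (\<lambda>\<tau>. \<i> * Z \<tau>) (\<lambda>\<tau>. \<i> * Y \<tau>)"
    unfolding rtbp_solution_def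
  proof (intro ballI conjI)
    fix \<tau> assume \<tau>: "\<tau> \<in> {0..U}"
    have b: "cmod (Z \<tau>) \<le> 2" "cmod (Y \<tau>) \<le> 2"
      and d: "((\<lambda>\<tau>. (Z \<tau>, Y \<tau>)) has_vector_derivative rtbp_field (- a) \<kappa> \<epsilon> (Z \<tau>, Y \<tau>)) (at \<tau> within {0..U})"
      using assms \<tau> unfolding scaled_EC_def rtbp_solution_def by blast+
    show "cmod (\<i> * Z \<tau>) \<le> 2" "cmod (\<i> * Y \<tau>) \<le> 2" using b by (simp_all add: norm_mult)
    define F where "F = rtbp_field (- a) \<kappa> \<epsilon> (Z \<tau>, Y \<tau>)"
    have "(Z has_vector_derivative fst F) (at \<tau> within {0..U})" "(Y has_vector_derivative snd F) (at \<tau> within {0..U})"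
      using d unfolding has_vector_derivative_def F_def by (auto dest: has_derivative_fst has_derivative_snd)
    then have "((\<lambda>\<tau>. (\<i> * Z \<tau>, \<i> * Y \<tau>)) has_vector_derivative (\<i> * fst F, \<i> * snd F)) (at \<tau> within {0..U})"
      by (intro has_vector_derivative_Pair has_vector_derivative_mult_right)
    moreover have "rtbp_field a \<kappa> \<epsilon> (\<i> * Z \<tau>, \<i> * Y \<tau>) = (\<i> * fst F, \<i> * snd F)"
      unfolding F_def rtbp_field_def prod.case fst_conv snd_conv tide_force_ii
      by (simp add: norm_mult algebra_simps)
    ultimately show "((\<lambda>\<tau>. (\<i> * Z \<tau>, \<i> * Y \<tau>)) has_vector_derivative rtbp_field a \<kappa> \<epsilon> (\<i> * Z \<tau>, \<i> * Y \<tau>)) (at \<tau> within {0..U})"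
      by simp
  qed
  then show ?thesis using assms unfolding scaled_EC_def by (simp add: norm_mult)
qed

text \<open>The exponents 2/3 in C make c^(3/2) = L^(3/2) n (1 - \<mu>), so both n and \<mu> cancel
  in \<epsilon> n = 4 / L^(3/2). The constant 20 is 4 * 5, from n \<pi> + 1 \<le> 5 n.\<close>

lemma scaling_bounds:
  fixes L \<mu> :: real and n :: nat
  assumes L: "1 \<le> L" and \<mu>: "0 < \<mu>" "\<mu> < 1" and n: "1 \<le> n"
  defines "c \<equiv> L * real n powr (2/3) * (1 - \<mu>) powr (2/3)"
  shows "0 < c" "2 * (1 - \<mu>) / c \<le> 2 / L"
    "4 * (1 - \<mu>) / (c * sqrt c) * (real n * pi + 1) \<le> 20 / L"
proof -
  define m where "m = 1 - \<mu>"
  have m: "0 < m" "m \<le> 1" using \<mu> by (auto simp: m_def)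
  have c: "c = L * real n powr (2/3) * m powr (2/3)" by (simp add: c_def m_def)
  show c0: "0 < c" using L n m by (simp add: c)
  have "m powr 1 \<le> m powr (2/3)" using m by (intro powr_mono') auto
  moreover have "1 \<le> real n powr (2/3)" using n by (simp add: ge_one_powr_ge_zero)
  ultimately have "L * 1 * m \<le> c" unfolding c using L m by (intro mult_mono) auto
  then have "2 * m * L \<le> 2 * c" by (simp add: mult_ac)
  then show "2 * (1 - \<mu>) / c \<le> 2 / L" unfolding m_def[symmetric] using c0 L by (simp add: divide_simps)
  have "c * sqrt c = c powr (3/2)"
  proof -
    have "c powr (3/2) = c powr (1 + 1/2)" by simp
    also have "\<dots> = c * sqrt c" using c0 by (simp only: powr_add powr_half_sqrt) simp
    finally show ?thesis by simp
  qed
  also have "\<dots> = L powr (3/2) * real n * m"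
    unfolding c using L n m by (simp add: powr_mult powr_powr)
  finally have cs: "c * sqrt c = L powr (3/2) * real n * m" .
  have "L powr 1 \<le> L powr (3/2)" using L by (intro powr_mono) auto
  then have L1: "L \<le> L powr (3/2)" using L by simp
  have "4 * m / (c * sqrt c) * (real n * pi + 1) = 4 * (real n * pi + 1) / (L powr (3/2) * real n)"
    unfolding cs using m by simp
  also have "\<dots> \<le> 4 * (real n * 5) / (L powr (3/2) * real n)"
  proof -
    have "real n * pi \<le> real n * 4" using pi_less_4 by (intro mult_left_mono) auto
    moreover have "1 \<le> real n" using n by simp
    ultimately have "real n * pi + 1 \<le> real n * 5" by linarith
    then have "4 * (real n * pi + 1) \<le> 4 * (real n * 5)" by (rule mult_left_mono) simp
    then show ?thesis using L by (intro divide_right_mono) auto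
  qed
  also have "\<dots> = 20 / L powr (3/2)" using n by simp
  also have "\<dots> \<le> 20 / L" using L1 L by (intro divide_left_mono) auto
  finally show "4 * (1 - \<mu>) / (c * sqrt c) * (real n * pi + 1) \<le> 20 / L" by (simp add: m_def)
qed

section \<open>The four orbits\<close>

lemma small_angle:
  fixes x :: real
  assumes "\<bar>x\<bar> \<le> pi / 6"
  shows "5 / 6 \<le> cos x" "\<bar>sin x\<bar> \<le> 1 / 2"
proof -
  have "cos (pi / 6) \<le> cos \<bar>x\<bar>" using assms by (intro cos_monotone_0_pi_le) auto
  then have "sqrt 3 / 2 \<le> cos x" by (simp add: cos_30)
  moreover have "5 / 3 \<le> sqrt (3 :: real)" by (rule real_le_rsqrt) (simp add: power2_eq_square)
  ultimately show "5 / 6 \<le> cos x" by linarith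
  have "sin \<bar>x\<bar> \<le> sin (pi / 6)" using assms by (intro sin_monotone_2pi_le) auto
  moreover have "0 \<le> sin \<bar>x\<bar>" using assms by (intro sin_ge_zero) auto
  ultimately show "\<bar>sin x\<bar> \<le> 1 / 2" by (simp add: sin_30 abs_if split: if_splits)
qed

lemma Re_Im_near_ray:
  assumes "cmod (w - of_real r * cis \<phi>) \<le> 1 / 1000"
  shows "\<bar>Re w - r * cos \<phi>\<bar> \<le> 1 / 1000" "\<bar>Im w - r * sin \<phi>\<bar> \<le> 1 / 1000"
  using order_trans[OF abs_Re_le_cmod assms] order_trans[OF abs_Im_le_cmod assms] by simp_all

text \<open>Distinctness of the four orbits is read off from the squares of Z: each orbit stays near
  a ray, reaching 4/5 along its axis, while the transversal coordinate and the opposite direction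
  stay small.\<close>

lemma ray_along_real_axis:
  assumes "\<And>\<tau>. \<tau> \<in> {0..U} \<Longrightarrow> cmod (w \<tau> - of_real ((sin \<tau>)\<^sup>2) * cis \<phi>) \<le> 1 / 1000"
    and \<phi>: "\<bar>\<phi>\<bar> \<le> pi / 6" and U: "pi / 2 \<le> U"
  shows "4 / 5 \<le> Re (w (pi / 2))" "\<And>\<tau>. \<tau> \<in> {0..U} \<Longrightarrow> - 1 / 10 \<le> Re (w \<tau>)" "\<And>\<tau>. \<tau> \<in> {0..U} \<Longrightarrow> \<bar>Im (w \<tau>)\<bar> \<le> 3 / 5"
proof -
  note c = small_angle[OF \<phi>]
  have "pi / 2 \<in> {0..U}" using U by auto
  from Re_Im_near_ray(1)[OF assms(1)[OF this]] c show "4 / 5 \<le> Re (w (pi / 2))"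
    unfolding sin_pi_half power_one mult_1 by linarith
  fix \<tau> assume \<tau>: "\<tau> \<in> {0..U}"
  note d = Re_Im_near_ray[OF assms(1)[OF \<tau>]]
  have "0 \<le> (sin \<tau>)\<^sup>2 * cos \<phi>" using c by (intro mult_nonneg_nonneg) auto
  then show "- 1 / 10 \<le> Re (w \<tau>)" using d(1) by linarith
  have "\<bar>(sin \<tau>)\<^sup>2 * sin \<phi>\<bar> \<le> 1 * (1 / 2)"
    unfolding abs_mult using c by (intro mult_mono) (auto simp: abs_square_le_1)
  then show "\<bar>Im (w \<tau>)\<bar> \<le> 3 / 5" using d(2) by linarith
qed

text \<open>Squaring removes s, so the mirror image of the point at \<tau> is the point at U -
  \<tau>, and the orbit as a set is mapped to itself.\<close>

lemma reflect_symmetric_image: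
  fixes Z :: "real \<Rightarrow> complex" and U :: real
  assumes s: "s \<in> {-1, 1 :: real}" and Z: "\<And>\<tau>. \<tau> \<in> {0..U} \<Longrightarrow> Z \<tau> = of_real s * cnj (Z (U - \<tau>))"
  shows "reflect_x_axis ` ((\<lambda>\<tau>. (\<mu> + b * Re ((Z \<tau>)\<^sup>2), b * Im ((Z \<tau>)\<^sup>2))) ` {0..U})
    = (\<lambda>\<tau>. (\<mu> + b * Re ((Z \<tau>)\<^sup>2), b * Im ((Z \<tau>)\<^sup>2))) ` {0..U}"
proof -
  have im: "(\<lambda>\<tau>. U - \<tau>) ` {0..U} = {0..U}"
  proof -
    have "x \<in> (\<lambda>\<tau>. U - \<tau>) ` {0..U}" if "x \<in> {0..U}" for x
      using that by (intro image_eqI[of _ _ "U - x"]) auto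
    then show ?thesis by auto
  qed
  have "reflect_x_axis (\<mu> + b * Re ((Z \<tau>)\<^sup>2), b * Im ((Z \<tau>)\<^sup>2)) = (\<mu> + b * Re ((Z (U - \<tau>))\<^sup>2), b * Im ((Z (U - \<tau>))\<^sup>2))"
    if "\<tau> \<in> {0..U}" for \<tau>
  proof -
    define w where "w = (Z (U - \<tau>))\<^sup>2"
    have "(Z \<tau>)\<^sup>2 = cnj w"
      unfolding w_def using s by (subst Z[OF that]) (auto simp: power_mult_distrib)
    then show ?thesis unfolding w_def[symmetric] by (simp add: reflect_x_axis_def)
  qed
  then have "reflect_x_axis ` ((\<lambda>\<tau>. (\<mu> + b * Re ((Z \<tau>)\<^sup>2), b * Im ((Z \<tau>)\<^sup>2))) ` {0..U})
    = (\<lambda>\<tau>. (\<mu> + b * Re ((Z \<tau>)\<^sup>2), b * Im ((Z \<tau>)\<^sup>2))) ` ((\<lambda>\<tau>. U - \<tau>) ` {0..U})"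
    unfolding image_image by (intro image_cong refl)
  then show ?thesis unfolding im .
qed

theorem theorem1:
  "\<exists>Lhat>0. \<forall>L\<ge>Lhat. \<forall>\<mu>\<in>{0<..<1::real}. \<forall>n\<ge>1::nat.
     \<forall>C. C = 3 * \<mu> + L * real n powr (2/3) * (1 - \<mu>) powr (2/3) \<longrightarrow>
       (\<exists>\<alpha> \<beta> \<gamma> \<delta>. distinct [\<alpha>, \<beta>, \<gamma>, \<delta>] \<and>
          n_EC_orbit \<mu> C n \<alpha> \<and> n_EC_orbit \<mu> C n \<beta> \<and>
          n_EC_orbit \<mu> C n \<gamma> \<and> n_EC_orbit \<mu> C n \<delta> \<and>
          reflect_x_axis ` \<alpha> = \<alpha> \<and> reflect_x_axis ` \<gamma> = \<gamma> \<and>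
          reflect_x_axis ` \<beta> = \<delta>)"
proof -
  obtain B where tide: "\<And>a. \<bar>a\<bar> \<le> 1 / 32 \<Longrightarrow> tide B a"
    using tide_uniform by blast
  have B: "1 \<le> B" by (rule tide.B1[OF tide[of 0]]) simp
  \<comment> \<open>The largest value allowed by the smallness condition of \<open>rtbp\<close>; it
    depends on B alone, so the bound 20 / \<eta> for L is independent of \<mu> and n.\<close>
  define \<eta> where "\<eta> = 1 / (100000 * B\<^sup>2)"
  have "1\<^sup>2 \<le> B\<^sup>2" using B by (intro power_mono) auto
  then have \<eta>: "0 < \<eta>" "\<eta> \<le> 1 / 100000" "\<eta> * B\<^sup>2 \<le> 1 / 100000"
    using B by (auto simp: \<eta>_def divide_simps)
  show ?thesis
  proof (intro exI[of _ "20 / \<eta>"] conjI allI impI ballI)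
    show "0 < 20 / \<eta>" using \<eta> by simp
    fix L \<mu> C :: real and n :: nat
    assume L: "20 / \<eta> \<le> L" and "\<mu> \<in> {0<..<1}" and n: "1 \<le> n"
      and C: "C = 3 * \<mu> + L * real n powr (2/3) * (1 - \<mu>) powr (2/3)"
    then have \<mu>: "0 < \<mu>" "\<mu> < 1" by auto
    define c where "c = L * real n powr (2/3) * (1 - \<mu>) powr (2/3)"
    have "1 \<le> 20 / \<eta>" using \<eta> by (simp add: divide_simps)
    then have L1: "1 \<le> L" using L by linarith
    have "20 / L \<le> \<eta>" using L L1 \<eta> by (simp add: divide_simps mult.commute)
    then have L\<eta>: "20 / L \<le> \<eta>" "2 / L \<le> \<eta>" using L1 by (auto simp: divide_simps)
    note sc = scaling_bounds[OF L1 \<mu> n, folded c_def]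
    define A where "A = sqrt (2 * (1 - \<mu>) / c)"
    have A: "0 < A" "A\<^sup>2 = 2 * (1 - \<mu>) / c" using sc(1) \<mu> by (simp_all add: A_def)
    then have A\<eta>: "A\<^sup>2 \<le> \<eta>" using sc(2) L\<eta> by linarith
    then have A32: "A\<^sup>2 \<le> 1 / 32" using \<eta> by linarith
    define \<epsilon> where "\<epsilon> = 2 * A\<^sup>2 / sqrt c"
    have \<epsilon>: "0 < \<epsilon>" using A(1) sc(1) by (simp add: \<epsilon>_def)
    define T where "T = real n * pi + 1"
    have e: "\<epsilon> = 4 * (1 - \<mu>) / (c * sqrt c)" by (simp add: \<epsilon>_def A(2))
    have "\<epsilon> * T \<le> 20 / L" unfolding e T_def by (rule sc(3))
    then have \<epsilon>T: "\<epsilon> * T \<le> \<eta>" using L\<eta>(1) by linarith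
    have nT: "real n * pi + 1 / 2 \<le> T" by (simp add: T_def)
    have rtbp: "rtbp B a (\<mu> / 4) \<epsilon> T \<eta>" if "\<bar>a\<bar> = A\<^sup>2" for a
      by (intro rtbp.intro rtbp_axioms.intro tide) (use that A32 A\<eta> \<mu> \<epsilon> \<epsilon>T \<eta> in \<open>auto simp: T_def\<close>)
    have rtbp_pos: "rtbp B (A\<^sup>2) (\<mu> / 4) \<epsilon> T \<eta>" and rtbp_neg: "rtbp B (- (A\<^sup>2)) (\<mu> / 4) \<epsilon> T \<eta>"
      by (rule rtbp; simp)+
    define \<Phi> where "\<Phi> Z U = (\<lambda>\<tau>. (\<mu> + A\<^sup>2 * Re ((Z \<tau>)\<^sup>2), A\<^sup>2 * Im ((Z \<tau>)\<^sup>2))) ` {0..U}" for Z :: "real \<Rightarrow> complex" and U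
    have EC: "n_EC_orbit \<mu> C n (\<Phi> Z U)" if "scaled_EC (A\<^sup>2) (\<mu> / 4) \<epsilon> n U Z Y" for Z Y U
      unfolding \<Phi>_def by (rule n_EC_orbit_of_scaled_EC[OF \<mu> sc(1) _ A A32 \<epsilon>_def that]) (simp add: C c_def)
    obtain U1 Z1 Y1 \<theta>1 s1 where 1: "scaled_EC (A\<^sup>2) (\<mu> / 4) \<epsilon> n U1 Z1 Y1" "\<theta>1 \<in> {- (pi / 12)..pi / 12}" "pi / 2 \<le> U1"
      "\<And>\<tau>. \<tau> \<in> {0..U1} \<Longrightarrow> cmod ((Z1 \<tau>)\<^sup>2 - of_real ((sin \<tau>)\<^sup>2) * cis (2 * \<theta>1)) \<le> 1 / 1000"
      "s1 \<in> {-1, 1 :: real}" "\<And>\<tau>. \<tau> \<in> {0..U1} \<Longrightarrow> Z1 \<tau> = of_real s1 * cnj (Z1 (U1 - \<tau>))"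
      using rtbp.symmetric_EC_exists[OF rtbp_pos n nT] by blast
    obtain U2 Z2 Y2 \<theta>2 s2 where 2: "scaled_EC (- (A\<^sup>2)) (\<mu> / 4) \<epsilon> n U2 Z2 Y2" "\<theta>2 \<in> {- (pi / 12)..pi / 12}" "pi / 2 \<le> U2"
      "\<And>\<tau>. \<tau> \<in> {0..U2} \<Longrightarrow> cmod ((Z2 \<tau>)\<^sup>2 - of_real ((sin \<tau>)\<^sup>2) * cis (2 * \<theta>2)) \<le> 1 / 1000"
      "s2 \<in> {-1, 1 :: real}" "\<And>\<tau>. \<tau> \<in> {0..U2} \<Longrightarrow> Z2 \<tau> = of_real s2 * cnj (Z2 (U2 - \<tau>))"
      using rtbp.symmetric_EC_exists[OF rtbp_neg n nT] by blast
    obtain U3 Z3 Y3 \<theta>3 where 3: "scaled_EC (A\<^sup>2) (\<mu> / 4) \<epsilon> n U3 Z3 Y3" "\<theta>3 \<in> {pi / 6..pi / 3}" "pi / 2 \<le> U3"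
      "\<And>\<tau>. \<tau> \<in> {0..U3} \<Longrightarrow> cmod ((Z3 \<tau>)\<^sup>2 - of_real ((sin \<tau>)\<^sup>2) * cis (2 * \<theta>3)) \<le> 1 / 1000"
      using rtbp.oblique_EC_exists[OF rtbp_pos n nT] by blast
    define \<alpha> \<beta> \<gamma> where "\<alpha> = \<Phi> Z1 U1" and "\<beta> = \<Phi> Z3 U3" and "\<gamma> = \<Phi> (\<lambda>\<tau>. \<i> * Z2 \<tau>) U2"
    have \<alpha>EC: "n_EC_orbit \<mu> C n \<alpha>" unfolding \<alpha>_def by (rule EC[OF 1(1)])
    have \<beta>EC: "n_EC_orbit \<mu> C n \<beta>" unfolding \<beta>_def by (rule EC[OF 3(1)])
    have \<gamma>EC: "n_EC_orbit \<mu> C n \<gamma>" unfolding \<gamma>_def by (rule EC[OF scaled_EC_ii[OF 2(1)]])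
    have \<alpha>sym: "reflect_x_axis ` \<alpha> = \<alpha>" unfolding \<alpha>_def \<Phi>_def by (rule reflect_symmetric_image[of s1 U1 Z1, OF 1(5,6)])
    have \<gamma>sym: "reflect_x_axis ` \<gamma> = \<gamma>"
      unfolding \<gamma>_def \<Phi>_def
    \<comment> \<open>Conjugation turns i into - i, so the factor i changes the sign of the
      symmetry.\<close>
    proof (rule reflect_symmetric_image[of "- s2" U2 "\<lambda>\<tau>. \<i> * Z2 \<tau>"])
      show "- s2 \<in> {-1, 1}" using 2(5) by auto
      fix \<tau> assume "\<tau> \<in> {0..U2}"
      from 2(6)[OF this] have "\<i> * Z2 \<tau> = \<i> * (of_real s2 * cnj (Z2 (U2 - \<tau>)))" by (rule arg_cong)
      then show "\<i> * Z2 \<tau> = of_real (- s2) * cnj (\<i> * Z2 (U2 - \<tau>))" by (simp add: mult_ac)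
    qed
    \<comment> \<open>The coordinates of the plane centred at the first primary and in units of A^2:
      the real and imaginary part of z^2.\<close>
    define X W where "X p = (fst p - \<mu>) / A\<^sup>2" and "W p = snd p / A\<^sup>2" for p :: "real \<times> real"
    have XW: "X (\<mu> + A\<^sup>2 * x, A\<^sup>2 * y) = x" "W (\<mu> + A\<^sup>2 * x, A\<^sup>2 * y) = y" for x y
      using A(1) by (simp_all add: X_def W_def)
    have XWr: "X (reflect_x_axis p) = X p" "W (reflect_x_axis p) = - W p" for p
      by (simp_all add: X_def W_def reflect_x_axis_def)
    have half: "pi / 2 \<in> {0..U1}" "pi / 2 \<in> {0..U2}" "pi / 2 \<in> {0..U3}" using 1(3) 2(3) 3(3) by auto
    have \<phi>1: "\<bar>2 * \<theta>1\<bar> \<le> pi / 6" by (rule abs_leI) (use 1(2) in auto)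
    have \<phi>2: "\<bar>2 * \<theta>2\<bar> \<le> pi / 6" by (rule abs_leI) (use 2(2) in auto)
    have \<phi>3: "\<bar>2 * \<theta>3 - pi / 2\<bar> \<le> pi / 6" by (rule abs_leI) (use 3(2) in auto)
    note r1 = ray_along_real_axis[of U1 "\<lambda>\<tau>. (Z1 \<tau>)\<^sup>2", OF 1(4) \<phi>1 1(3)]
    note r2 = ray_along_real_axis[of U2 "\<lambda>\<tau>. (Z2 \<tau>)\<^sup>2", OF 2(4) \<phi>2 2(3)]
    \<comment> \<open>Here z^2 is near the positive imaginary axis; turning it by - i brings it to
      the real axis, so that the same ray lemma applies with W in the role of X.\<close>
    have "cmod (- \<i> * (Z3 \<tau>)\<^sup>2 - of_real ((sin \<tau>)\<^sup>2) * cis (2 * \<theta>3 - pi / 2)) \<le> 1 / 1000" if "\<tau> \<in> {0..U3}" for \<tau>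
    proof -
      have "cis (2 * \<theta>3 - pi / 2) = - \<i> * cis (2 * \<theta>3)" by (simp add: complex_eq_iff cos_diff sin_diff)
      then have "- \<i> * (Z3 \<tau>)\<^sup>2 - of_real ((sin \<tau>)\<^sup>2) * cis (2 * \<theta>3 - pi / 2) = - \<i> * ((Z3 \<tau>)\<^sup>2 - of_real ((sin \<tau>)\<^sup>2) * cis (2 * \<theta>3))"
        by (simp add: algebra_simps)
      then show ?thesis using 3(4)[OF that] by (simp only: norm_mult) simp
    qed
    note r3 = ray_along_real_axis[of U3 "\<lambda>\<tau>. - \<i> * (Z3 \<tau>)\<^sup>2", OF this \<phi>3 3(3)]
    have a1: "\<exists>p\<in>\<alpha>. 4 / 5 \<le> X p"
      unfolding \<alpha>_def \<Phi>_def using half(1) r1(1) XW(1) by (intro bexI[OF _ imageI[OF half(1)]]) simp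
    have c1: "\<exists>p\<in>\<gamma>. X p \<le> - 4 / 5"
      unfolding \<gamma>_def \<Phi>_def using r2(1)
      by (intro bexI[OF _ imageI[OF half(2)]]) (simp only: XW(1), simp add: power_mult_distrib)
    have c2: "\<forall>p\<in>\<gamma>. X p \<le> 1 / 10"
      unfolding \<gamma>_def \<Phi>_def ball_simps XW(1) using r2(2) by (simp add: power_mult_distrib minus_le_iff)
    have b1: "\<exists>p\<in>\<beta>. 4 / 5 \<le> W p"
      unfolding \<beta>_def \<Phi>_def using r3(1) XW(2) by (intro bexI[OF _ imageI[OF half(3)]]) simp
    have b2: "\<forall>p\<in>\<beta>. - 1 / 10 \<le> W p" "\<forall>p\<in>\<beta>. \<bar>X p\<bar> \<le> 3 / 5"
      unfolding \<beta>_def \<Phi>_def using r3(2,3) XW by auto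
    have d1: "\<forall>p\<in>reflect_x_axis ` \<beta>. W p \<le> 1 / 10" "\<forall>p\<in>reflect_x_axis ` \<beta>. \<bar>X p\<bar> \<le> 3 / 5"
      using b2 by (auto simp: XWr minus_le_iff)
    \<comment> \<open>\<alpha> reaches X \<ge> 4/5 and \<gamma> reaches X \<le> -4/5, while \<beta>
      and its mirror image keep |X| \<le> 3/5; these two are separated by the sign of W.\<close>
    have "\<alpha> \<noteq> \<beta>" "\<alpha> \<noteq> reflect_x_axis ` \<beta>" using a1 b2(2) d1(2) by fastforce+
    moreover have "\<gamma> \<noteq> \<beta>" "\<gamma> \<noteq> reflect_x_axis ` \<beta>" using c1 b2(2) d1(2) by fastforce+
    moreover have "\<alpha> \<noteq> \<gamma>" using a1 c2 by fastforce
    moreover have "\<beta> \<noteq> reflect_x_axis ` \<beta>" using b1 d1(1) by fastforce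
    ultimately have "distinct [\<alpha>, \<beta>, \<gamma>, reflect_x_axis ` \<beta>]" by auto
    then show "\<exists>\<alpha> \<beta> \<gamma> \<delta>. distinct [\<alpha>, \<beta>, \<gamma>, \<delta>] \<and>
          n_EC_orbit \<mu> C n \<alpha> \<and> n_EC_orbit \<mu> C n \<beta> \<and>
          n_EC_orbit \<mu> C n \<gamma> \<and> n_EC_orbit \<mu> C n \<delta> \<and>
          reflect_x_axis ` \<alpha> = \<alpha> \<and> reflect_x_axis ` \<gamma> = \<gamma> \<and>
          reflect_x_axis ` \<beta> = \<delta>"
      using \<alpha>EC \<beta>EC \<gamma>EC \<alpha>sym \<gamma>sym n_EC_orbit_reflect[OF \<mu>(2) \<beta>EC] by blast
  qed
qed

end
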